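(* Let $X=X_1\times X_2\times\cdots\times X_r$ be a product of locally compact Hadamard spaces and let $\Gamma<\mathrm{Is}(X_1)\times\cdots\times\mathrm{Is}(X_r)$ be a group which acts properly discontinuously on $X$ and contains two independent regular axial isometries. Then the Furstenberg limit set is minimal, i.e. $F_\Gamma$ is the smallest non-empty, $\Gamma$-invariant closed subset of $\partial^F X$.
   Context: A Hadamard space is a complete CAT(0) metric space. Let $(X_i,d_i)$, $i=1,\ldots,r$, be locally compact Hadamard spaces, and let $X=X_1\times\cdots\times X_r$ carry the product distance $d=\sqrt{d_1^2+\cdots+d_r^2}$. $\partial X_i$ and $\partial X$ denote the geometric boundaries with the cone topology. An isometry $h$ of a Hadamard space $Y$ is axial if there are $l(h)>0$ and a geodesic line $\sigma:\mathbb{R}\to Y$ (an axis) with $h(\sigma(t))=\sigma(t+l(h))$ for all $t$; set $h^+=\sigma(\infty)$, $h^-=\sigma(-\infty)$. It is rank one if it has an axis which does not bound a flat half-plane (a closed convex subset of $Y$ isometric to $[0,\infty)\times\mathbb{R}$ whose boundary line is the axis). Two rank one isometries $g,h$ are independent if $\{g^+,g^-\}\cap\{h^+,h^-\}=\emptyset$. An element $h=(h_1,\ldots,h_r)\in\mathrm{Is}(X_1)\times\cdots\times\mathrm{Is}(X_r)$ is regular axial if each $h_i$ is a rank one isometry of $X_i$; two regular axial isometries $g,h$ are independent if $g_i,h_i$ are independent for all $i$. The Furstenberg boundary is $\partial^F X=\partial X_1\times\cdots\times\partial X_r$ with the product topology and componentwise action. Every geodesic ray in $X$ has the form $\sigma(t)=(\sigma_1(\theta_1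 t),\ldots,\sigma_r(\theta_r t))$ with $\sigma_i$ geodesic rays in $X_i$, $\theta_i\ge 0$, $\sum\theta_i^2=1$; $\theta$ is its slope and depends only on the class of $\sigma$. The regular boundary $\partial X^{reg}$ is the set of points of $\partial X$ whose slope has all coordinates positive, and $\pi^F:\partial X^{reg}\to\partial^F X$ maps the class of $\sigma$ to $(\sigma_1(\infty),\ldots,\sigma_r(\infty))$. $L_\Gamma=\overline{\Gamma\cdot x}\cap\partial X$ ($x\in X$ arbitrary) is the geometric limit set and $F_\Gamma=\pi^F(L_\Gamma\cap\partial X^{reg})$ is the Furstenberg limit set. *)

theory Defs
  imports "HOL-Analysis.Analysis" "HOL-Algebra.Bij" "HOL-Algebra.Product_Groups"
begin

text \<open>
  Metric spaces are given by a carrier \<open>M\<close> and a distance \<open>d\<close>, as in the locale \<open>Metric_space\<close>,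
  so that the factors of a product may be different spaces over one ambient type.
\<close>

section \<open>Hadamard spaces\<close>

definition geodesic_segment ::
  "'a set \<Rightarrow> ('a \<Rightarrow> 'a \<Rightarrow> real) \<Rightarrow> (real \<Rightarrow> 'a) \<Rightarrow> 'a \<Rightarrow> 'a \<Rightarrow> bool" where
  "geodesic_segment M d \<gamma> x y \<longleftrightarrow>
     x \<in> M \<and> y \<in> M \<and> \<gamma> 0 = x \<and> \<gamma> (d x y) = y \<and>
     (\<forall>t\<in>{0..d x y}. \<gamma> t \<in> M) \<and>
     (\<forall>s\<in>{0..d x y}. \<forall>t\<in>{0..d x y}. d (\<gamma> s) (\<gamma> t) = \<bar>s - t\<bar>)"

definition geodesic_space :: "'a set \<Rightarrow> ('a \<Rightarrow> 'a \<Rightarrow> real) \<Rightarrow> bool" where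
  "geodesic_space M d \<longleftrightarrow> (\<forall>x\<in>M. \<forall>y\<in>M. \<exists>\<gamma>. geodesic_segment M d \<gamma> x y)"

text \<open>
  The comparison inequality for geodesic triangles with vertices \<open>p, q, r\<close> and comparison triangle
  \<open>p', q', r'\<close> in the Euclidean plane. Two points on different sides of a triangle lie on two sides
  that share a vertex, here called \<open>p\<close>; for two points on the same side the inequality is an
  equality. The third side exists because the space is geodesic. The points \<open>u\<close> and \<open>v\<close> are the
  comparison points of \<open>\<alpha> s\<close> and \<open>\<beta> t\<close>.
\<close>

definition CAT0_space :: "'a set \<Rightarrow> ('a \<Rightarrow> 'a \<Rightarrow> real) \<Rightarrow> bool" where
  "CAT0_space M d \<longleftrightarrow> Metric_space M d \<and> geodesic_space M d \<and>
     (\<forall>p\<in>M. \<forall>q\<in>M. \<forall>r\<in>M. \<forall>\<alpha> \<beta>.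
        geodesic_segment M d \<alpha> p q \<and> geodesic_segment M d \<beta> p r \<longrightarrow>
        (\<forall>p' q' r' :: real^2.
           dist p' q' = d p q \<and> dist p' r' = d p r \<and> dist q' r' = d q r \<longrightarrow>
           (\<forall>s\<in>{0..d p q}. \<forall>t\<in>{0..d p r}.
              \<forall>u\<in>closed_segment p' q'. \<forall>v\<in>closed_segment p' r'.
                dist p' u = s \<and> dist p' v = t \<longrightarrow> d (\<alpha> s) (\<beta> t) \<le> dist u v)))"

definition hadamard_space :: "'a set \<Rightarrow> ('a \<Rightarrow> 'a \<Rightarrow> real) \<Rightarrow> bool" where
  "hadamard_space M d \<longleftrightarrow> CAT0_space M d \<and> Metric_space.mcomplete M d"

section \<open>The geometric boundary and the cone topology\<close>

text \<open>Rays are functions on \<open>\<real>\<close> of which only the values at nonnegative arguments are relevant.\<close>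

definition geodesic_ray :: "'a set \<Rightarrow> ('a \<Rightarrow> 'a \<Rightarrow> real) \<Rightarrow> (real \<Rightarrow> 'a) \<Rightarrow> bool" where
  "geodesic_ray M d \<sigma> \<longleftrightarrow>
     (\<forall>t\<ge>0. \<sigma> t \<in> M) \<and> (\<forall>s\<ge>0. \<forall>t\<ge>0. d (\<sigma> s) (\<sigma> t) = \<bar>s - t\<bar>)"

definition geodesic_line :: "'a set \<Rightarrow> ('a \<Rightarrow> 'a \<Rightarrow> real) \<Rightarrow> (real \<Rightarrow> 'a) \<Rightarrow> bool" where
  "geodesic_line M d \<sigma> \<longleftrightarrow> (\<forall>t. \<sigma> t \<in> M) \<and> (\<forall>s t. d (\<sigma> s) (\<sigma> t) = \<bar>s - t\<bar>)"

definition asymptotic :: "('a \<Rightarrow> 'a \<Rightarrow> real) \<Rightarrow> (real \<Rightarrow> 'a) \<Rightarrow> (real \<Rightarrow> 'a) \<Rightarrow> bool" where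
  "asymptotic d \<sigma> \<tau> \<longleftrightarrow> (\<exists>C. \<forall>t\<ge>0. d (\<sigma> t) (\<tau> t) \<le> C)"

text \<open>\<open>ray_end M d \<sigma>\<close> is the point \<open>\<sigma>(\<infinity>)\<close>, the class of all rays asymptotic to \<open>\<sigma>\<close>.\<close>

definition ray_end :: "'a set \<Rightarrow> ('a \<Rightarrow> 'a \<Rightarrow> real) \<Rightarrow> (real \<Rightarrow> 'a) \<Rightarrow> (real \<Rightarrow> 'a) set" where
  "ray_end M d \<sigma> = {\<tau>. geodesic_ray M d \<tau> \<and> asymptotic d \<sigma> \<tau>}"

definition geom_boundary :: "'a set \<Rightarrow> ('a \<Rightarrow> 'a \<Rightarrow> real) \<Rightarrow> (real \<Rightarrow> 'a) set set" where
  "geom_boundary M d = ray_end M d ` {\<sigma>. geodesic_ray M d \<sigma>}"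

text \<open>
  The compactification \<open>M \<union> \<partial>M\<close> is a subset of a sum type: \<open>Inl\<close> for \<open>M\<close>, \<open>Inr\<close> for \<open>\<partial>M\<close>. The set
  \<open>cone_nbhd M d c R \<epsilon>\<close> consists of the points outside the ball of radius \<open>R\<close> about \<open>c 0\<close> such
  that the geodesic from \<open>c 0\<close> towards that point passes at time \<open>R\<close> within \<open>\<epsilon>\<close> of \<open>c R\<close>.
  All base points \<open>c 0\<close> are used; a fixed one gives the same topology.
\<close>

definition cone_nbhd ::
  "'a set \<Rightarrow> ('a \<Rightarrow> 'a \<Rightarrow> real) \<Rightarrow> (real \<Rightarrow> 'a) \<Rightarrow> real \<Rightarrow> real \<Rightarrow> ('a + (real \<Rightarrow> 'a) set) set" where
  "cone_nbhd M d c R \<epsilon> =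
     Inl ` {y \<in> M. R < d (c 0) y \<and>
              (\<exists>\<gamma>. geodesic_segment M d \<gamma> (c 0) y \<and> d (\<gamma> R) (c R) < \<epsilon>)} \<union>
     Inr ` {\<xi> \<in> geom_boundary M d. \<exists>\<sigma>\<in>\<xi>. \<sigma> 0 = c 0 \<and> d (\<sigma> R) (c R) < \<epsilon>}"

definition cone_topology ::
  "'a set \<Rightarrow> ('a \<Rightarrow> 'a \<Rightarrow> real) \<Rightarrow> ('a + (real \<Rightarrow> 'a) set) topology" where
  "cone_topology M d = topology_generated_by
     ({Inl ` U |U. openin (Metric_space.mtopology M d) U} \<union>
      {cone_nbhd M d c R \<epsilon> |c R \<epsilon>. geodesic_ray M d c \<and> 0 < R \<and> 0 < \<epsilon>})"

definition boundary_topology ::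
  "'a set \<Rightarrow> ('a \<Rightarrow> 'a \<Rightarrow> real) \<Rightarrow> (real \<Rightarrow> 'a) set topology" where
  "boundary_topology M d = pullback_topology (geom_boundary M d) Inr (cone_topology M d)"

section \<open>Isometries\<close>

definition isometry_group :: "'a set \<Rightarrow> ('a \<Rightarrow> 'a \<Rightarrow> real) \<Rightarrow> ('a \<Rightarrow> 'a) monoid" where
  "isometry_group M d =
     (BijGroup M)\<lparr>carrier := {f \<in> Bij M. \<forall>x\<in>M. \<forall>y\<in>M. d (f x) (f y) = d x y}\<rparr>"

text \<open>
  The action \<open>\<sigma>(\<infinity>) \<mapsto> (h \<circ> \<sigma>)(\<infinity>)\<close>. The union is over equal sets. The image of
  \<open>\<xi>\<close> under \<open>\<sigma> \<mapsto> h \<circ> \<sigma>\<close> would not contain every representative, as values at negative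
  arguments are arbitrary.
\<close>

definition boundary_act ::
  "'a set \<Rightarrow> ('a \<Rightarrow> 'a \<Rightarrow> real) \<Rightarrow> ('a \<Rightarrow> 'a) \<Rightarrow> (real \<Rightarrow> 'a) set \<Rightarrow> (real \<Rightarrow> 'a) set" where
  "boundary_act M d h \<xi> = (\<Union>\<sigma>\<in>\<xi>. ray_end M d (h \<circ> \<sigma>))"

definition is_axis ::
  "'a set \<Rightarrow> ('a \<Rightarrow> 'a \<Rightarrow> real) \<Rightarrow> ('a \<Rightarrow> 'a) \<Rightarrow> (real \<Rightarrow> 'a) \<Rightarrow> bool" where
  "is_axis M d h \<sigma> \<longleftrightarrow> geodesic_line M d \<sigma> \<and> (\<exists>l>0. \<forall>t. h (\<sigma> t) = \<sigma> (t + l))"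

text \<open>
  The end points \<open>h\<^sup>+\<close> and \<open>h\<^sup>-\<close> of an axial isometry. They do not depend on the axis, since any two
  axes of \<open>h\<close> have the same \<open>l\<close> and bounded distance from each other.
\<close>

definition attracting_point ::
  "'a set \<Rightarrow> ('a \<Rightarrow> 'a \<Rightarrow> real) \<Rightarrow> ('a \<Rightarrow> 'a) \<Rightarrow> (real \<Rightarrow> 'a) set" where
  "attracting_point M d h = (THE \<xi>. \<exists>\<sigma>. is_axis M d h \<sigma> \<and> \<xi> = ray_end M d \<sigma>)"

definition repelling_point ::
  "'a set \<Rightarrow> ('a \<Rightarrow> 'a \<Rightarrow> real) \<Rightarrow> ('a \<Rightarrow> 'a) \<Rightarrow> (real \<Rightarrow> 'a) set" where
  "repelling_point M d h = (THE \<xi>. \<exists>\<sigma>. is_axis M d h \<sigma> \<and> \<xi> = ray_end M d (\<lambda>t. \<sigma> (- t)))"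

definition geodesically_convex :: "'a set \<Rightarrow> ('a \<Rightarrow> 'a \<Rightarrow> real) \<Rightarrow> 'a set \<Rightarrow> bool" where
  "geodesically_convex M d F \<longleftrightarrow>
     (\<forall>x\<in>F. \<forall>y\<in>F. \<forall>\<gamma>. geodesic_segment M d \<gamma> x y \<longrightarrow> \<gamma> ` {0..d x y} \<subseteq> F)"

definition bounds_flat_half_plane ::
  "'a set \<Rightarrow> ('a \<Rightarrow> 'a \<Rightarrow> real) \<Rightarrow> (real \<Rightarrow> 'a) \<Rightarrow> bool" where
  "bounds_flat_half_plane M d \<sigma> \<longleftrightarrow>
     (\<exists>F (\<phi> :: real \<times> real \<Rightarrow> 'a).
        F \<subseteq> M \<and> closedin (Metric_space.mtopology M d) F \<and> geodesically_convex M d F \<and>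
        \<phi> ` ({0..} \<times> UNIV) = F \<and>
        (\<forall>p\<in>{0..} \<times> UNIV. \<forall>q\<in>{0..} \<times> UNIV. d (\<phi> p) (\<phi> q) = dist p q) \<and>
        \<phi> ` ({0} \<times> UNIV) = range \<sigma>)"

definition rank_one :: "'a set \<Rightarrow> ('a \<Rightarrow> 'a \<Rightarrow> real) \<Rightarrow> ('a \<Rightarrow> 'a) \<Rightarrow> bool" where
  "rank_one M d h \<longleftrightarrow> h \<in> carrier (isometry_group M d) \<and>
     (\<exists>\<sigma>. is_axis M d h \<sigma> \<and> \<not> bounds_flat_half_plane M d \<sigma>)"

definition independent_rank_one ::
  "'a set \<Rightarrow> ('a \<Rightarrow> 'a \<Rightarrow> real) \<Rightarrow> ('a \<Rightarrow> 'a) \<Rightarrow> ('a \<Rightarrow> 'a) \<Rightarrow> bool" where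
  "independent_rank_one M d g h \<longleftrightarrow> rank_one M d g \<and> rank_one M d h \<and>
     {attracting_point M d g, repelling_point M d g} \<inter>
     {attracting_point M d h, repelling_point M d h} = {}"

section \<open>Products\<close>

text \<open>\<open>I\<close> is the index set, \<open>X i\<close> and \<open>d i\<close> are the carrier and the distance of the \<open>i\<close>th factor.\<close>

definition prod_space :: "'i set \<Rightarrow> ('i \<Rightarrow> 'a set) \<Rightarrow> ('i \<Rightarrow> 'a) set" where
  "prod_space I X = (\<Pi>\<^sub>E i\<in>I. X i)"

definition prod_distance ::
  "'i set \<Rightarrow> ('i \<Rightarrow> 'a \<Rightarrow> 'a \<Rightarrow> real) \<Rightarrow> ('i \<Rightarrow> 'a) \<Rightarrow> ('i \<Rightarrow> 'a) \<Rightarrow> real" where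
  "prod_distance I d x y = sqrt (\<Sum>i\<in>I. (d i (x i) (y i))\<^sup>2)"

definition prod_isometries ::
  "'i set \<Rightarrow> ('i \<Rightarrow> 'a set) \<Rightarrow> ('i \<Rightarrow> 'a \<Rightarrow> 'a \<Rightarrow> real) \<Rightarrow> ('i \<Rightarrow> 'a \<Rightarrow> 'a) monoid" where
  "prod_isometries I X d = product_group I (\<lambda>i. isometry_group (X i) (d i))"

definition prod_act :: "'i set \<Rightarrow> ('i \<Rightarrow> 'a \<Rightarrow> 'a) \<Rightarrow> ('i \<Rightarrow> 'a) \<Rightarrow> ('i \<Rightarrow> 'a)" where
  "prod_act I h x = (\<lambda>i\<in>I. h i (x i))"

definition properly_discontinuous ::
  "'i set \<Rightarrow> ('i \<Rightarrow> 'a set) \<Rightarrow> ('i \<Rightarrow> 'a \<Rightarrow> 'a \<Rightarrow> real) \<Rightarrow> ('i \<Rightarrow> 'a \<Rightarrow> 'a) set \<Rightarrow> bool" where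
  "properly_discontinuous I X d \<Gamma> \<longleftrightarrow>
     (\<forall>K. compactin (Metric_space.mtopology (prod_space I X) (prod_distance I d)) K \<longrightarrow>
        finite {h \<in> \<Gamma>. prod_act I h ` K \<inter> K \<noteq> {}})"

definition regular_axial ::
  "'i set \<Rightarrow> ('i \<Rightarrow> 'a set) \<Rightarrow> ('i \<Rightarrow> 'a \<Rightarrow> 'a \<Rightarrow> real) \<Rightarrow> ('i \<Rightarrow> 'a \<Rightarrow> 'a) \<Rightarrow> bool" where
  "regular_axial I X d h \<longleftrightarrow> h \<in> carrier (prod_isometries I X d) \<and>
     (\<forall>i\<in>I. rank_one (X i) (d i) (h i))"

definition independent_regular_axial ::
  "'i set \<Rightarrow> ('i \<Rightarrow> 'a set) \<Rightarrow> ('i \<Rightarrow> 'a \<Rightarrow> 'a \<Rightarrow> real) \<Rightarrow>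
     ('i \<Rightarrow> 'a \<Rightarrow> 'a) \<Rightarrow> ('i \<Rightarrow> 'a \<Rightarrow> 'a) \<Rightarrow> bool" where
  "independent_regular_axial I X d g h \<longleftrightarrow> regular_axial I X d g \<and> regular_axial I X d h \<and>
     (\<forall>i\<in>I. independent_rank_one (X i) (d i) (g i) (h i))"

section \<open>The Furstenberg boundary and limit sets\<close>

definition furstenberg_topology ::
  "'i set \<Rightarrow> ('i \<Rightarrow> 'a set) \<Rightarrow> ('i \<Rightarrow> 'a \<Rightarrow> 'a \<Rightarrow> real) \<Rightarrow> ('i \<Rightarrow> (real \<Rightarrow> 'a) set) topology" where
  "furstenberg_topology I X d = product_topology (\<lambda>i. boundary_topology (X i) (d i)) I"

definition furstenberg_act ::
  "'i set \<Rightarrow> ('i \<Rightarrow> 'a set) \<Rightarrow> ('i \<Rightarrow> 'a \<Rightarrow> 'a \<Rightarrow> real) \<Rightarrow> ('i \<Rightarrow> 'a \<Rightarrow> 'a) \<Rightarrow>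
     ('i \<Rightarrow> (real \<Rightarrow> 'a) set) \<Rightarrow> ('i \<Rightarrow> (real \<Rightarrow> 'a) set)" where
  "furstenberg_act I X d h \<xi> = (\<lambda>i\<in>I. boundary_act (X i) (d i) (h i) (\<xi> i))"

text \<open>\<open>\<sigma>(t) = (\<rho>\<^sub>i (\<theta>\<^sub>i t))\<^sub>i\<close>, where \<open>\<theta>\<close> is the slope of the ray \<open>\<sigma>\<close> in the product.\<close>

definition ray_decomposition ::
  "'i set \<Rightarrow> ('i \<Rightarrow> 'a set) \<Rightarrow> ('i \<Rightarrow> 'a \<Rightarrow> 'a \<Rightarrow> real) \<Rightarrow>
     (real \<Rightarrow> 'i \<Rightarrow> 'a) \<Rightarrow> ('i \<Rightarrow> real) \<Rightarrow> ('i \<Rightarrow> real \<Rightarrow> 'a) \<Rightarrow> bool" where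
  "ray_decomposition I X d \<sigma> \<theta> \<rho> \<longleftrightarrow>
     (\<forall>i\<in>I. geodesic_ray (X i) (d i) (\<rho> i) \<and> 0 \<le> \<theta> i) \<and> (\<Sum>i\<in>I. (\<theta> i)\<^sup>2) = 1 \<and>
     (\<forall>t\<ge>0. \<sigma> t = (\<lambda>i\<in>I. \<rho> i (\<theta> i * t)))"

definition has_slope ::
  "'i set \<Rightarrow> ('i \<Rightarrow> 'a set) \<Rightarrow> ('i \<Rightarrow> 'a \<Rightarrow> 'a \<Rightarrow> real) \<Rightarrow>
     (real \<Rightarrow> 'i \<Rightarrow> 'a) set \<Rightarrow> ('i \<Rightarrow> real) \<Rightarrow> bool" where
  "has_slope I X d \<xi> \<theta> \<longleftrightarrow> (\<exists>\<sigma>\<in>\<xi>. \<exists>\<rho>. ray_decomposition I X d \<sigma> \<theta> \<rho>)"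

definition regular_boundary ::
  "'i set \<Rightarrow> ('i \<Rightarrow> 'a set) \<Rightarrow> ('i \<Rightarrow> 'a \<Rightarrow> 'a \<Rightarrow> real) \<Rightarrow> (real \<Rightarrow> 'i \<Rightarrow> 'a) set set" where
  "regular_boundary I X d =
     {\<xi> \<in> geom_boundary (prod_space I X) (prod_distance I d).
        \<exists>\<theta>. has_slope I X d \<xi> \<theta> \<and> (\<forall>i\<in>I. 0 < \<theta> i)}"

text \<open>Only meaningful on the regular boundary, where the class of \<open>\<rho> i\<close> is determined by \<open>\<xi>\<close>.\<close>

definition furstenberg_proj ::
  "'i set \<Rightarrow> ('i \<Rightarrow> 'a set) \<Rightarrow> ('i \<Rightarrow> 'a \<Rightarrow> 'a \<Rightarrow> real) \<Rightarrow>
     (real \<Rightarrow> 'i \<Rightarrow> 'a) set \<Rightarrow> ('i \<Rightarrow> (real \<Rightarrow> 'a) set)" where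
  "furstenberg_proj I X d \<xi> =
     (THE \<eta>. \<exists>\<sigma>\<in>\<xi>. \<exists>\<theta> \<rho>. ray_decomposition I X d \<sigma> \<theta> \<rho> \<and>
               \<eta> = (\<lambda>i\<in>I. ray_end (X i) (d i) (\<rho> i)))"

definition geometric_limit_set ::
  "'i set \<Rightarrow> ('i \<Rightarrow> 'a set) \<Rightarrow> ('i \<Rightarrow> 'a \<Rightarrow> 'a \<Rightarrow> real) \<Rightarrow>
     ('i \<Rightarrow> 'a \<Rightarrow> 'a) set \<Rightarrow> ('i \<Rightarrow> 'a) \<Rightarrow> (real \<Rightarrow> 'i \<Rightarrow> 'a) set set" where
  "geometric_limit_set I X d \<Gamma> x =
     {\<xi> \<in> geom_boundary (prod_space I X) (prod_distance I d).
        Inr \<xi> \<in> cone_topology (prod_space I X) (prod_distance I d)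
                 closure_of (Inl ` {prod_act I h x |h. h \<in> \<Gamma>})}"

definition furstenberg_limit_set ::
  "'i set \<Rightarrow> ('i \<Rightarrow> 'a set) \<Rightarrow> ('i \<Rightarrow> 'a \<Rightarrow> 'a \<Rightarrow> real) \<Rightarrow>
     ('i \<Rightarrow> 'a \<Rightarrow> 'a) set \<Rightarrow> ('i \<Rightarrow> 'a) \<Rightarrow> ('i \<Rightarrow> (real \<Rightarrow> 'a) set) set" where
  "furstenberg_limit_set I X d \<Gamma> x =
     furstenberg_proj I X d ` (geometric_limit_set I X d \<Gamma> x \<inter> regular_boundary I X d)"

definition nonempty_invariant_closed ::
  "'i set \<Rightarrow> ('i \<Rightarrow> 'a set) \<Rightarrow> ('i \<Rightarrow> 'a \<Rightarrow> 'a \<Rightarrow> real) \<Rightarrow>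
     ('i \<Rightarrow> 'a \<Rightarrow> 'a) set \<Rightarrow> ('i \<Rightarrow> (real \<Rightarrow> 'a) set) set \<Rightarrow> bool" where
  "nonempty_invariant_closed I X d \<Gamma> A \<longleftrightarrow>
     A \<noteq> {} \<and> (\<forall>h\<in>\<Gamma>. furstenberg_act I X d h ` A \<subseteq> A) \<and>
     closedin (furstenberg_topology I X d) A"

end

theory Submission
  imports Defs
begin

text \<open>
  Let \<open>\<sigma>\<close> be an axis of a rank one isometry. If the distances \<open>d p (\<sigma> t)\<close> did not grow with slope
  almost \<open>1\<close> away from the projection of \<open>p\<close> to \<open>\<sigma>\<close>, a limit of translates would be linear along \<open>\<sigma>\<close>
  with slope less than \<open>1\<close>, and the rays from \<open>\<sigma>\<close> to the limit would form a flat half-plane. So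
  \<open>\<sigma>\<close> is contracting: a geodesic whose end points project far to the left and far to the right of
  \<open>\<sigma> t\<close> passes near \<open>\<sigma> t\<close>. By ping-pong with two independent regular axial isometries, every point of
  the product is moved far to the right (or to the left) of all axes at once by an element of a
  fixed finite subset of \<open>\<Gamma>\<close>. This shows that the Furstenberg limit set lies in every nonempty
  closed invariant set. In particular it lies in the orbit closure of the attracting point
  \<open>h\<^sup>+\<close>, and conversely every point of that orbit closure is the projection of a limit point with
  the slope of \<open>h\<close>.
\<close>

text \<open>Neither closedness nor minimality of the Furstenberg limit set can be read off its
  definition: regular limit points may converge to a boundary point whose slope has a zero
  coordinate, where \<open>furstenberg_proj\<close> carries no information. Closedness is therefore
  obtained only by identifying the set with an orbit closure all of whose points are realized with
  one fixed slope. Two devices shape the rest. The comparison of triangles is replaced by an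
  inequality between squared distances, because that can be summed over the factors and so makes the
  product a space of the same kind. And the dynamics is stated through projections of points to the
  axes rather than through neighbourhoods in the boundary: one element of \<Gamma> acts on all
  factors at once and has to do the right thing in each of them, which a pigeonhole over exponents
  achieves for points of the space directly. Finiteness of the ping-pong sets makes every constant
  independent of the element \<gamma> that approaches the limit point.\<close>

section \<open>Comparison geometry\<close>

text \<open>With \<open>p\<close> at the origin and \<open>q = (a, 0)\<close>, the law of cosines
  dictates the first coordinate \<open>x\<close> of \<open>r\<close>. That \<open>b^2 - x^2\<close>
  is nonnegative is Heron's factorization, whose factors are the three triangle inequalities and the
  perimeter.\<close>

lemma comparison_triangle:
  fixes a b c :: real
  assumes "0 \<le> a" "0 \<le> b" "0 \<le> c" "c \<le> a + b" "a \<le> b + c" "b \<le> a + c"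
  obtains p q r :: "real^2" where "dist p q = a" "dist p r = b" "dist q r = c"
proof (cases "a = 0")
  case True
  have "dist (0 :: real^2) (vector [b, 0]) = b"
    using assms by (simp add: dist_vec_def L2_set_def UNIV_2)
  with True assms show ?thesis
    using that[of 0 0 "vector [b, 0]"] by auto
next
  case False
  define x where "x = (a^2 + b^2 - c^2) / (2 * a)"
  define y where "y = sqrt (b^2 - x^2)"
  have a: "a > 0" using False assms by simp
  have "b^2 - x^2 = (2*a*b - (a^2 + b^2 - c^2)) * (2*a*b + (a^2 + b^2 - c^2)) / (4 * a^2)"
    using a by (simp add: x_def field_simps power2_eq_square)
  also have "\<dots> = (c - (a - b)) * (c + (a - b)) * ((a + b - c) * (a + b + c)) / (4 * a^2)"
    by (simp add: algebra_simps power2_eq_square)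
  also have "\<dots> \<ge> 0" using assms by simp
  finally have y2: "y^2 = b^2 - x^2" by (simp add: y_def)
  have xa: "2 * a * x = a^2 + b^2 - c^2" using a by (simp add: x_def)
  have "(a - x)^2 + y^2 = c^2" using y2 xa by (simp add: power2_eq_square algebra_simps)
  then have "dist (vector [a, 0] :: real^2) (vector [x, y]) = c"
    using assms by (simp add: dist_vec_def L2_set_def UNIV_2 dist_real_def)
  moreover have "dist (0 :: real^2) (vector [x, y]) = b"
    using assms y2 by (simp add: dist_vec_def L2_set_def UNIV_2)
  moreover have "dist (0 :: real^2) (vector [a, 0]) = a"
    using a by (simp add: dist_vec_def L2_set_def UNIV_2)
  ultimately show ?thesis using that by blast
qed

text \<open>Stewart's theorem: the equality in Euclidean space of which the axiom
  \<open>stewart\<close> below is the CAT(0) form.\<close>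

lemma euclidean_stewart:
  fixes p q r :: "'a::real_inner"
  shows "(dist (p + u *\<^sub>R (q - p)) r)\<^sup>2 =
    (1 - u) * (dist p r)\<^sup>2 + u * (dist q r)\<^sup>2 - u * (1 - u) * (dist p q)\<^sup>2"
proof -
  have [simp]: "r \<bullet> p = p \<bullet> r" "r \<bullet> q = q \<bullet> r" "q \<bullet> p = p \<bullet> q" by (simp_all add: inner_commute)
  show ?thesis
    unfolding dist_norm power2_norm_eq_inner
    by (simp add: inner_diff_left inner_diff_right inner_add_left inner_add_right algebra_simps power2_eq_square)
qed

lemma geodesic_segmentD:
  assumes "geodesic_segment M d \<gamma> x y"
  shows "x \<in> M" "y \<in> M" "\<gamma> 0 = x" "\<gamma> (d x y) = y"
    and "\<And>t. 0 \<le> t \<Longrightarrow> t \<le> d x y \<Longrightarrow> \<gamma> t \<in> M"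
    and "\<And>s t. 0 \<le> s \<Longrightarrow> s \<le> d x y \<Longrightarrow> 0 \<le> t \<Longrightarrow> t \<le> d x y \<Longrightarrow> d (\<gamma> s) (\<gamma> t) = \<bar>s - t\<bar>"
  using assms by (auto simp: geodesic_segment_def)

lemma geodesic_rayD:
  assumes "geodesic_ray M d c"
  shows "\<And>t. 0 \<le> t \<Longrightarrow> c t \<in> M" "\<And>s t. 0 \<le> s \<Longrightarrow> 0 \<le> t \<Longrightarrow> d (c s) (c t) = \<bar>s - t\<bar>"
  using assms by (auto simp: geodesic_ray_def)

lemma geodesic_lineD:
  assumes "geodesic_line M d \<sigma>"
  shows "\<sigma> t \<in> M" "d (\<sigma> s) (\<sigma> t) = \<bar>s - t\<bar>"
  using assms by (auto simp: geodesic_line_def)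

text \<open>
  The inequality of Bruhat and Tits, for all points of a geodesic. Unlike the comparison with
  Euclidean triangles it passes to products by addition.
\<close>

locale cat0 = Metric_space M d for M :: "'a set" and d +
  assumes geodesic_exists: "x \<in> M \<Longrightarrow> y \<in> M \<Longrightarrow> \<exists>\<gamma>. geodesic_segment M d \<gamma> x y"
    and stewart: "geodesic_segment M d \<gamma> x y \<Longrightarrow> z \<in> M \<Longrightarrow> 0 \<le> u \<Longrightarrow> u \<le> 1 \<Longrightarrow>
      (d z (\<gamma> (u * d x y)))\<^sup>2 \<le> (1 - u) * (d z x)\<^sup>2 + u * (d z y)\<^sup>2 - u * (1 - u) * (d x y)\<^sup>2"

text \<open>The definition compares points on two sides through a common vertex. Taking the second
  point to be the far end of its side turns this into a comparison of a point with the opposite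
  vertex.\<close>

lemma CAT0_space_imp_cat0:
  assumes "CAT0_space M d"
  shows "cat0 M d"
proof -
  interpret Metric_space M d using assms by (simp add: CAT0_space_def)
  have ge: "\<exists>\<gamma>. geodesic_segment M d \<gamma> x y" if "x \<in> M" "y \<in> M" for x y
    using assms that by (auto simp: CAT0_space_def geodesic_space_def)
  show ?thesis
  proof
    fix x y z u \<gamma>
    assume g: "geodesic_segment M d \<gamma> x y" and z: "z \<in> M" and u: "0 \<le> u" "u \<le> (1::real)"
    have xy: "x \<in> M" "y \<in> M" using geodesic_segmentD[OF g] by auto
    obtain \<beta> where b: "geodesic_segment M d \<beta> x z" using ge xy z by blast
    obtain p q r :: "real^2" where pqr: "dist p q = d x y" "dist p r = d x z" "dist q r = d y z"
      using comparison_triangle[of "d x y" "d x z" "d y z"] triangle xy z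
      by (metis commute nonneg)
    define v where "v = p + u *\<^sub>R (q - p)"
    have "v \<in> closed_segment p q"
      using u by (auto simp: v_def closed_segment_def scaleR_diff_left scaleR_diff_right intro!: exI[of _ u])
    moreover have "dist p v = norm (u *\<^sub>R (q - p))" by (simp add: v_def dist_norm)
    ultimately have v: "v \<in> closed_segment p q" "dist p v = u * d x y"
      using u pqr by (simp_all add: dist_norm norm_minus_commute)
    have s: "u * d x y \<in> {0..d x y}" using u by (auto intro: mult_left_le_one_le)
    have "d (\<gamma> (u * d x y)) (\<beta> (d x z)) \<le> dist v r"
      using assms[unfolded CAT0_space_def] xy z g b s pqr v by (auto intro: ends_in_segment)
    then have "d z (\<gamma> (u * d x y)) \<le> dist v r"
      using geodesic_segmentD[OF b] by (simp add: commute)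
    then have "(d z (\<gamma> (u * d x y)))\<^sup>2 \<le> (dist v r)\<^sup>2" by (simp add: power_mono)
    also have "\<dots> = (1 - u) * (d z x)\<^sup>2 + u * (d z y)\<^sup>2 - u * (1 - u) * (d x y)\<^sup>2"
      unfolding v_def euclidean_stewart pqr by (simp add: commute)
    finally show "(d z (\<gamma> (u * d x y)))\<^sup>2 \<le> (1 - u) * (d z x)\<^sup>2 + u * (d z y)\<^sup>2 - u * (1 - u) * (d x y)\<^sup>2" .
  qed (use ge in blast)
qed

context cat0
begin

lemma geodesic_reverse:
  assumes "geodesic_segment M d \<gamma> x y"
  shows "geodesic_segment M d (\<lambda>t. \<gamma> (d x y - t)) y x"
  using assms by (auto simp: geodesic_segment_def commute)

lemma geodesic_subsegment:
  assumes "geodesic_segment M d \<gamma> x y" "0 \<le> v" "v \<le> d x y"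
  shows "d x (\<gamma> v) = v" "d (\<gamma> v) y = d x y - v" "geodesic_segment M d \<gamma> x (\<gamma> v)"
proof -
  note g = geodesic_segmentD[OF assms(1)]
  show *: "d x (\<gamma> v) = v" using g(6)[of 0 v] g(3) assms by simp
  show "d (\<gamma> v) y = d x y - v" using g(6)[of v "d x y"] g(4) assms by simp
  show "geodesic_segment M d \<gamma> x (\<gamma> v)" unfolding geodesic_segment_def * using g assms by auto
qed

lemma ray_segment:
  assumes "geodesic_ray M d c" "0 \<le> v"
  shows "d (c 0) (c v) = v" "geodesic_segment M d c (c 0) (c v)"
proof -
  note g = geodesic_rayD[OF assms(1)]
  show *: "d (c 0) (c v) = v" using g assms by simp
  show "geodesic_segment M d c (c 0) (c v)" unfolding geodesic_segment_def * using g assms by auto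
qed

lemma line_segment:
  assumes "geodesic_line M d \<sigma>" "s \<le> t"
  shows "d (\<sigma> s) (\<sigma> t) = t - s" "geodesic_segment M d (\<lambda>u. \<sigma> (s + u)) (\<sigma> s) (\<sigma> t)"
proof -
  note g = geodesic_lineD[OF assms(1)]
  show *: "d (\<sigma> s) (\<sigma> t) = t - s" using g assms by simp
  show "geodesic_segment M d (\<lambda>u. \<sigma> (s + u)) (\<sigma> s) (\<sigma> t)"
    unfolding geodesic_segment_def * using g assms by auto
qed

lemma scaled_le: "0 \<le> u \<Longrightarrow> u \<le> 1 \<Longrightarrow> u * d x y \<le> d x y"
  by (simp add: mult_left_le_one_le)

text \<open>The right side is the squared distance of the comparison points, by the law of cosines.
  It results from \<open>stewart\<close> used twice, for \<alpha> s against \<beta> and then for r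
  against \<alpha>. If a side has length 0, then \<open>s * t = 0\<close>, so the division by zero
  does no harm.\<close>

lemma two_sides:
  assumes \<alpha>: "geodesic_segment M d \<alpha> p q" and \<beta>: "geodesic_segment M d \<beta> p r"
    and s: "0 \<le> s" "s \<le> d p q" and t: "0 \<le> t" "t \<le> d p r"
  shows "(d (\<alpha> s) (\<beta> t))\<^sup>2 \<le>
    s\<^sup>2 + t\<^sup>2 - s * t / (d p q * d p r) * ((d p q)\<^sup>2 + (d p r)\<^sup>2 - (d q r)\<^sup>2)"
proof -
  note A = geodesic_segmentD[OF \<alpha>] and B = geodesic_segmentD[OF \<beta>]
  have m: "\<alpha> s \<in> M" "\<beta> t \<in> M" using A B s t by auto
  have da: "d p (\<alpha> s) = s" and db: "d p (\<beta> t) = t"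
    using geodesic_subsegment(1)[OF \<alpha> s] geodesic_subsegment(1)[OF \<beta> t] by auto
  show ?thesis
  proof (cases "d p q = 0 \<or> d p r = 0")
    case True
    then have "s = 0 \<or> t = 0" using s t by auto
    then show ?thesis
      using da db A(3) B(3) commute by (metis add.commute add.right_neutral cancel_comm_monoid_add_class.diff_cancel diff_zero div_0 mult_zero_left mult_zero_right order_refl power_zero_numeral)
  next
    case False
    define a b where "a = d p q" and "b = d p r"
    have ab: "a > 0" "b > 0" using False nonneg[of p q] nonneg[of p r] by (auto simp: a_def b_def less_le)
    define u w where "u = s / a" and "w = t / b"
    have u: "0 \<le> u" "u \<le> 1" "s = u * a" and w: "0 \<le> w" "w \<le> 1" "t = w * b"
      using s t ab by (auto simp: u_def w_def a_def b_def)
    have "(d (\<alpha> s) (\<beta> t))\<^sup>2 \<le> (1 - w) * (d (\<alpha> s) p)\<^sup>2 + w * (d (\<alpha> s) r)\<^sup>2 - w * (1 - w) * b\<^sup>2"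
      using stewart[OF \<beta> m(1) w(1,2)] w by (simp add: b_def)
    also have "d (\<alpha> s) p = u * a" using da u by (simp add: commute)
    also have "(1 - w) * (u * a)\<^sup>2 + w * (d (\<alpha> s) r)\<^sup>2 - w * (1 - w) * b\<^sup>2 \<le>
      (1 - w) * (u * a)\<^sup>2 + w * ((1 - u) * b\<^sup>2 + u * (d q r)\<^sup>2 - u * (1 - u) * a\<^sup>2) - w * (1 - w) * b\<^sup>2"
      using stewart[OF \<alpha> B(2) u(1,2)] u w by (simp add: a_def b_def commute mult_left_mono)
    also have "\<dots> = (u * a)\<^sup>2 + (w * b)\<^sup>2 - u * w * (a\<^sup>2 + b\<^sup>2 - (d q r)\<^sup>2)"
      by (simp add: algebra_simps power2_eq_square)
    also have "u * w = s * t / (a * b)" by (simp add: u_def w_def)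
    finally show ?thesis using u w by (simp add: a_def b_def)
  qed
qed

lemma geodesic_unique:
  assumes \<alpha>: "geodesic_segment M d \<alpha> x y" and \<beta>: "geodesic_segment M d \<beta> x y"
    and t: "0 \<le> t" "t \<le> d x y"
  shows "\<alpha> t = \<beta> t"
proof -
  note A = geodesic_segmentD[OF \<alpha>] and B = geodesic_segmentD[OF \<beta>]
  have "(d (\<alpha> t) (\<beta> t))\<^sup>2 \<le> 0"
  proof (cases "d x y = 0")
    case True
    then have "t = 0" using t by simp
    then show ?thesis using A(1,3) B(3) by simp
  next
    case False
    then show ?thesis using two_sides[OF \<alpha> \<beta> t t] A(2)
      by (simp add: power2_eq_square field_simps)
  qed
  then have "d (\<alpha> t) (\<beta> t) = 0" by simp
  then show ?thesis using A B t by simp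
qed

text \<open>Similar triangles: the distance at time \<open>u\<close>, divided by \<open>u\<close>,
  is nondecreasing. The product form covers \<open>u = 0\<close>. Read backwards, it says that
  bounded distance at a late time means tiny distance early, which is how all closeness at infinity
  is exploited.\<close>

lemma geodesics_diverge:
  assumes \<alpha>: "geodesic_segment M d \<alpha> p q" and \<beta>: "geodesic_segment M d \<beta> p r"
    and "0 \<le> u" "u \<le> v" "v \<le> d p q" "v \<le> d p r"
  shows "v * d (\<alpha> u) (\<beta> u) \<le> u * d (\<alpha> v) (\<beta> v)"
proof (cases "u = 0 \<or> v = 0")
  case True
  then show ?thesis using assms geodesic_segmentD[OF \<alpha>] geodesic_segmentD[OF \<beta>] by auto
next
  case False
  have v: "0 < v" "0 \<le> v" "0 \<le> u" using assms False by auto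
  note A = geodesic_subsegment[OF \<alpha> v(2) assms(5)] and B = geodesic_subsegment[OF \<beta> v(2) assms(6)]
  have "(d (\<alpha> u) (\<beta> u))\<^sup>2 \<le> u\<^sup>2 + u\<^sup>2 - u * u / (v * v) * (v\<^sup>2 + v\<^sup>2 - (d (\<alpha> v) (\<beta> v))\<^sup>2)"
    using two_sides[OF A(3) B(3) v(3) _ v(3)] A(1) B(1) assms by simp
  also have "\<dots> = (u / v * d (\<alpha> v) (\<beta> v))\<^sup>2"
    using v by (simp add: field_simps power2_eq_square)
  finally have "d (\<alpha> u) (\<beta> u) \<le> u / v * d (\<alpha> v) (\<beta> v)"
    by (rule power2_le_imp_le) (use v in simp)
  then show ?thesis using v by (simp add: field_simps)
qed

lemma proportional_points:
  assumes \<alpha>: "geodesic_segment M d \<alpha> p q" and \<beta>: "geodesic_segment M d \<beta> p r" and u: "0 \<le> u" "u \<le> 1"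
  shows "d (\<alpha> (u * d p q)) (\<beta> (u * d p r)) \<le> u * d q r"
proof (cases "d p q = 0 \<or> d p r = 0")
  case True
  note A = geodesic_segmentD[OF \<alpha>] and B = geodesic_segmentD[OF \<beta>]
  from True show ?thesis
  proof
    assume "d p q = 0"
    then have "p = q" using A by simp
    then show ?thesis using geodesic_subsegment(1)[OF \<beta>, of "u * d p r"] u A(1,3) scaled_le by simp
  next
    assume "d p r = 0"
    then have "p = r" using A B by simp
    then show ?thesis using geodesic_subsegment(1)[OF \<alpha>, of "u * d p q"] u B(1,3) scaled_le
      by (simp add: commute)
  qed
next
  case False
  have s: "0 \<le> u * d p q" "u * d p q \<le> d p q" "0 \<le> u * d p r" "u * d p r \<le> d p r"
    using u by (auto simp: scaled_le)
  have "(d (\<alpha> (u * d p q)) (\<beta> (u * d p r)))\<^sup>2 \<le> (u * d q r)\<^sup>2"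
    using two_sides[OF \<alpha> \<beta> s] False by (simp add: field_simps power2_eq_square)
  then show ?thesis by (rule power2_le_imp_le) (use u in simp)
qed

text \<open>By the triangle inequality the term with \<open>d x y\<close> in \<open>stewart\<close>
  may be weakened to \<open>d z x - d z y\<close>, and then the bound is a perfect square.\<close>

lemma distance_convex:
  assumes \<gamma>: "geodesic_segment M d \<gamma> x y" and z: "z \<in> M" and u: "0 \<le> u" "u \<le> 1"
  shows "d z (\<gamma> (u * d x y)) \<le> (1 - u) * d z x + u * d z y"
proof -
  note g = geodesic_segmentD[OF \<gamma>]
  have "\<bar>d z x - d z y\<bar> \<le> d x y" using mdist_reverse_triangle[of x z y] g z by (simp add: commute)
  then have "(d z x - d z y)\<^sup>2 \<le> (d x y)\<^sup>2" by (metis abs_ge_zero power2_abs power_mono)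
  then have "u * (1 - u) * (d z x - d z y)\<^sup>2 \<le> u * (1 - u) * (d x y)\<^sup>2" using u by (simp add: mult_left_mono)
  then have "(d z (\<gamma> (u * d x y)))\<^sup>2 \<le> (1 - u) * (d z x)\<^sup>2 + u * (d z y)\<^sup>2 - u * (1 - u) * (d z x - d z y)\<^sup>2"
    using stewart[OF \<gamma> z u] by linarith
  also have "\<dots> = ((1 - u) * d z x + u * d z y)\<^sup>2" by (simp add: algebra_simps power2_eq_square)
  finally show ?thesis by (rule power2_le_imp_le) (use u in simp)
qed

text \<open>The point of \<beta> proportional to \<open>\<alpha> t\<close> has parameter
  \<open>t * K / L\<close> instead of \<open>t\<close>. Reaching it costs at most
  \<open>d x y\<close>, and correcting the parameter costs at most \<open>d x y\<close> again, hence
  the factor 2.\<close>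

lemma geodesics_same_end:
  assumes \<alpha>: "geodesic_segment M d \<alpha> x z" and \<beta>: "geodesic_segment M d \<beta> y z"
    and t: "0 \<le> t" "t \<le> d x z" "t \<le> d y z"
  shows "d (\<alpha> t) (\<beta> t) \<le> 2 * d x y"
proof (cases "d x z = 0")
  case True
  then have "t = 0" using t by simp
  then show ?thesis using geodesic_segmentD[OF \<alpha>] geodesic_segmentD[OF \<beta>] by simp
next
  case False
  note A = geodesic_segmentD[OF \<alpha>] and B = geodesic_segmentD[OF \<beta>]
  define L K where "L = d x z" and "K = d y z"
  have L: "L > 0" "K \<ge> 0" using False nonneg[of x z] by (auto simp: L_def K_def less_le)
  define u where "u = 1 - t / L"
  have u: "0 \<le> u" "u \<le> 1" using t L by (auto simp: u_def L_def)
  have e1: "d x z - u * d z x = t" "d y z - u * d z y = t * K / L"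
    using L by (auto simp: u_def commute[of z] L_def[symmetric] K_def[symmetric] field_simps)
  have 1: "d (\<alpha> t) (\<beta> (t * K / L)) \<le> u * d x y"
    using proportional_points[OF geodesic_reverse[OF \<alpha>] geodesic_reverse[OF \<beta>] u] by (simp add: e1)
  have "t * K \<le> L * K" using t L by (intro mult_right_mono) (auto simp: L_def)
  then have tk: "0 \<le> t * K / L" "t * K / L \<le> K" using t L by (auto simp: field_simps)
  have "d (\<beta> (t * K / L)) (\<beta> t) = \<bar>t * K / L - t\<bar>"
    using B(6)[of "t * K / L" t] tk t by (simp add: K_def)
  also have "t * K / L - t = t / L * (K - L)" using L by (simp add: field_simps)
  also have "\<bar>\<dots>\<bar> = t / L * \<bar>K - L\<bar>" using t L by (simp add: abs_mult)
  also have "\<dots> \<le> 1 * d x y"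
    using t L mdist_reverse_triangle[of y z x] A B
    by (intro mult_mono) (auto simp: L_def K_def commute)
  finally have "d (\<beta> (t * K / L)) (\<beta> t) \<le> d x y" by simp
  moreover have "u * d x y \<le> d x y" using u scaled_le by blast
  moreover have "d (\<alpha> t) (\<beta> t) \<le> d (\<alpha> t) (\<beta> (t * K / L)) + d (\<beta> (t * K / L)) (\<beta> t)"
    using A B t tk by (intro triangle) (auto simp: K_def)
  ultimately show ?thesis using 1 by linarith
qed

section \<open>Compactness of closed balls\<close>

lemma compactin_mcball_limit:
  assumes "mcomplete" "x \<in> M" "0 < r" "\<And>r'. r' < r \<Longrightarrow> compactin mtopology (mcball x r')"
  shows "compactin mtopology (mcball x r)"
proof -
  have "mtotally_bounded (mcball x r)"
    unfolding mtotally_bounded_def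
  proof (intro allI impI)
    fix e :: real assume e: "e > 0"
    \<comment> \<open>Moving along geodesics towards \<open>x\<close> brings every point of the
      large ball within \<open>e/3\<close> of the ball of radius \<open>r'\<close>, so an
      \<open>e/2\<close>-net there is an \<open>e\<close>-net here. The maximum with 0 keeps
      \<open>x\<close> in the small ball.\<close>
    define r' where "r' = max 0 (r - e/3)"
    have "r' < r" using e assms by (auto simp: r'_def)
    then have "mtotally_bounded (mcball x r')" using assms compactin_imp_mtotally_bounded by blast
    then obtain K where K: "finite K" "K \<subseteq> mcball x r'" "mcball x r' \<subseteq> (\<Union>k\<in>K. mball k (e/2))"
      unfolding mtotally_bounded_def using e by (metis half_gt_zero)
    have "y \<in> (\<Union>k\<in>K. mball k e)" if y: "y \<in> mcball x r" for y
    proof -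
      obtain \<gamma> where g: "geodesic_segment M d \<gamma> x y" using geodesic_exists[of x y] y by auto
      define v where "v = min r' (d x y)"
      have v: "0 \<le> v" "v \<le> d x y" "v \<le> r'" "d x y - v \<le> e/3"
        using y e by (simp_all add: v_def r'_def min_def max_def)
      have "\<gamma> v \<in> mcball x r'"
        using geodesic_subsegment(1)[OF g v(1,2)] geodesic_segmentD(5)[OF g v(1,2)] v assms by simp
      then obtain k where k: "k \<in> K" "\<gamma> v \<in> mball k (e/2)" using K by blast
      have "d k y \<le> d k (\<gamma> v) + d (\<gamma> v) y" using k y by (intro triangle) auto
      also have "\<dots> < e" using k v geodesic_subsegment(2)[OF g v(1,2)] e by auto
      finally show ?thesis using k y by auto
    qed
    then show "\<exists>K. finite K \<and> K \<subseteq> mcball x r \<and> mcball x r \<subseteq> (\<Union>k\<in>K. mball k e)"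
      using K mcball_subset_concentric[of r' r x] \<open>r' < r\<close> by (intro exI[of _ K]) auto
  qed
  then show ?thesis
    using mtotally_bounded_eq_compact_closure_of[OF assms(1)] closure_of_closedin[OF closedin_mcball] by metis
qed

text \<open>Cover the ball by finitely many open sets with compact neighbourhoods. A Lebesgue number
  \<open>e\<close> of this cover shows that the slightly larger ball still lies in the union of
  those compact sets, because geodesics connect it to the smaller ball by pieces of length at most
  \<open>e/2\<close>.\<close>

lemma compactin_mcball_extend:
  assumes "locally_compact_space mtopology" "x \<in> M" "0 \<le> r" "compactin mtopology (mcball x r)"
  shows "\<exists>e>0. compactin mtopology (mcball x (r + e))"
proof -
  have "\<forall>y\<in>M. \<exists>U K. openin mtopology U \<and> compactin mtopology K \<and> y \<in> U \<and> U \<subseteq> K"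
    using assms(1) by (simp add: locally_compact_space_def)
  then obtain U K where UK: "\<And>y. y \<in> M \<Longrightarrow> openin mtopology (U y) \<and> compactin mtopology (K y) \<and> y \<in> U y \<and> U y \<subseteq> K y"
    by metis
  obtain F where F: "finite F" "F \<subseteq> U ` mcball x r" "mcball x r \<subseteq> \<Union>F"
  proof -
    have "mcball x r \<subseteq> \<Union>(U ` mcball x r)" using UK by (auto simp del: in_mcball dest: mcball_subset_mspace[THEN subsetD])
    moreover have "openin mtopology V" if "V \<in> U ` mcball x r" for V using that UK by auto
    ultimately show ?thesis using compactinD[OF assms(4), of "U ` mcball x r"] that by blast
  qed
  then obtain S where S: "finite S" "S \<subseteq> mcball x r" "F = U ` S" by (meson finite_subset_image)
  have op: "\<And>V. V \<in> F \<Longrightarrow> openin mtopology V" using S UK by auto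
  obtain e where e: "e > 0" "\<forall>y\<in>mcball x r. \<exists>V\<in>F. mball y e \<subseteq> V"
    using lebesgue_number[OF assms(4) F(3) op] by blast
  have "mcball x (r + e/2) \<subseteq> \<Union>(K ` S)"
  proof
    fix y assume y: "y \<in> mcball x (r + e/2)"
    obtain \<gamma> where g: "geodesic_segment M d \<gamma> x y" using geodesic_exists y assms by auto
    define v where "v = min r (d x y)"
    have v: "0 \<le> v" "v \<le> d x y" "v \<le> r" "d x y - v \<le> e/2"
      using y e assms by (auto simp: v_def)
    have "\<gamma> v \<in> mcball x r"
      using geodesic_subsegment(1)[OF g v(1,2)] geodesic_segmentD(5)[OF g v(1,2)] v assms by simp
    then obtain V where V: "V \<in> F" "mball (\<gamma> v) e \<subseteq> V" using e by blast
    have "y \<in> mball (\<gamma> v) e"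
      using v geodesic_subsegment(2)[OF g v(1,2)] e y geodesic_segmentD(5)[OF g v(1,2)] by auto
    then obtain z where "z \<in> S" "y \<in> U z" using V S by auto
    then show "y \<in> \<Union>(K ` S)" using UK S by (meson UN_I mcball_subset_mspace subsetD)
  qed
  moreover have "compactin mtopology (\<Union>(K ` S))"
    using S UK by (intro compactin_Union) auto
  ultimately have "compactin mtopology (mcball x (r + e/2))"
    using closed_compactin by blast
  then show ?thesis using e by (intro exI[of _ "e/2"]) simp
qed

text \<open>The radii with compact balls form an initial segment that contains its supremum and
  extends beyond it, so it cannot be bounded.\<close>

lemma hopf_rinow:
  assumes "mcomplete" "locally_compact_space mtopology"
  shows "compactin mtopology (mcball x r)"
proof (rule ccontr)
  assume R: "\<not> compactin mtopology (mcball x r)"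
  define P where "P = {r. compactin mtopology (mcball x r)}"
  have x: "x \<in> M" and r: "r \<ge> 0"
    using R mcball_eq_empty[of x r] by (metis compactin_empty not_le)+
  have mono: "r' \<in> P" if "r'' \<in> P" "r' \<le> r''" for r' r''
    using that closed_compactin[OF _ mcball_subset_concentric closedin_mcball] by (auto simp: P_def)
  have "mcball x 0 = {x}" using x by (auto simp: order.antisym[OF _ nonneg] dest!: order.antisym[OF _ nonneg])
  then have 0: "0 \<in> P" using x by (simp add: P_def finite_imp_compactin)
  have bdd: "bdd_above P" using mono R by (intro bdd_aboveI[of _ r]) (auto simp: P_def, meson linorder_le_cases)
  define s where "s = Sup P"
  have s0: "0 \<le> s" using cSup_upper[OF 0 bdd] by (simp add: s_def)
  have "s \<in> P"
  proof (cases "s = 0")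
    case False
    have "r' \<in> P" if r': "r' < s" for r'
    proof -
      obtain r'' where "r'' \<in> P" "r' < r''" using less_cSupE[of r' P] 0 r' unfolding s_def by blast
      then show ?thesis using mono[of r'' r'] by simp
    qed
    then show ?thesis using compactin_mcball_limit[OF assms(1) x, of s] s0 False by (auto simp: P_def)
  qed (use 0 in simp)
  then obtain e where "e > 0" "s + e \<in> P"
    using compactin_mcball_extend[OF assms(2) x s0] by (auto simp: P_def)
  then show False using cSup_upper[OF _ bdd, of "s + e"] by (simp add: s_def)
qed

end

section \<open>Flat half-planes as limits of geodesics to distant points\<close>

context Metric_space
begin

text \<open>Tychonoff for an arbitrary index type in place of a diagonal subsequence: \<phi> is a
  cluster point of the maps \<open>f n\<close> in a product of compact sets. The index
  \<open>n\<close> found depends on the pair \<open>j\<close>, \<open>k\<close>, so it cannot be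
  fixed for all pairs at once.\<close>

lemma cluster_map:
  fixes f :: "nat \<Rightarrow> 'k \<Rightarrow> 'a"
  assumes B: "\<And>k. compactin mtopology (B k)" and f: "\<And>n k. f n k \<in> B k"
  shows "\<exists>\<phi>. (\<forall>k. \<phi> k \<in> B k) \<and>
    (\<forall>j k e N. e > 0 \<longrightarrow> (\<exists>n\<ge>N. \<bar>d (\<phi> j) (\<phi> k) - d (f n j) (f n k)\<bar> < e))"
proof -
  define T where "T = product_topology (\<lambda>k. subtopology mtopology (B k)) UNIV"
  have BM: "B k \<subseteq> M" for k using compactin_subset_topspace[OF B] by simp
  have ts: "topspace T = {\<psi>. \<forall>k. \<psi> k \<in> B k}"
    using BM by (auto simp: T_def PiE_def Pi_def)
  have cT: "compact_space T"
    using B by (simp add: T_def compact_space_product_topology compact_space_subtopology)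
  define C where "C N = Abstract_Topology.closure_of T {f n |n. n \<ge> N}" for N :: nat
  have sub: "{f n |n. n \<ge> N} \<subseteq> topspace T" for N using f ts by auto
  have "\<Inter>(range C) \<noteq> {}"
  proof -
    have "\<Inter>\<F> \<noteq> {}" if F: "finite \<F>" "\<F> \<subseteq> range C" for \<F>
    proof -
      obtain S where S: "finite S" "\<F> = C ` S" using F by (meson finite_subset_image)
      \<comment> \<open>Finite intersection property: the map with the largest index belongs to all
        the finitely many tails.\<close>
      have "f (Max (insert 0 S)) \<in> C N" if "N \<in> S" for N
        using closure_of_subset[OF sub[of N]] that S(1) Max_ge[of "insert 0 S" N]
        unfolding C_def by blast
      then show ?thesis using S by auto
    qed
    then show ?thesis using cT unfolding compact_space_fip by (auto simp: C_def)
  qed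
  then obtain \<phi> where p: "\<And>N. \<phi> \<in> C N" by blast
  have p1: "\<phi> \<in> topspace T" using p[of 0] by (simp add: C_def in_closure_of)
  have "\<exists>n\<ge>N. \<bar>d (\<phi> j) (\<phi> k) - d (f n j) (f n k)\<bar> < e" if e: "e > 0" for j k e N
  proof -
    have cm: "continuous_map T (mtopology_of Self) (\<lambda>\<psi>. \<psi> i)" for i
      unfolding T_def mtopology_of_def mspace_Self mdist_Self
      using continuous_map_product_projection[of i UNIV "\<lambda>k. subtopology mtopology (B k)"]
      by (simp add: continuous_map_in_subtopology)
    have "continuous_map T euclidean (\<lambda>\<psi>. d (\<psi> j) (\<psi> k))"
      using continuous_map_mdist[OF cm cm] by simp
    then have "openin T {\<psi> \<in> topspace T. d (\<psi> j) (\<psi> k) \<in> ball (d (\<phi> j) (\<phi> k)) e}"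
      by (rule openin_continuous_map_preimage) simp
    moreover have "\<phi> \<in> {\<psi> \<in> topspace T. d (\<psi> j) (\<psi> k) \<in> ball (d (\<phi> j) (\<phi> k)) e}"
      using p1 e by simp
    ultimately obtain \<psi> where "\<psi> \<in> {f n |n. n \<ge> N}" "d (\<psi> j) (\<psi> k) \<in> ball (d (\<phi> j) (\<phi> k)) e"
      using p[of N] unfolding C_def in_closure_of by (metis (no_types, lifting) mem_Collect_eq)
    then show ?thesis by (auto simp: dist_real_def)
  qed
  then show ?thesis using p1 ts by blast
qed

end

context cat0
begin

text \<open>\<open>q\<close> is the squared Euclidean norm in oblique coordinates, and an upper
  bound by it is forced to be sharp. Distances to the boundary line are exact by midpoint
  comparison. For two points at different heights, the triangle through the boundary point collinear
  with them then gives the lower bound.\<close>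

lemma flat_half_plane_isometry:
  fixes s :: real
  assumes line: "geodesic_line M d \<sigma>" and \<phi>M: "\<And>t a. 0 \<le> a \<Longrightarrow> \<phi> (t, a) \<in> M"
    and \<phi>0: "\<And>t. \<phi> (t, 0) = \<sigma> t" and \<phi>a: "\<And>t a. 0 \<le> a \<Longrightarrow> d (\<sigma> t) (\<phi> (t, a)) = a"
    and upper: "\<And>t a t' b. 0 \<le> a \<Longrightarrow> 0 \<le> b \<Longrightarrow>
      (d (\<phi> (t, a)) (\<phi> (t', b)))\<^sup>2 \<le> (t' - t)\<^sup>2 - 2 * s * (t' - t) * (b - a) + (b - a)\<^sup>2"
    and s: "\<bar>s\<bar> < 1" and ab: "0 \<le> a" "0 \<le> b"
  shows "(d (\<phi> (t, a)) (\<phi> (t', b)))\<^sup>2 = (t' - t)\<^sup>2 - 2 * s * (t' - t) * (b - a) + (b - a)\<^sup>2"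
proof -
  define q where "q C e = C\<^sup>2 - 2 * s * C * e + e\<^sup>2" for C e :: real
  have q0: "0 \<le> q C e" for C e
  proof -
    have "q C e = (C - s * e)\<^sup>2 + (1 - s\<^sup>2) * e\<^sup>2" by (simp add: q_def algebra_simps power2_eq_square)
    moreover have "s\<^sup>2 \<le> 1" using s by (simp add: abs_square_le_1)
    ultimately show ?thesis by simp
  qed
  have up: "d (\<phi> (t, a)) (\<phi> (t', b)) \<le> sqrt (q (t' - t) (b - a))" if "0 \<le> a" "0 \<le> b" for t t' a b
    using upper[OF that] by (simp add: q_def real_le_rsqrt)
  have \<sigma>M: "\<sigma> t \<in> M" for t using geodesic_lineD[OF line] by auto
  have base: "d (\<sigma> t0) (\<phi> (t, b)) = sqrt (q (t - t0) b)" if b: "0 \<le> b" for t0 t b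
  proof -
    \<comment> \<open>\<open>t1\<close> is the reflection of \<open>t0\<close> in \<open>t\<close>.
      The two upper bounds add up to exactly what \<open>stewart\<close> demands at the midpoint, so
      neither can be strict.\<close>
    define t1 where "t1 = 2 * t - t0"
    have st: "(d (\<phi> (t, b)) (\<sigma> t))\<^sup>2 \<le> (1/2) * (d (\<phi> (t, b)) (\<sigma> t0))\<^sup>2 + (1/2) * (d (\<phi> (t, b)) (\<sigma> t1))\<^sup>2 - (1/4) * (t1 - t0)\<^sup>2"
    proof (cases "t0 \<le> t1")
      case True
      then show ?thesis
        using stewart[OF line_segment(2)[OF line True] \<phi>M[OF b, of t], of "1/2"]
        unfolding line_segment(1)[OF line True] by (simp add: t1_def field_simps)
    next
      case False
      then have F: "t1 \<le> t0" by simp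
      then show ?thesis
        using stewart[OF line_segment(2)[OF line F] \<phi>M[OF b, of t], of "1/2"]
        unfolding line_segment(1)[OF line F] power2_commute[of t1] by (simp add: t1_def field_simps)
    qed
    have e: "d (\<phi> (t, b)) (\<sigma> t) = b" using \<phi>a[OF b] by (simp add: commute)
    have u0: "(d (\<phi> (t, b)) (\<sigma> t0))\<^sup>2 \<le> q (t - t0) b"
      using upper[of 0 b t0 t] b \<phi>0 by (simp add: q_def commute)
    have u1: "(d (\<phi> (t, b)) (\<sigma> t1))\<^sup>2 \<le> q (t - t1) b"
      using upper[of 0 b t1 t] b \<phi>0 by (simp add: q_def commute)
    have "q (t - t0) b + q (t - t1) b = 2 * b\<^sup>2 + (t1 - t0)\<^sup>2 / 2"
      by (simp add: q_def t1_def field_simps power2_eq_square)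
    with st e u0 u1 have "(d (\<phi> (t, b)) (\<sigma> t0))\<^sup>2 = q (t - t0) b" by (simp add: field_simps)
    then show ?thesis by (metis commute nonneg real_sqrt_unique)
  qed
  have ne: "sqrt (q (t' - t) (b - a)) \<le> d (\<phi> (t, a)) (\<phi> (t', b))"
    if ab: "0 \<le> a" "a < b" for t t' a b
  proof -
    text \<open>\<open>\<sigma> t0\<close> is where the line through the two points meets the boundary.\<close>
    define t0 where "t0 = t' - (t' - t) * b / (b - a)"
    have e1: "t' - t0 = (b / (b - a)) * (t' - t)" using ab by (simp add: t0_def)
    have e2: "t - t0 = (a / (b - a)) * (t' - t)" using ab by (simp add: t0_def field_simps)
    have qs: "sqrt (q (c * C) (c * e)) = c * sqrt (q C e)" if "0 \<le> c" for c C e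
    proof -
      have "q (c * C) (c * e) = c\<^sup>2 * q C e" by (simp add: q_def algebra_simps power2_eq_square)
      then show ?thesis using that by (simp add: real_sqrt_mult)
    qed
    have b1: "d (\<sigma> t0) (\<phi> (t', b)) = (b / (b - a)) * sqrt (q (t' - t) (b - a))"
      using base[of b t0 t'] qs[of "b/(b-a)" "t' - t" "b - a"] ab e1 by simp
    have b2: "d (\<sigma> t0) (\<phi> (t, a)) = (a / (b - a)) * sqrt (q (t' - t) (b - a))"
      using base[of a t0 t] qs[of "a/(b-a)" "t' - t" "b - a"] ab e2 by simp
    have "d (\<sigma> t0) (\<phi> (t', b)) \<le> d (\<sigma> t0) (\<phi> (t, a)) + d (\<phi> (t, a)) (\<phi> (t', b))"
      using ab \<phi>M \<sigma>M by (intro triangle) auto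
    moreover have "(b / (b - a)) * x - (a / (b - a)) * x = x" for x
      using ab by (simp flip: left_diff_distrib diff_divide_distrib)
    ultimately show ?thesis using b1 b2 by (metis add_le_cancel_left diff_add_cancel add.commute le_diff_eq)
  qed
  have ge: "sqrt (q (t' - t) (b - a)) \<le> d (\<phi> (t, a)) (\<phi> (t', b))"
  proof (cases a b rule: linorder_cases)
    case less
    then show ?thesis using ne ab by blast
  next
    case greater
    then show ?thesis using ne[of b a t t'] ab
      by (simp add: commute q_def power2_commute algebra_simps)
  next
    case equal
    \<comment> \<open>At equal heights the line through the points is parallel to the boundary. One
      point is raised by \<open>e\<close>, and \<open>e\<close> tends to 0.\<close>
    have *: "sqrt (q (t' - t) e) - e \<le> d (\<phi> (t, a)) (\<phi> (t', b))" if e: "e > 0" for e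
    proof -
      have "d (\<phi> (t, a)) (\<phi> (t', b + e)) \<le> d (\<phi> (t, a)) (\<phi> (t', b)) + d (\<phi> (t', b)) (\<phi> (t', b + e))"
        using ab e \<phi>M by (intro triangle) auto
      moreover have "d (\<phi> (t', b)) (\<phi> (t', b + e)) \<le> e"
        using up[of b "b + e" t' t'] ab e by (simp add: q_def)
      moreover have "sqrt (q (t' - t) e) \<le> d (\<phi> (t, a)) (\<phi> (t', b + e))"
        using ne[of a "b + e" t' t] equal ab e by simp
      ultimately show ?thesis by simp
    qed
    have "((\<lambda>e. sqrt (q (t' - t) e) - e) \<longlongrightarrow> sqrt (q (t' - t) 0) - 0) (at_right 0)"
      unfolding q_def by (intro tendsto_intros)
    then have "sqrt (q (t' - t) 0) - 0 \<le> d (\<phi> (t, a)) (\<phi> (t', b))"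
      using * by (intro tendsto_upperbound[where F = "at_right 0"]) (auto simp: eventually_at_right_less eventually_at_filter)
    then show ?thesis using equal by simp
  qed
  have "d (\<phi> (t, a)) (\<phi> (t', b)) = sqrt (q (t' - t) (b - a))"
    using ge up[OF ab] by (simp add: order_antisym)
  then show ?thesis using q0 by (simp add: q_def)
qed


text \<open>A shear turns the oblique coordinates into Cartesian ones. The image is closed because
  Cauchy sequences pull back to the closed half-plane, and convex because geodesics are unique and
  straight segments already supply them.\<close>

lemma bounds_flat_half_planeI:
  fixes s :: real
  assumes line: "geodesic_line M d \<sigma>" and \<phi>M: "\<And>t a. 0 \<le> a \<Longrightarrow> \<phi> (t, a) \<in> M"
    and \<phi>0: "\<And>t. \<phi> (t, 0) = \<sigma> t" and s: "\<bar>s\<bar> < 1"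
    and iso: "\<And>t a t' b. 0 \<le> a \<Longrightarrow> 0 \<le> b \<Longrightarrow>
      (d (\<phi> (t, a)) (\<phi> (t', b)))\<^sup>2 = (t' - t)\<^sup>2 - 2 * s * (t' - t) * (b - a) + (b - a)\<^sup>2"
  shows "bounds_flat_half_plane M d \<sigma>"
proof -
  define k where "k = sqrt (1 - s\<^sup>2)"
  have "s\<^sup>2 < 1" using s by (simp add: abs_square_less_1)
  then have k: "k > 0" "k\<^sup>2 = 1 - s\<^sup>2" by (auto simp: k_def)
  \<comment> \<open>The shift of the second coordinate removes the mixed term. What is left of the
    form is \<open>C^2 + (1 - s^2) * e^2\<close>, and division of the height by \<open>k\<close>
    normalizes it.\<close>
  define \<psi> where "\<psi> p = \<phi> (snd p + s * fst p / k, fst p / k)" for p :: "real \<times> real"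
  define H where "H = {0::real..} \<times> (UNIV :: real set)"
  have H: "convex H" "closed H" by (auto simp: H_def intro!: convex_Times closed_Times)
  have \<psi>M: "\<psi> p \<in> M" if "p \<in> H" for p using that k by (auto simp: \<psi>_def H_def intro!: \<phi>M)
  have dist: "d (\<psi> p) (\<psi> q) = dist p q" if pq: "p \<in> H" "q \<in> H" for p q
  proof -
    define e C where "e = fst q / k - fst p / k" and "C = snd q - snd p"
    have "(d (\<psi> p) (\<psi> q))\<^sup>2 = (C + s * e)\<^sup>2 - 2 * s * (C + s * e) * e + e\<^sup>2"
    proof -
      have "snd q + s * fst q / k - (snd p + s * fst p / k) = C + s * e"
        by (simp add: C_def e_def algebra_simps)
      then show ?thesis using iso[of "fst p / k" "fst q / k" "snd p + s * fst p / k" "snd q + s * fst q / k"] pq k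
        by (auto simp: \<psi>_def H_def e_def)
    qed
    also have "\<dots> = C\<^sup>2 + (1 - s\<^sup>2) * e\<^sup>2" by (simp add: algebra_simps power2_eq_square)
    also have "\<dots> = C\<^sup>2 + (k * e)\<^sup>2" using k by (simp add: power_mult_distrib)
    also have "k * e = fst q - fst p" using k by (simp add: e_def field_simps)
    finally have "(d (\<psi> p) (\<psi> q))\<^sup>2 = (dist p q)\<^sup>2"
      by (cases p; cases q) (simp add: C_def dist_Pair_Pair dist_real_def power2_commute)
    then show ?thesis by simp
  qed
  have "closedin mtopology (\<psi> ` H)"
    unfolding metric_closedin_iff_sequentially_closed
  proof (intro conjI allI impI)
    show "\<psi> ` H \<subseteq> M" using \<psi>M by auto
    fix y l assume *: "range y \<subseteq> \<psi> ` H \<and> limitin mtopology y l sequentially"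
    then have "\<forall>n. \<exists>p\<in>H. y n = \<psi> p" by auto
    then obtain p where p: "\<And>n. p n \<in> H" "\<And>n. y n = \<psi> (p n)" by metis
    have "MCauchy y" using * \<psi>M p by (intro convergent_imp_MCauchy) auto
    then have "Cauchy p" using p dist by (simp add: MCauchy_def Cauchy_def)
    then obtain q where q: "p \<longlonglongrightarrow> q" using Cauchy_convergent convergent_def by blast
    have qH: "q \<in> H" using closed_sequentially[OF H(2)] p(1) q by blast
    have "limitin mtopology y (\<psi> q) sequentially"
      unfolding limit_metric_sequentially
      using q \<psi>M[OF qH] \<psi>M[OF p(1)] p qH by (simp add: dist lim_sequentially)
    then have "l = \<psi> q" using * limitin_metric_unique by (metis trivial_limit_sequentially)
    then show "l \<in> \<psi> ` H" using qH by simp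
  qed
  moreover have "geodesically_convex M d (\<psi> ` H)"
    unfolding geodesically_convex_def
  proof (intro ballI allI impI)
    fix x y \<gamma> assume "x \<in> \<psi> ` H" "y \<in> \<psi> ` H" and g: "geodesic_segment M d \<gamma> x y"
    then obtain p q where pq: "p \<in> H" "q \<in> H" "x = \<psi> p" "y = \<psi> q" by auto
    define D where "D = d x y"
    have D: "D = dist p q" using dist pq by (simp add: D_def)
    define c where "c t = p + (t / D) *\<^sub>R (q - p)" for t
    have cH: "c t \<in> H" if "0 \<le> t" "t \<le> D" for t
    proof -
      have "c t = (1 - t / D) *\<^sub>R p + (t / D) *\<^sub>R q" by (simp add: c_def algebra_simps)
      then show ?thesis using H(1) pq that by (auto intro!: convexD simp: divide_le_eq_1)
    qed
    have "geodesic_segment M d (\<lambda>t. \<psi> (c t)) x y"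
      unfolding geodesic_segment_def D_def[symmetric]
    proof (intro conjI ballI)
      show "\<psi> (c 0) = x" using pq by (simp add: c_def)
      show "\<psi> (c D) = y" using pq D by (cases "D = 0") (auto simp: c_def)
      fix s t assume st: "s \<in> {0..D}" "t \<in> {0..D}"
      have "d (\<psi> (c s)) (\<psi> (c t)) = dist (c s) (c t)" using dist cH st by auto
      also have "\<dots> = norm ((s / D - t / D) *\<^sub>R (q - p))"
        by (simp add: c_def dist_norm scaleR_diff_left)
      also have "\<dots> = \<bar>s / D - t / D\<bar> * D" by (simp add: D dist_norm norm_minus_commute)
      also have "\<dots> = \<bar>s - t\<bar>"
      proof (cases "D = 0")
        case False
        then have "D > 0" using D by simp
        then show ?thesis by (simp add: field_simps flip: diff_divide_distrib)
      qed (use st in auto)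
      finally show "d (\<psi> (c s)) (\<psi> (c t)) = \<bar>s - t\<bar>" .
    qed (use geodesic_segmentD[OF g] \<psi>M cH in auto)
    then have "\<gamma> t = \<psi> (c t)" if "t \<in> {0..D}" for t
      using geodesic_unique[OF g] that by (auto simp: D_def)
    then show "\<gamma> ` {0..d x y} \<subseteq> \<psi> ` H" using cH by (auto simp: D_def)
  qed
  moreover have "\<psi> ` ({0} \<times> UNIV) = range \<sigma>"
  proof -
    have "\<psi> (0, v) = \<sigma> v" for v using \<phi>0 by (simp add: \<psi>_def)
    moreover have "{0} \<times> (UNIV :: real set) = range (Pair (0::real))" by auto
    ultimately show ?thesis by (simp add: image_image)
  qed
  ultimately show ?thesis
    unfolding bounds_flat_half_plane_def H_def[symmetric]
    by (intro exI[of _ "\<psi> ` H"] exI[of _ \<psi>] conjI image_subsetI ballI \<psi>M dist refl)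
qed

text \<open>The witnesses of \<open>almost_linear\<close> run off to infinity, and the geodesics to
  them from the points of \<sigma> become rays. The law of cosines at the distant vertex controls
  the limits of their mutual distances through \<sigma> and the slope \<open>s\<close>
  alone.\<close>

lemma flat_half_plane:
  assumes line: "geodesic_line M d \<sigma>" and proper: "\<And>x r. compactin mtopology (mcball x r)"
    and s: "\<bar>s\<bar> < 1"
    and almost_linear: "\<And>n::nat. \<exists>x\<in>M. \<forall>t. \<bar>t\<bar> \<le> real n \<longrightarrow> \<bar>d x (\<sigma> t) - d x (\<sigma> 0) - s * t\<bar> \<le> 1 / real (Suc n)"
  shows "bounds_flat_half_plane M d \<sigma>"
proof -
  have \<sigma>M: "\<sigma> t \<in> M" for t using geodesic_lineD[OF line] by auto
  obtain x where x: "\<And>n. x n \<in> M"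
    and xl: "\<And>n t. \<bar>t\<bar> \<le> real n \<Longrightarrow> \<bar>d (x n) (\<sigma> t) - d (x n) (\<sigma> 0) - s * t\<bar> \<le> 1 / real (Suc n)"
    using almost_linear by metis
  define A where "A t n = d (x n) (\<sigma> t)" for t n
  \<comment> \<open>The linear terms at \<open>n\<close> and \<open>- n\<close> cancel, so the
    triangle inequality forces \<open>x n\<close> away from the line.\<close>
  have A0: "A 0 n \<ge> real n - 1" for n
  proof -
    have "2 * real n = d (\<sigma> (- real n)) (\<sigma> (real n))" using geodesic_lineD[OF line] by simp
    also have "\<dots> \<le> A (- real n) n + A (real n) n" using triangle''[OF \<sigma>M x \<sigma>M] by (simp add: A_def)
    also have "\<dots> \<le> 2 * A 0 n + 2 / real (Suc n)"
      using xl[of "real n" n] xl[of "- real n" n] by (simp add: A_def)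
    also have "2 / real (Suc n) \<le> 2" by (simp add: field_simps)
    finally show ?thesis by simp
  qed
  have A_inf: "filterlim (A t) at_top sequentially" for t
  proof -
    have "- (1 + \<bar>t\<bar>) + real n \<le> A t n" for n
      using A0[of n] triangle'[OF x[of n] \<sigma>M[of t] \<sigma>M[of 0]] geodesic_lineD(2)[OF line, of 0 t]
        geodesic_lineD(2)[OF line, of t 0]
      by (simp add: A_def)
    then show ?thesis
      by (intro filterlim_at_top_mono[OF filterlim_tendsto_add_at_top[OF tendsto_const filterlim_real_sequentially]] always_eventually allI)
  qed
  have A_lin: "(\<lambda>n. A t n - A 0 n) \<longlonglongrightarrow> s * t" for t
  proof (rule Lim_transform_bound[of _ "\<lambda>n. 1 / real (Suc n)", THEN LIM_zero_cancel])
    show "\<forall>\<^sub>F n in sequentially. norm (A t n - A 0 n - s * t) \<le> norm (1 / real (Suc n))"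
      using xl by (intro eventually_sequentiallyI[of "nat \<lceil>\<bar>t\<bar>\<rceil>"]) (auto simp: A_def nat_le_iff ceiling_le_iff)
    show "(\<lambda>n. 1 / real (Suc n)) \<longlonglongrightarrow> 0" using LIMSEQ_inverse_real_of_nat by (simp add: inverse_eq_divide)
  qed
  have "\<exists>c. geodesic_segment M d c (\<sigma> t) (x n)" for t n using geodesic_exists \<sigma>M x by blast
  then obtain c where c: "\<And>t n. geodesic_segment M d (c t n) (\<sigma> t) (x n)" by metis
  \<comment> \<open>Clipping makes \<open>f n\<close> total with values in the compact balls
    \<open>B\<close>. For fixed \<open>a\<close> at least 0 it is inactive once \<open>x n\<close>
    is far away.\<close>
  define clip where "clip t a n = max 0 (min a (A t n))" for t a n
  have clip: "0 \<le> clip t a n" "clip t a n \<le> d (\<sigma> t) (x n)" "0 \<le> a \<Longrightarrow> clip t a n \<le> a" for t a n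
    by (auto simp: clip_def A_def commute)
  define f where "f n p = c (fst p) n (clip (fst p) (snd p) n)" for n p
  define B where "B p = mcball (\<sigma> (fst p)) (max 0 (snd p))" for p
  have fB: "f n p \<in> B p" for n p
    unfolding f_def B_def in_mcball
    using geodesic_subsegment(1)[OF c clip(1,2)] geodesic_segmentD(5)[OF c clip(1,2)] \<sigma>M
    by (auto simp: clip_def)
  obtain \<phi> where \<phi>B: "\<And>p. \<phi> p \<in> B p"
    and cl: "\<And>p q e N. e > 0 \<Longrightarrow> \<exists>n\<ge>N. \<bar>d (\<phi> p) (\<phi> q) - d (f n p) (f n q)\<bar> < e"
    using cluster_map[of B f] proper fB by (auto simp: B_def) metis
  have \<phi>0: "\<phi> (t, 0) = \<sigma> t" for t
    using \<phi>B[of "(t, 0)"] order.antisym[OF _ nonneg] by (fastforce simp: B_def)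
  have f0: "f n (t, 0) = \<sigma> t" for n t
    using geodesic_segmentD(3)[OF c] by (simp add: f_def clip_def A_def)
  have \<phi>M: "\<phi> (t, a) \<in> M" for t a using \<phi>B[of "(t, a)"] by (simp add: B_def)
  \<comment> \<open>For each pair \<open>cl\<close> supplies only some large \<open>n\<close>, so
    only bounds valid for all large \<open>n\<close> pass to \<phi>.\<close>
  have lim_le: "d (\<phi> p) (\<phi> q) \<le> u"
    if G: "\<forall>\<^sub>F n in sequentially. d (f n p) (f n q) \<le> G n" "G \<longlonglongrightarrow> u" for p q G u
  proof (rule field_le_epsilon)
    fix e :: real assume e: "e > 0"
    have "\<forall>\<^sub>F n in sequentially. G n < u + e/2" using G(2) e by (intro order_tendstoD) auto
    then have "\<forall>\<^sub>F n in sequentially. d (f n p) (f n q) < u + e/2" using G(1) by eventually_elim simp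
    then obtain N where N: "\<And>n. n \<ge> N \<Longrightarrow> d (f n p) (f n q) < u + e/2" by (auto simp: eventually_sequentially)
    obtain n where "n \<ge> N" "\<bar>d (\<phi> p) (\<phi> q) - d (f n p) (f n q)\<bar> < e/2" using cl[of "e/2" N p q] half_gt_zero[OF e] by blast
    then show "d (\<phi> p) (\<phi> q) \<le> u + e" using N[of n] by linarith
  qed
  have ev: "\<forall>\<^sub>F n in sequentially. a < A t n" for a t
    using A_inf[of t] by (simp add: filterlim_at_top_dense)
  have \<phi>a: "d (\<sigma> t) (\<phi> (t, a)) = a" if a: "0 \<le> a" for t a
  proof (rule order.antisym)
    show "d (\<sigma> t) (\<phi> (t, a)) \<le> a" using \<phi>B[of "(t, a)"] a by (simp add: B_def)
    show "a \<le> d (\<sigma> t) (\<phi> (t, a))"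
    proof (rule field_le_epsilon)
      fix e :: real assume e: "e > 0"
      obtain N where N: "\<And>n. n \<ge> N \<Longrightarrow> a < A t n" using ev[of a t] by (auto simp: eventually_sequentially)
      obtain n where n: "n \<ge> N" "\<bar>d (\<phi> (t, 0)) (\<phi> (t, a)) - d (f n (t, 0)) (f n (t, a))\<bar> < e" using cl[OF e] by metis
      have "d (f n (t, 0)) (f n (t, a)) = a"
        using geodesic_subsegment(1)[OF c[of t n] clip(1,2)[of t a n]] N[OF n(1)] a
        unfolding f0 by (simp add: f_def clip_def)
      then show "a \<le> d (\<sigma> t) (\<phi> (t, a)) + e" using n(2) \<phi>0 by simp
    qed
  qed
  have upper: "(d (\<phi> (t, a)) (\<phi> (t', b)))\<^sup>2 \<le> (t' - t)\<^sup>2 - 2 * s * (t' - t) * (b - a) + (b - a)\<^sup>2"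
    if ab: "0 \<le> a" "0 \<le> b" for t a t' b
  proof -
    \<comment> \<open>\<open>G n\<close> is the bound of \<open>two_sides\<close> at the vertex
      \<open>x n\<close>, rewritten through \<open>A t n - A t' n\<close>: the distances themselves
      diverge, but this difference converges.\<close>
    define G where "G n = (A t n - A t' n - a + b)\<^sup>2 + (1 - a / A t n) * (1 - b / A t' n) * ((t' - t)\<^sup>2 - (A t n - A t' n)\<^sup>2)" for n
    have "\<forall>\<^sub>F n in sequentially. d (f n (t, a)) (f n (t', b)) \<le> sqrt (G n)"
      using ev[of a t] ev[of b t']
    proof eventually_elim
      case (elim n)
      have A: "A t n > 0" "A t' n > 0" using elim ab by auto
      have e1: "c t n a = f n (t, a)" "c t' n b = f n (t', b)" using elim ab by (auto simp: f_def clip_def)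
      have e2: "d (x n) (\<sigma> t) = A t n" "d (x n) (\<sigma> t') = A t' n" "d (\<sigma> t) (x n) = A t n" "d (\<sigma> t') (x n) = A t' n"
        by (auto simp: A_def commute)
      have "(d (f n (t, a)) (f n (t', b)))\<^sup>2 \<le> (A t n - a)\<^sup>2 + (A t' n - b)\<^sup>2 -
         (A t n - a) * (A t' n - b) / (A t n * A t' n) * ((A t n)\<^sup>2 + (A t' n)\<^sup>2 - (t' - t)\<^sup>2)"
        using two_sides[OF geodesic_reverse[OF c[of t n]] geodesic_reverse[OF c[of t' n]], of "A t n - a" "A t' n - b"]
          elim ab geodesic_lineD(2)[OF line, of t t']
        by (simp add: e1 e2 power2_commute)
      also have "\<dots> = G n" using A unfolding G_def by (simp add: field_simps power2_eq_square)
      finally show ?case by (rule real_le_rsqrt)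
    qed
    moreover have "(\<lambda>n. sqrt (G n)) \<longlonglongrightarrow> sqrt ((s * t - s * t' - a + b)\<^sup>2 + (1 - 0) * (1 - 0) * ((t' - t)\<^sup>2 - (s * t - s * t')\<^sup>2))"
    proof -
      have *: "(\<lambda>n. A t n - A t' n) \<longlonglongrightarrow> s * t - s * t'"
        using tendsto_diff[OF A_lin[of t] A_lin[of t']] by simp
      have **: "(\<lambda>n. a / A t n) \<longlonglongrightarrow> 0" for a t
        using A_inf by (intro real_tendsto_divide_at_top[OF tendsto_const])
      show ?thesis unfolding G_def by (intro tendsto_intros * **)
    qed
    ultimately have "d (\<phi> (t, a)) (\<phi> (t', b)) \<le> sqrt ((s * t - s * t' - a + b)\<^sup>2 + (1 - 0) * (1 - 0) * ((t' - t)\<^sup>2 - (s * t - s * t')\<^sup>2))"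
      by (rule lim_le)
    also have "(s * t - s * t' - a + b)\<^sup>2 + (1 - 0) * (1 - 0) * ((t' - t)\<^sup>2 - (s * t - s * t')\<^sup>2)
      = (t' - t)\<^sup>2 - 2 * s * (t' - t) * (b - a) + (b - a)\<^sup>2"
      by (simp add: algebra_simps power2_eq_square)
    finally have *: "d (\<phi> (t, a)) (\<phi> (t', b)) \<le> sqrt ((t' - t)\<^sup>2 - 2 * s * (t' - t) * (b - a) + (b - a)\<^sup>2)" .
    have "0 \<le> (t' - t)\<^sup>2 - 2 * s * (t' - t) * (b - a) + (b - a)\<^sup>2"
      using order.trans[OF nonneg *] by simp
    then show ?thesis using power_mono[OF * nonneg, of 2] by simp
  qed
  show ?thesis
    by (rule bounds_flat_half_planeI[OF line \<phi>M \<phi>0 s flat_half_plane_isometry[OF line \<phi>M \<phi>0 \<phi>a upper s]])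
qed

end

section \<open>Rank one lines\<close>

text \<open>
  A point is left of \<open>\<tau>\<close> if its projection to the line \<open>\<sigma>\<close> is at most \<open>\<tau>\<close>, by convexity of the
  distance to the point.
\<close>

definition left_of :: "('a \<Rightarrow> 'a \<Rightarrow> real) \<Rightarrow> (real \<Rightarrow> 'a) \<Rightarrow> 'a \<Rightarrow> real \<Rightarrow> bool" where
  "left_of d \<sigma> x \<tau> \<longleftrightarrow> (\<forall>t\<ge>0. d x (\<sigma> \<tau>) \<le> d x (\<sigma> (\<tau> + t)))"

definition right_of :: "('a \<Rightarrow> 'a \<Rightarrow> real) \<Rightarrow> (real \<Rightarrow> 'a) \<Rightarrow> 'a \<Rightarrow> real \<Rightarrow> bool" where
  "right_of d \<sigma> x \<tau> \<longleftrightarrow> left_of d (\<lambda>t. \<sigma> (- t)) x (- \<tau>)"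

lemma right_of_iff: "right_of d \<sigma> x \<tau> \<longleftrightarrow> (\<forall>t\<ge>0. d x (\<sigma> \<tau>) \<le> d x (\<sigma> (\<tau> - t)))"
  by (simp add: right_of_def left_of_def)

text \<open>The map \<open>g\<close> takes the point at parameter \<open>a\<close> to within
  \<open>l\<close> of \<open>\<sigma> 0\<close>. This retains only the cocompactness of a
  translation along the line and is symmetric under reversal.\<close>

definition periodic_line :: "'a set \<Rightarrow> ('a \<Rightarrow> 'a \<Rightarrow> real) \<Rightarrow> (real \<Rightarrow> 'a) \<Rightarrow> bool" where
  "periodic_line M d \<sigma> \<longleftrightarrow> geodesic_line M d \<sigma> \<and>
     (\<exists>l. \<forall>a. \<exists>g b. \<bar>a + b\<bar> \<le> l \<and> (\<forall>y\<in>M. g y \<in> M) \<and>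
        (\<forall>y\<in>M. \<forall>z\<in>M. d (g y) (g z) = d y z) \<and> (\<forall>t. g (\<sigma> t) = \<sigma> (t + b)))"

text \<open>A form of the contraction property of rank one axes, stated for geodesics between points
  with distant projections. One constant serves both as margin for the projections and as bound for
  the distance.\<close>

definition contracting_line :: "'a set \<Rightarrow> ('a \<Rightarrow> 'a \<Rightarrow> real) \<Rightarrow> (real \<Rightarrow> 'a) \<Rightarrow> real \<Rightarrow> bool" where
  "contracting_line M d \<sigma> T \<longleftrightarrow> geodesic_line M d \<sigma> \<and> 0 < T \<and>
     (\<forall>\<tau> p q \<gamma>. geodesic_segment M d \<gamma> p q \<and> left_of d \<sigma> p (\<tau> - T) \<and> right_of d \<sigma> q (\<tau> + T) \<longrightarrow>
        (\<exists>u\<in>{0..d p q}. d (\<gamma> u) (\<sigma> \<tau>) \<le> T))"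

lemma geodesic_line_reverse: "geodesic_line M d \<sigma> \<Longrightarrow> geodesic_line M d (\<lambda>t. \<sigma> (- t))"
  by (auto simp: geodesic_line_def)

lemma periodic_line_reverse:
  assumes "periodic_line M d \<sigma>"
  shows "periodic_line M d (\<lambda>t. \<sigma> (- t))"
proof -
  obtain l where l: "\<And>a. \<exists>g b. \<bar>a + b\<bar> \<le> l \<and> (\<forall>y\<in>M. g y \<in> M) \<and>
        (\<forall>y\<in>M. \<forall>z\<in>M. d (g y) (g z) = d y z) \<and> (\<forall>t. g (\<sigma> t) = \<sigma> (t + b))"
    using assms unfolding periodic_line_def by blast
  have "\<exists>g b. \<bar>a + b\<bar> \<le> l \<and> (\<forall>y\<in>M. g y \<in> M) \<and>
        (\<forall>y\<in>M. \<forall>z\<in>M. d (g y) (g z) = d y z) \<and> (\<forall>t. g (\<sigma> (- t)) = \<sigma> (- (t + b)))" for a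
  proof -
    obtain g b where "\<bar>- a + b\<bar> \<le> l" "\<forall>y\<in>M. g y \<in> M"
        "\<forall>y\<in>M. \<forall>z\<in>M. d (g y) (g z) = d y z" "\<forall>t. g (\<sigma> t) = \<sigma> (t + b)" using l[of "- a"] by blast
    then show ?thesis by (intro exI[of _ g] exI[of _ "- b"]) auto
  qed
  then show ?thesis using assms by (auto simp: periodic_line_def geodesic_line_reverse)
qed

lemma bounds_flat_half_plane_reverse:
  "bounds_flat_half_plane M d (\<lambda>t. \<sigma> (- t)) \<longleftrightarrow> bounds_flat_half_plane M d \<sigma>"
proof -
  have "range (\<lambda>t. \<sigma> (- t)) = range \<sigma>" by (metis equation_minus_iff fun.set_map image_image surj_def)
  then show ?thesis by (simp add: bounds_flat_half_plane_def)
qed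

lemma convex_on_slopes:
  fixes f :: "real \<Rightarrow> real"
  assumes f: "convex_on UNIV f" and "a < b" "b \<le> u" "u < v"
  shows "(f b - f a) / (b - a) \<le> (f v - f u) / (v - u)"
proof -
  have 1: "(f y - f x) / (y - x) \<le> (f z - f y) / (z - y)" if xyz: "x < y" "y < z" for x y z
  proof -
    have "(f x - f y) / (x - y) \<le> (f y - f z) / (y - z)"
      using convex_on_slope_le[OF f UNIV_I UNIV_I xyz] by linarith
    then show ?thesis using minus_divide_divide[of "f x - f y" "x - y"] minus_divide_divide[of "f y - f z" "y - z"]
      by simp
  qed
  show ?thesis
  proof (cases "b = u")
    case False
    then have "b < u" using assms by simp
    then show ?thesis using 1[of a b u] 1[of b u v] assms by linarith
  qed (use 1 assms in auto)
qed

context cat0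
begin

section \<open>Projection of points to a geodesic line\<close>

lemma line_distance_convex:
  assumes "geodesic_line M d \<sigma>" "x \<in> M"
  shows "convex_on UNIV (\<lambda>t. d x (\<sigma> t))"
proof (rule convex_on_linorderI)
  fix t a b :: real assume t: "0 < t" "t < 1" and ab: "a < b"
  have "(1 - t) * a + t * b = a + t * (b - a)" by (simp add: algebra_simps)
  then show "d x (\<sigma> ((1 - t) *\<^sub>R a + t *\<^sub>R b)) \<le> (1 - t) * d x (\<sigma> a) + t * d x (\<sigma> b)"
    using distance_convex[OF line_segment(2)[OF assms(1) less_imp_le[OF ab]] assms(2), of t]
      line_segment(1)[OF assms(1) less_imp_le[OF ab]] t by simp
qed simp

lemma line_distance_lipschitz:
  assumes "geodesic_line M d \<sigma>" "x \<in> M"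
  shows "\<bar>d x (\<sigma> s) - d x (\<sigma> t)\<bar> \<le> \<bar>s - t\<bar>"
  using mdist_reverse_triangle[of "\<sigma> s" x "\<sigma> t"] geodesic_lineD[OF assms(1)] assms(2)
  by (simp add: commute)

text \<open>Convexity: the chord from \<tau> to \<tau>' has nonnegative slope, hence so has every
  later chord.\<close>

lemma left_of_mono:
  assumes "geodesic_line M d \<sigma>" "x \<in> M" "left_of d \<sigma> x \<tau>" "\<tau> \<le> \<tau>'"
  shows "left_of d \<sigma> x \<tau>'"
  unfolding left_of_def
proof (intro allI impI)
  fix t :: real assume t: "0 \<le> t"
  let ?f = "\<lambda>t. d x (\<sigma> t)"
  show "?f \<tau>' \<le> ?f (\<tau>' + t)"
  proof (cases "\<tau> = \<tau>' \<or> t = 0")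
    case True
    then show ?thesis using assms(3) t by (auto simp: left_of_def)
  next
    case False
    then have "(?f \<tau>' - ?f \<tau>) / (\<tau>' - \<tau>) \<le> (?f (\<tau>' + t) - ?f \<tau>') / (\<tau>' + t - \<tau>')"
      using assms t by (intro convex_on_slopes line_distance_convex) auto
    moreover have "?f \<tau> \<le> ?f \<tau>'" using assms(3,4) by (auto simp: left_of_def dest: spec[of _ "\<tau>' - \<tau>"])
    then have "0 \<le> (?f \<tau>' - ?f \<tau>) / (\<tau>' - \<tau>)" using assms(4) by simp
    ultimately have "0 \<le> (?f (\<tau>' + t) - ?f \<tau>') / t" by simp
    then show ?thesis using False t by (simp add: zero_le_divide_iff)
  qed
qed

lemma right_of_mono:
  assumes "geodesic_line M d \<sigma>" "x \<in> M" "right_of d \<sigma> x \<tau>" "\<tau>' \<le> \<tau>"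
  shows "right_of d \<sigma> x \<tau>'"
  using left_of_mono[OF geodesic_line_reverse[OF assms(1)] assms(2), of "- \<tau>" "- \<tau>'"] assms(3,4)
  by (simp add: right_of_def)

lemma projection_exists:
  assumes l: "geodesic_line M d \<sigma>" and x: "x \<in> M"
  shows "\<exists>\<tau>. left_of d \<sigma> x \<tau> \<and> right_of d \<sigma> x \<tau>"
proof -
  let ?f = "\<lambda>t. d x (\<sigma> t)"
  \<comment> \<open>For \<open>\<bar>t\<bar> > R\<close> the triangle inequality gives
    \<open>?f t > ?f 0\<close>, so the minimum over the compact interval is global.\<close>
  define R where "R = 2 * ?f 0"
  have R0: "R \<ge> 0" by (simp add: R_def)
  have "continuous_on {-R..R} ?f"
    using line_distance_lipschitz[OF l x]
    by (intro lipschitz_on_continuous_on[of 1] lipschitz_onI) (auto simp: dist_real_def)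
  then obtain \<tau> where \<tau>: "\<tau> \<in> {-R..R}" "\<And>t. t \<in> {-R..R} \<Longrightarrow> ?f \<tau> \<le> ?f t"
    using continuous_attains_inf[of "{-R..R}" ?f] R0 by auto
  have "?f \<tau> \<le> ?f t" for t
  proof (cases "t \<in> {-R..R}")
    case False
    then have "\<bar>t\<bar> > R" using R0 by auto
    moreover have "\<bar>t\<bar> \<le> ?f 0 + ?f t"
      using triangle''[of "\<sigma> 0" x "\<sigma> t"] geodesic_lineD[OF l] x by simp
    ultimately show ?thesis using \<tau>(2)[of 0] R0 by (simp add: R_def)
  qed (use \<tau> in auto)
  then show ?thesis by (auto simp: left_of_def right_of_iff)
qed

lemma left_or_right:
  assumes "geodesic_line M d \<sigma>" "x \<in> M"
  shows "left_of d \<sigma> x \<tau> \<or> right_of d \<sigma> x \<tau>"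
  using projection_exists[OF assms] left_of_mono[OF assms] right_of_mono[OF assms] by (meson linear)

text \<open>The angle at the foot point is at least a right angle. In place of angles, minimality at
  \<tau> is compared with \<open>stewart\<close> at the fraction \<open>u\<close>; the result is
  divided by \<open>u\<close>, and \<open>u\<close> tends to 0.\<close>

lemma pythagoras:
  assumes l: "geodesic_line M d \<sigma>" and x: "x \<in> M" and "left_of d \<sigma> x \<tau>" "0 \<le> t"
  shows "(d x (\<sigma> \<tau>))\<^sup>2 + t\<^sup>2 \<le> (d x (\<sigma> (\<tau> + t)))\<^sup>2"
proof -
  have "(1 - u) * t\<^sup>2 \<le> (d x (\<sigma> (\<tau> + t)))\<^sup>2 - (d x (\<sigma> \<tau>))\<^sup>2" if u: "0 < u" "u \<le> 1" for u
  proof -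
    have "d x (\<sigma> \<tau>) \<le> d x (\<sigma> (\<tau> + u * t))" using assms u by (simp add: left_of_def)
    then have "(d x (\<sigma> \<tau>))\<^sup>2 \<le> (d x (\<sigma> (\<tau> + u * t)))\<^sup>2" by (simp add: power_mono)
    also have "\<dots> \<le> (1 - u) * (d x (\<sigma> \<tau>))\<^sup>2 + u * (d x (\<sigma> (\<tau> + t)))\<^sup>2 - u * (1 - u) * t\<^sup>2"
      using stewart[OF line_segment(2)[OF l, of \<tau> "\<tau> + t"] x, of u] line_segment(1)[OF l, of \<tau> "\<tau> + t"] assms u
      by simp
    finally have "u * ((1 - u) * t\<^sup>2) \<le> u * ((d x (\<sigma> (\<tau> + t)))\<^sup>2 - (d x (\<sigma> \<tau>))\<^sup>2)"
      by (simp add: algebra_simps)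
    then show ?thesis using u by simp
  qed
  moreover have "((\<lambda>u. (1 - u) * t\<^sup>2) \<longlongrightarrow> (1 - 0) * t\<^sup>2) (at_right 0)" by (intro tendsto_intros)
  ultimately have "(1 - 0) * t\<^sup>2 \<le> (d x (\<sigma> (\<tau> + t)))\<^sup>2 - (d x (\<sigma> \<tau>))\<^sup>2"
    by (intro tendsto_upperbound[where F = "at_right 0"])
      (auto intro!: eventually_at_rightI[of 0 1])
  then show ?thesis by simp
qed

text \<open>
  If the distances to points left of the line had slopes bounded away from \<open>1\<close> along the line, then
  translates of such points on which the infimum \<open>s\<close> of the slopes is nearly attained would be
  almost linear of slope \<open>s < 1\<close> on long pieces of the line.
\<close>

lemma slope_near_one:
  assumes \<sigma>: "periodic_line M d \<sigma>" and proper: "\<And>x r. compactin mtopology (mcball x r)"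
    and nf: "\<not> bounds_flat_half_plane M d \<sigma>" and s0: "s0 < 1"
  shows "\<exists>T>0. \<forall>x\<in>M. \<forall>\<tau>. left_of d \<sigma> x \<tau> \<longrightarrow> d x (\<sigma> \<tau>) + s0 * T \<le> d x (\<sigma> (\<tau> + T))"
proof (rule ccontr)
  assume contr: "\<not> ?thesis"
  have line: "geodesic_line M d \<sigma>" using \<sigma> by (simp add: periodic_line_def)
  \<comment> \<open>The slopes guaranteed, over one fixed length \<open>T\<close>, for all points
    left of the line. Under the contrary assumption their supremum \<open>s\<close> lies between 0
    and \<open>s0\<close>.\<close>
  define S where "S = {s. \<exists>T>0. \<forall>x\<in>M. \<forall>\<tau>. left_of d \<sigma> x \<tau> \<longrightarrow> d x (\<sigma> \<tau>) + s * T \<le> d x (\<sigma> (\<tau> + T))}"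
  have down: "s' \<in> S" if s: "s \<in> S" "s' \<le> s" for s s'
  proof -
    obtain T where T: "T > 0" "\<And>x \<tau>. x \<in> M \<Longrightarrow> left_of d \<sigma> x \<tau> \<Longrightarrow> d x (\<sigma> \<tau>) + s * T \<le> d x (\<sigma> (\<tau> + T))"
      using s by (auto simp: S_def)
    have "s' * T \<le> s * T" using s T by simp
    then show ?thesis using T unfolding S_def by (smt (verit) mem_Collect_eq)
  qed
  have "s0 \<notin> S" using contr by (simp add: S_def)
  then have less: "s < s0" if "s \<in> S" for s using down[OF that, of s0] that by (cases "s0 \<le> s") auto
  have 0: "0 \<in> S" unfolding S_def left_of_def by (auto intro!: exI[of _ 1])
  have bdd: "bdd_above S" by (rule bdd_aboveI[of _ s0], rule less_imp_le[OF less])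
  define s where "s = Sup S"
  have s: "0 \<le> s" "s < 1"
  proof -
    show "0 \<le> s" using cSup_upper[OF 0 bdd] by (simp add: s_def)
    have "s \<le> s0" unfolding s_def using 0 less by (intro cSup_least) (auto intro: less_imp_le)
    then show "s < 1" using s0 by simp
  qed
  have linear_piece: "\<exists>x\<in>M. \<exists>a. \<forall>t. \<bar>t\<bar> \<le> R \<longrightarrow> \<bar>d x (\<sigma> (a + t)) - d x (\<sigma> a) - s * t\<bar> \<le> 2 * \<delta> * \<bar>t\<bar>"
    if R: "0 < R" and \<delta>: "0 < \<delta>" for R \<delta>
  proof -
    have "\<exists>s'\<in>S. s - \<delta> < s'" using less_cSupE[of "s - \<delta>" S] 0 \<delta> unfolding s_def by (metis diff_less_eq empty_iff less_add_same_cancel1)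
    then have "s - \<delta> \<in> S" using down by force
    then obtain N where N: "N > 0" "\<And>x \<tau>. x \<in> M \<Longrightarrow> left_of d \<sigma> x \<tau> \<Longrightarrow> d x (\<sigma> \<tau>) + (s - \<delta>) * N \<le> d x (\<sigma> (\<tau> + N))"
      by (auto simp: S_def)
    \<comment> \<open>The mean slope is at least \<open>s - \<delta>\<close> over the first
      \<open>N\<close> units after \<tau>, and at most \<open>s + 2 * \<delta>\<close> between
      \<tau> + B and \<tau> + L. Convexity confines the slopes in between to this range, which
      leaves room \<open>R\<close> on both sides of \<tau> + A. \<open>L\<close> is so long that
      dropping the initial piece of length \<open>B\<close> raises the slope bound only from
      \<open>s + \<delta>\<close> to \<open>s + 2 * \<delta>\<close>.\<close>
    define A B where "A = N + R" and "B = A + R"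
    define L where "L = B + 1 + (s + 2 * \<delta>) * B / \<delta>"
    have B: "B > 0" using N R by (simp add: A_def B_def)
    have q: "(s + 2 * \<delta>) * B / \<delta> \<ge> 0" using s \<delta> B by simp
    have L: "L > B" using q by (simp add: L_def)
    have L2: "(s + \<delta>) * L \<le> (s + 2 * \<delta>) * (L - B)"
    proof -
      have "\<delta> * ((s + 2 * \<delta>) * B / \<delta>) \<le> \<delta> * L" using B \<delta> by (intro mult_left_mono) (auto simp: L_def)
      then have "(s + 2 * \<delta>) * B \<le> \<delta> * L" using \<delta> by simp
      then show ?thesis by (simp add: algebra_simps)
    qed
    have "s + \<delta> \<notin> S" using cSup_upper[OF _ bdd, of "s + \<delta>"] \<delta> by (auto simp: s_def)
    then obtain x \<tau> where x: "x \<in> M" and lo: "left_of d \<sigma> x \<tau>" and up: "d x (\<sigma> (\<tau> + L)) < d x (\<sigma> \<tau>) + (s + \<delta>) * L"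
    proof -
      have "0 < L" using L B by simp
      then show ?thesis using \<open>s + \<delta> \<notin> S\<close> that unfolding S_def not_le[symmetric] by blast
    qed
    define f where "f t = d x (\<sigma> t)" for t
    have cf: "convex_on UNIV f" unfolding f_def using line_distance_convex[OF line x] .
    have lowN: "s - \<delta> \<le> (f (\<tau> + N) - f \<tau>) / (\<tau> + N - \<tau>)"
      using N(2)[OF x lo] N(1) by (simp add: f_def field_simps)
    have "f \<tau> \<le> f (\<tau> + B)" using lo B by (simp add: left_of_def f_def)
    then have "f (\<tau> + L) - f (\<tau> + B) \<le> (s + 2 * \<delta>) * (L - B)" using up L2 by (simp add: f_def)
    then have upL: "(f (\<tau> + L) - f (\<tau> + B)) / (\<tau> + L - (\<tau> + B)) \<le> s + 2 * \<delta>" using L by (simp add: field_simps)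
    have mid: "(s - \<delta>) * (v - u) \<le> f v - f u \<and> f v - f u \<le> (s + 2 * \<delta>) * (v - u)"
      if uv: "\<tau> + N \<le> u" "u < v" "v \<le> \<tau> + B" for u v
    proof -
      have "s - \<delta> \<le> (f v - f u) / (v - u)"
        using lowN convex_on_slopes[OF cf, of \<tau> "\<tau> + N" u v] uv N by linarith
      moreover have "(f v - f u) / (v - u) \<le> s + 2 * \<delta>"
        using upL convex_on_slopes[OF cf, of u v "\<tau> + B" "\<tau> + L"] uv L by linarith
      ultimately show ?thesis using uv by (simp add: field_simps)
    qed
    have "\<bar>f (\<tau> + A + t) - f (\<tau> + A) - s * t\<bar> \<le> 2 * \<delta> * \<bar>t\<bar>" if t: "\<bar>t\<bar> \<le> R" for t
    proof (cases t "0::real" rule: linorder_cases)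
      case less
      then have "\<delta> * t \<le> 0" using \<delta> by (simp add: mult_le_0_iff)
      then show ?thesis using mid[of "\<tau> + A + t" "\<tau> + A"] less t by (simp add: A_def B_def abs_le_iff algebra_simps)
    next
      case greater
      then have "\<delta> * t \<ge> 0" using \<delta> by simp
      then show ?thesis using mid[of "\<tau> + A" "\<tau> + A + t"] greater t by (simp add: A_def B_def abs_le_iff algebra_simps)
    qed simp
    then show ?thesis using x unfolding f_def by blast
  qed
  obtain l where l: "\<And>a. \<exists>g b. \<bar>a + b\<bar> \<le> l \<and> (\<forall>y\<in>M. g y \<in> M) \<and>
        (\<forall>y\<in>M. \<forall>z\<in>M. d (g y) (g z) = d y z) \<and> (\<forall>t. g (\<sigma> t) = \<sigma> (t + b))"
    using \<sigma> unfolding periodic_line_def by blast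
  have l0: "l \<ge> 0" using l[of 0] by (meson abs_ge_zero order_trans)
  have "\<exists>x\<in>M. \<forall>t. \<bar>t\<bar> \<le> real n \<longrightarrow> \<bar>d x (\<sigma> t) - d x (\<sigma> 0) - s * t\<bar> \<le> 1 / real (Suc n)" for n :: nat
  proof -
    \<comment> \<open>The translation by \<open>g\<close> misses the origin by up to
      \<open>l\<close>, hence the extra room. \<delta> is chosen so that two errors of size
      \<open>2 * \<delta> * R\<close> add up to \<open>1 / real (Suc n)\<close>.\<close>
    define R where "R = real n + l + 1"
    define \<delta> where "\<delta> = 1 / (4 * R * real (Suc n))"
    have R: "R > 0" using l0 by (simp add: R_def)
    have \<delta>: "\<delta> > 0" using R by (simp add: \<delta>_def)
    obtain x a where x: "x \<in> M" and xa: "\<And>t. \<bar>t\<bar> \<le> R \<Longrightarrow> \<bar>d x (\<sigma> (a + t)) - d x (\<sigma> a) - s * t\<bar> \<le> 2 * \<delta> * \<bar>t\<bar>"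
      using linear_piece[OF R \<delta>] by blast
    obtain g b where g: "\<bar>a + b\<bar> \<le> l" "\<And>y. y \<in> M \<Longrightarrow> g y \<in> M"
        "\<And>y z. y \<in> M \<Longrightarrow> z \<in> M \<Longrightarrow> d (g y) (g z) = d y z" "\<And>t. g (\<sigma> t) = \<sigma> (t + b)"
      using l[of a] by blast
    have e: "d (g x) (\<sigma> t) = d x (\<sigma> (a + (t - (a + b))))" for t
      using g(3)[OF x, of "\<sigma> (t - b)"] g(4)[of "t - b"] geodesic_lineD[OF line] by simp
    have bd: "\<bar>d x (\<sigma> (a + t)) - d x (\<sigma> a) - s * t\<bar> \<le> 2 * \<delta> * R" if "\<bar>t\<bar> \<le> R" for t
    proof -
      have "2 * \<delta> * \<bar>t\<bar> \<le> 2 * \<delta> * R" using that \<delta> by (intro mult_left_mono) auto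
      then show ?thesis using xa[OF that] by linarith
    qed
    have "\<bar>d (g x) (\<sigma> t) - d (g x) (\<sigma> 0) - s * t\<bar> \<le> 1 / real (Suc n)" if t: "\<bar>t\<bar> \<le> real n" for t
    proof -
      have "\<bar>d (g x) (\<sigma> t) - d (g x) (\<sigma> 0) - s * t\<bar> =
        \<bar>(d x (\<sigma> (a + (t - (a + b)))) - d x (\<sigma> a) - s * (t - (a + b))) -
         (d x (\<sigma> (a + (0 - (a + b)))) - d x (\<sigma> a) - s * (0 - (a + b)))\<bar>"
        unfolding e by (simp add: algebra_simps)
      also have "\<dots> \<le> 2 * \<delta> * R + 2 * \<delta> * R"
        using bd[of "t - (a + b)"] bd[of "0 - (a + b)"] t g(1) l0 unfolding R_def
        by (smt (verit))
      also have "\<dots> = 1 / real (Suc n)"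
      proof -
        have "2 * (1 / (4 * R * K)) * R + 2 * (1 / (4 * R * K)) * R = 1 / K" if "K > 0" for K
          using R that by (simp add: field_simps)
        then show ?thesis unfolding \<delta>_def by (metis of_nat_0_less_iff zero_less_Suc)
      qed
      finally show ?thesis .
    qed
    then show ?thesis using g(2)[OF x] by blast
  qed
  then have "bounds_flat_half_plane M d \<sigma>"
    using flat_half_plane[OF line proper, of s] s by simp
  then show False using nf by simp
qed

text \<open>Growth with slope close to 1 makes the comparison angle at
  \<open>\<sigma> (\<tau> + T)\<close> small, so the geodesic towards \<open>p\<close> leaves almost
  along the line. The first conclusion ensures that it is long enough to be evaluated at
  \<open>T\<close>.\<close>

lemma geodesic_near_line:
  assumes line: "geodesic_line M d \<sigma>" and p: "p \<in> M" and T: "0 < T" and s: "0 \<le> s" "s \<le> 1"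
    and left: "left_of d \<sigma> p \<tau>" and slope: "d p (\<sigma> \<tau>) + s * T \<le> d p (\<sigma> (\<tau> + T))"
    and \<gamma>: "geodesic_segment M d \<gamma> (\<sigma> (\<tau> + T)) p"
  shows "T \<le> d (\<sigma> (\<tau> + T)) p" "(d (\<gamma> T) (\<sigma> \<tau>))\<^sup>2 \<le> 2 * (1 - s) * T\<^sup>2"
proof -
  define E D where "E = d (\<sigma> (\<tau> + T)) p" and "D = d p (\<sigma> \<tau>)"
  have E: "E = d p (\<sigma> (\<tau> + T))" by (simp add: E_def commute)
  have "D\<^sup>2 + T\<^sup>2 \<le> E\<^sup>2" using pythagoras[OF line p left less_imp_le[OF T]] by (simp add: D_def E)
  then have "T\<^sup>2 \<le> E\<^sup>2" using zero_le_power2[of D] by linarith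
  then show TE: "T \<le> d (\<sigma> (\<tau> + T)) p" unfolding E_def by (rule power2_le_imp_le) simp
  have len: "d (\<sigma> \<tau>) (\<sigma> (\<tau> + T)) = T" "d (\<sigma> (\<tau> + T)) (\<sigma> \<tau>) = T"
    using geodesic_lineD[OF line] T by simp_all
  define \<beta> where "\<beta> = (\<lambda>t. \<sigma> (\<tau> + (T - t)))"
  have \<beta>: "geodesic_segment M d \<beta> (\<sigma> (\<tau> + T)) (\<sigma> \<tau>)"
    using geodesic_reverse[OF line_segment(2)[OF line, of \<tau> "\<tau> + T"]] T len by (simp add: \<beta>_def)
  have "(d (\<gamma> T) (\<beta> T))\<^sup>2 \<le> T\<^sup>2 + T\<^sup>2 - T * T / (E * T) * (E\<^sup>2 + T\<^sup>2 - D\<^sup>2)"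
    using two_sides[OF \<gamma> \<beta>, of T T] T TE len by (simp add: E_def D_def)
  also have "\<dots> = 2 * T\<^sup>2 - T / E * (E\<^sup>2 + T\<^sup>2 - D\<^sup>2)" using T by simp
  also have "\<dots> \<le> 2 * T\<^sup>2 - T / E * (2 * s * T * E)"
  proof -
    have "D\<^sup>2 \<le> (E - s * T)\<^sup>2" using slope by (intro power_mono) (auto simp: E D_def)
    moreover have "s\<^sup>2 * T\<^sup>2 \<le> T\<^sup>2" using s by (intro mult_left_le_one_le) (auto simp: abs_square_le_1)
    ultimately have "2 * s * T * E \<le> E\<^sup>2 + T\<^sup>2 - D\<^sup>2" by (simp add: algebra_simps power2_eq_square)
    then show ?thesis using T by (intro diff_left_mono mult_left_mono) (auto simp: E_def)
  qed
  also have "\<dots> = 2 * (1 - s) * T\<^sup>2"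
  proof -
    have "E > 0" using T TE by (simp add: E_def)
    then show ?thesis by (simp add: field_simps power2_eq_square)
  qed
  finally show "(d (\<gamma> T) (\<sigma> \<tau>))\<^sup>2 \<le> 2 * (1 - s) * T\<^sup>2" by (simp add: \<beta>_def)
qed

text \<open>The comparison angle at \<open>\<sigma> \<tau>\<close> between \<open>p\<close> and \<open>z\<close> is close to \<open>\<pi>\<close>.\<close>

lemma detour:
  assumes line: "geodesic_line M d \<sigma>" and p: "p \<in> M" and z: "z \<in> M" and T: "0 < T"
    and left: "left_of d \<sigma> p (\<tau> - T)" "d p (\<sigma> (\<tau> - T)) + 127/128 * T \<le> d p (\<sigma> \<tau>)"
    and right: "right_of d \<sigma> z (\<tau> + T)" "d z (\<sigma> (\<tau> + T)) + 127/128 * T \<le> d z (\<sigma> \<tau>)"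
  shows "d p (\<sigma> \<tau>) + d z (\<sigma> (\<tau> + T)) / 2 \<le> d p z"
proof -
  have \<sigma>M: "\<sigma> t \<in> M" for t using geodesic_lineD[OF line] by simp
  obtain \<alpha> where \<alpha>: "geodesic_segment M d \<alpha> (\<sigma> \<tau>) p" using geodesic_exists \<sigma>M p by blast
  obtain \<beta> where \<beta>: "geodesic_segment M d \<beta> (\<sigma> \<tau>) z" using geodesic_exists \<sigma>M z by blast
  define E F G where "E = d (\<sigma> \<tau>) p" and "F = d (\<sigma> \<tau>) z" and "G = d p z"
  \<comment> \<open>The slope 127/128 is chosen for this: \<open>2 * (1 - 127/128)\<close> is the
    square of 1/8.\<close>
  have eighth: "x \<le> T / 8" if "x\<^sup>2 \<le> 2 * (1 - 127/128) * T\<^sup>2" for x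
    by (rule power2_le_imp_le) (use that T in \<open>auto simp: power_divide\<close>)
  have a: "T \<le> E" "d (\<alpha> T) (\<sigma> (\<tau> - T)) \<le> T / 8"
    using geodesic_near_line[OF line p T _ _ left(1), of "127/128" \<alpha>] left(2) \<alpha> eighth by (auto simp: E_def)
  have b: "T \<le> F" "d (\<beta> T) (\<sigma> (\<tau> + T)) \<le> T / 8"
    using geodesic_near_line[OF geodesic_line_reverse[OF line] z T _ _ right(1)[unfolded right_of_def], of "127/128" \<beta>]
      right(2) \<beta> eighth by (auto simp: F_def add.commute)
  have M: "\<alpha> T \<in> M" "\<beta> T \<in> M"
    using a b T geodesic_segmentD(5)[OF \<alpha>] geodesic_segmentD(5)[OF \<beta>] by (auto simp: E_def F_def)
  have "2 * T = d (\<sigma> (\<tau> - T)) (\<sigma> (\<tau> + T))" using geodesic_lineD[OF line] T by simp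
  also have "\<dots> \<le> d (\<sigma> (\<tau> - T)) (\<alpha> T) + d (\<alpha> T) (\<beta> T) + d (\<beta> T) (\<sigma> (\<tau> + T))"
    using triangle[OF \<sigma>M M(1) \<sigma>M, of "\<tau> - T" "\<tau> + T"] triangle[OF M \<sigma>M, of "\<tau> + T"] by linarith
  finally have "7 / 4 * T \<le> d (\<alpha> T) (\<beta> T)" using a b by (simp add: commute)
  \<comment> \<open>Two points at distance \<open>T\<close> from the vertex are at least
    \<open>7/4 * T\<close> apart. As 49/16 - 2 = 17/16 exceeds 1, the law of cosines yields a mixed
    term of at least \<open>E * F\<close>, which is what the square of \<open>E + F / 2\<close>
    needs.\<close>
  then have "(7 / 4 * T)\<^sup>2 \<le> (d (\<alpha> T) (\<beta> T))\<^sup>2" using T by (intro power_mono) auto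
  also have "\<dots> \<le> T\<^sup>2 + T\<^sup>2 - T * T / (E * F) * (E\<^sup>2 + F\<^sup>2 - G\<^sup>2)"
    using two_sides[OF \<alpha> \<beta>, of T T] T a b by (simp add: E_def F_def G_def)
  also have "T * T / (E * F) * (E\<^sup>2 + F\<^sup>2 - G\<^sup>2) = T\<^sup>2 * ((E\<^sup>2 + F\<^sup>2 - G\<^sup>2) / (E * F))"
    by (simp add: power2_eq_square)
  also have "(7 / 4 * T)\<^sup>2 = 49 / 16 * T\<^sup>2" by (simp add: power_mult_distrib power_divide)
  finally have "T\<^sup>2 * ((E\<^sup>2 + F\<^sup>2 - G\<^sup>2) / (E * F)) \<le> T\<^sup>2 * (- 17 / 16)" by linarith
  then have "(E\<^sup>2 + F\<^sup>2 - G\<^sup>2) / (E * F) \<le> - 17 / 16" by (rule mult_left_le_imp_le) (use T in simp)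
  then have "E\<^sup>2 + F\<^sup>2 - G\<^sup>2 \<le> - 17 / 16 * (E * F)" using T a b by (simp add: pos_divide_le_eq)
  moreover have "E * F \<ge> 0" "F\<^sup>2 \<ge> 0" using T a b by auto
  moreover have "(E + F / 2)\<^sup>2 = E\<^sup>2 + E * F + F\<^sup>2 / 4" by (simp add: power2_eq_square field_simps)
  ultimately have "(E + F / 2)\<^sup>2 \<le> G\<^sup>2" by linarith
  then have "E + F / 2 \<le> G" by (rule power2_le_imp_le) (simp add: G_def)
  moreover have "d z (\<sigma> (\<tau> + T)) \<le> F" using right(2) T by (simp add: F_def commute)
  ultimately show ?thesis by (simp add: E_def G_def commute)
qed

text \<open>The parameters whose points are left of \<tau> and those whose points are right of
  \<tau> form two closed sets covering a connected interval, each containing an end point.\<close>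

lemma point_on_geodesic_projecting_to:
  assumes line: "geodesic_line M d \<sigma>" and \<gamma>: "geodesic_segment M d \<gamma> p q"
    and "left_of d \<sigma> p \<tau>" "right_of d \<sigma> q \<tau>"
  shows "\<exists>u\<in>{0..d p q}. left_of d \<sigma> (\<gamma> u) \<tau> \<and> right_of d \<sigma> (\<gamma> u) \<tau>"
proof -
  note g = geodesic_segmentD[OF \<gamma>]
  have \<sigma>M: "\<sigma> t \<in> M" for t using geodesic_lineD[OF line] by simp
  let ?I = "{0..d p q}"
  have cont: "continuous_on ?I (\<lambda>u. d (\<gamma> u) (\<sigma> t))" for t
  proof (intro lipschitz_on_continuous_on[of 1] lipschitz_onI)
    fix u v assume "u \<in> ?I" "v \<in> ?I"
    then show "dist (d (\<gamma> u) (\<sigma> t)) (d (\<gamma> v) (\<sigma> t)) \<le> 1 * dist u v"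
      using mdist_reverse_triangle[of "\<gamma> u" "\<sigma> t" "\<gamma> v"] g \<sigma>M by (auto simp: dist_real_def commute)
  qed simp
  have closed: "closed {u \<in> ?I. \<forall>t\<ge>0. d (\<gamma> u) (\<sigma> \<tau>) \<le> d (\<gamma> u) (\<sigma> (\<tau> + c * t))}" for c
  proof -
    have "{u \<in> ?I. \<forall>t\<ge>0. d (\<gamma> u) (\<sigma> \<tau>) \<le> d (\<gamma> u) (\<sigma> (\<tau> + c * t))} =
      ?I \<inter> (\<Inter>t\<in>{0..}. {u \<in> ?I. d (\<gamma> u) (\<sigma> \<tau>) \<le> d (\<gamma> u) (\<sigma> (\<tau> + c * t))})" by auto
    also have "closed \<dots>"
      using continuous_on_closed_Collect_le[OF cont cont] by (intro closed_Int closed_INT) auto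
    finally show ?thesis .
  qed
  define A B where "A = {u \<in> ?I. left_of d \<sigma> (\<gamma> u) \<tau>}" and "B = {u \<in> ?I. right_of d \<sigma> (\<gamma> u) \<tau>}"
  have "closed A" "closed B" using closed[of 1] closed[of "-1"] by (simp_all add: A_def B_def left_of_def right_of_iff)
  moreover have "?I \<subseteq> A \<union> B"
  proof
    fix u assume "u \<in> ?I"
    then show "u \<in> A \<union> B" using left_or_right[OF line g(5)[of u], of \<tau>] by (auto simp: A_def B_def)
  qed
  moreover have "0 \<in> A \<inter> ?I" "d p q \<in> B \<inter> ?I" using assms(3,4) g by (auto simp: A_def B_def)
  ultimately have "A \<inter> B \<inter> ?I \<noteq> {}"
    using connected_closedD[of ?I A B] connected_Icc[of 0 "d p q"] by blast
  then show ?thesis by (auto simp: A_def B_def)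
qed

text \<open>Let \<open>z\<close> be a point of the geodesic that projects to \<tau>. By
  \<open>detour\<close> each half of the geodesic pays an extra
  \<open>d z (\<sigma> \<tau>) / 2\<close>, while the path along the line pays only
  \<open>2 * T\<close> for its middle piece. Hence \<open>z\<close> is within \<open>2 * T\<close>
  of the line; the margin doubles because \<open>detour\<close> needs a gap \<open>T\<close> on
  either side of its vertex.\<close>

lemma rank_one_contracting:
  assumes \<sigma>: "periodic_line M d \<sigma>" and proper: "\<And>x r. compactin mtopology (mcball x r)"
    and nf: "\<not> bounds_flat_half_plane M d \<sigma>"
  shows "\<exists>T. contracting_line M d \<sigma> T"
proof -
  have line: "geodesic_line M d \<sigma>" using \<sigma> by (simp add: periodic_line_def)
  note rline = geodesic_line_reverse[OF line]
  have \<sigma>M: "\<sigma> t \<in> M" for t using geodesic_lineD[OF line] by simp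
  let ?s = "127/128 :: real"
  obtain T1 where T1: "T1 > 0" "\<And>x \<tau>. x \<in> M \<Longrightarrow> left_of d \<sigma> x \<tau> \<Longrightarrow> d x (\<sigma> \<tau>) + ?s * T1 \<le> d x (\<sigma> (\<tau> + T1))"
    using slope_near_one[OF \<sigma> proper nf, of ?s] by auto
  obtain T2 where T2: "T2 > 0" "\<And>x \<tau>. x \<in> M \<Longrightarrow> left_of d (\<lambda>t. \<sigma> (- t)) x \<tau> \<Longrightarrow> d x (\<sigma> (- \<tau>)) + ?s * T2 \<le> d x (\<sigma> (- (\<tau> + T2)))"
    using slope_near_one[OF periodic_line_reverse[OF \<sigma>] proper, of ?s] nf
    by (auto simp: bounds_flat_half_plane_reverse)
  \<comment> \<open>The two directions of the line provide different lengths \<open>T1\<close> and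
    \<open>T2\<close>. By convexity a slope bound persists for larger lengths, so the maximum serves
    both.\<close>
  have slope_mono: "d x (\<rho> \<tau>) + ?s * T' \<le> d x (\<rho> (\<tau> + T'))"
    if "geodesic_line M d \<rho>" "x \<in> M" "0 < T" "T \<le> T'" "d x (\<rho> \<tau>) + ?s * T \<le> d x (\<rho> (\<tau> + T))" for \<rho> x \<tau> T T'
  proof (cases "T = T'")
    case False
    define f where "f t = d x (\<rho> t)" for t
    have "(f (\<tau> + T) - f \<tau>) / T \<le> (f (\<tau> + T') - f (\<tau> + T)) / (T' - T)"
      using convex_on_slopes[OF line_distance_convex[OF that(1,2)], of \<tau> "\<tau> + T" "\<tau> + T" "\<tau> + T'"] that False
      by (simp add: f_def)
    moreover have "?s \<le> (f (\<tau> + T) - f \<tau>) / T" using that by (simp add: f_def field_simps)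
    ultimately have "?s \<le> (f (\<tau> + T') - f (\<tau> + T)) / (T' - T)" by linarith
    then have "?s * (T' - T) \<le> f (\<tau> + T') - f (\<tau> + T)" using that False by (simp add: field_simps)
    then show ?thesis using that(5) unfolding f_def right_diff_distrib by linarith
  qed (use that in simp)
  define T where "T = max T1 T2"
  have T: "T > 0" using T1 by (simp add: T_def)
  have sl: "d x (\<sigma> \<tau>) + ?s * T \<le> d x (\<sigma> (\<tau> + T))" if "x \<in> M" "left_of d \<sigma> x \<tau>" for x \<tau>
    using slope_mono[OF line that(1) T1(1) _ T1(2)[OF that]] by (simp add: T_def)
  have sr: "d x (\<sigma> \<tau>) + ?s * T \<le> d x (\<sigma> (\<tau> - T))" if "x \<in> M" "right_of d \<sigma> x \<tau>" for x \<tau>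
    using slope_mono[OF rline that(1) T2(1) _ T2(2)[OF that(1), of "- \<tau>"], of T] that(2)
    by (simp add: T_def right_of_def)
  have "\<exists>u\<in>{0..d p q}. d (\<gamma> u) (\<sigma> \<tau>) \<le> 2 * T"
    if \<gamma>: "geodesic_segment M d \<gamma> p q" and l: "left_of d \<sigma> p (\<tau> - 2 * T)" and r: "right_of d \<sigma> q (\<tau> + 2 * T)" for \<tau> p q \<gamma>
  proof -
    note g = geodesic_segmentD[OF \<gamma>]
    obtain u where u: "u \<in> {0..d p q}" "left_of d \<sigma> (\<gamma> u) \<tau>" "right_of d \<sigma> (\<gamma> u) \<tau>"
      using point_on_geodesic_projecting_to[OF line \<gamma>, of \<tau>] left_of_mono[OF line g(1) l, of \<tau>]
        right_of_mono[OF line g(2) r, of \<tau>] T by auto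
    define z where "z = \<gamma> u"
    have z: "z \<in> M" using u g by (auto simp: z_def)
    have 1: "d p (\<sigma> (\<tau> - T)) + d z (\<sigma> \<tau>) / 2 \<le> d p z"
      using detour[OF line g(1) z T, of "\<tau> - T"] l u(3) sl[OF g(1) l] sr[OF z u(3)[folded z_def]] T
      by (simp add: z_def)
    have 2: "d q (\<sigma> (\<tau> + T)) + d z (\<sigma> \<tau>) / 2 \<le> d q z"
    proof -
      have "d q (\<sigma> (- (- \<tau> - T))) + d z (\<sigma> (- (- \<tau> - T + T))) / 2 \<le> d q z"
      proof (rule detour[OF rline g(2) z T])
        have e: "- \<tau> - T - T = - (\<tau> + 2 * T)" by simp
        show "left_of d (\<lambda>t. \<sigma> (- t)) q (- \<tau> - T - T)" using r unfolding e by (simp add: right_of_def)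
        have e2: "- (- \<tau> - T) = \<tau> + T" "\<tau> + 2 * T - T = \<tau> + T" by simp_all
        show "d q (\<sigma> (- (- \<tau> - T - T))) + ?s * T \<le> d q (\<sigma> (- (- \<tau> - T)))"
          using sr[OF g(2) r] unfolding e e2 by (simp add: add.commute)
        show "right_of d (\<lambda>t. \<sigma> (- t)) z (- \<tau> - T + T)" using u(2) by (simp add: right_of_def z_def)
        show "d z (\<sigma> (- (- \<tau> - T + T))) + ?s * T \<le> d z (\<sigma> (- (- \<tau> - T)))"
          using sl[OF z u(2)[folded z_def]] unfolding e2 by simp
      qed
      then show ?thesis by (simp add: add.commute)
    qed
    have "d p z + d z q = d p q" using geodesic_subsegment[OF \<gamma>, of u] u by (simp add: z_def)
    moreover have "d p q \<le> d p (\<sigma> (\<tau> - T)) + (d (\<sigma> (\<tau> - T)) (\<sigma> (\<tau> + T)) + d (\<sigma> (\<tau> + T)) q)"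
      using triangle[OF g(1) \<sigma>M g(2), of "\<tau> - T"] triangle[OF \<sigma>M \<sigma>M g(2), of "\<tau> - T" "\<tau> + T"] by linarith
    moreover have "d (\<sigma> (\<tau> - T)) (\<sigma> (\<tau> + T)) = 2 * T" using geodesic_lineD(2)[OF line] T by simp
    ultimately have "d z (\<sigma> \<tau>) \<le> 2 * T" using 1 2 by (simp add: commute)
    then show ?thesis using u by (auto simp: z_def)
  qed
  then have "contracting_line M d \<sigma> (2 * T)" using line T unfolding contracting_line_def by simp
  then show ?thesis ..
qed

end

section \<open>Rays and the cone topology\<close>

context cat0
begin

lemma asymptotic_refl: "geodesic_ray M d c \<Longrightarrow> asymptotic d c c"
  unfolding asymptotic_def using geodesic_rayD(1) by (metis mdist_zero order_refl)

lemma asymptotic_sym: "asymptotic d c c' \<Longrightarrow> asymptotic d c' c"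
  by (simp add: asymptotic_def commute)

lemma asymptotic_trans:
  assumes "geodesic_ray M d a" "geodesic_ray M d b" "geodesic_ray M d c" "asymptotic d a b" "asymptotic d b c"
  shows "asymptotic d a c"
proof -
  obtain C C' where C: "\<And>t. t \<ge> 0 \<Longrightarrow> d (a t) (b t) \<le> C" "\<And>t. t \<ge> 0 \<Longrightarrow> d (b t) (c t) \<le> C'"
    using assms unfolding asymptotic_def by blast
  have "d (a t) (c t) \<le> C + C'" if "t \<ge> 0" for t
    using C[OF that] triangle[of "a t" "b t" "c t"] assms(1-3)[THEN geodesic_rayD(1), OF that] by linarith
  then show ?thesis unfolding asymptotic_def by blast
qed

lemma in_ray_end_self: "geodesic_ray M d c \<Longrightarrow> c \<in> ray_end M d c"
  by (simp add: ray_end_def asymptotic_refl)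

lemma ray_end_eqI:
  assumes "geodesic_ray M d a" "geodesic_ray M d b" "asymptotic d a b"
  shows "ray_end M d a = ray_end M d b"
  unfolding ray_end_def using assms asymptotic_trans asymptotic_sym by blast

lemma ray_end_eq_iff:
  assumes "geodesic_ray M d a" "geodesic_ray M d b"
  shows "ray_end M d a = ray_end M d b \<longleftrightarrow> asymptotic d a b"
  using ray_end_eqI[OF assms] in_ray_end_self[OF assms(2)] by (auto simp: ray_end_def)

lemma ray_end_in_boundary: "geodesic_ray M d c \<Longrightarrow> ray_end M d c \<in> geom_boundary M d"
  by (simp add: geom_boundary_def)

lemma boundaryD:
  assumes "\<xi> \<in> geom_boundary M d" "c \<in> \<xi>"
  shows "geodesic_ray M d c" "\<xi> = ray_end M d c"
proof -
  obtain c0 where c0: "geodesic_ray M d c0" "\<xi> = ray_end M d c0" using assms by (auto simp: geom_boundary_def)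
  then show "geodesic_ray M d c" using assms by (simp add: ray_end_def)
  then show "\<xi> = ray_end M d c" using ray_end_eqI[OF c0(1)] c0 assms by (auto simp: ray_end_def)
qed

lemma boundary_nonempty: "\<xi> \<in> geom_boundary M d \<Longrightarrow> \<exists>c. c \<in> \<xi>"
  using in_ray_end_self by (auto simp: geom_boundary_def)

lemma rays_diverge:
  assumes "geodesic_ray M d a" "geodesic_ray M d b" "a 0 = b 0" "0 \<le> u" "u \<le> v"
  shows "v * d (a u) (b u) \<le> u * d (a v) (b v)"
proof -
  have v: "0 \<le> v" using assms by simp
  have "geodesic_segment M d b (a 0) (b v)" using ray_segment(2)[OF assms(2) v] assms(3) by simp
  then show ?thesis
    using geodesics_diverge[OF ray_segment(2)[OF assms(1) v], of b "b v" u v] assms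
      ray_segment(1)[OF assms(1) v] ray_segment(1)[OF assms(2) v] by simp
qed

lemma ray_segment_diverge:
  assumes "geodesic_ray M d a" "geodesic_segment M d \<gamma> (a 0) y" "0 \<le> u" "u \<le> v" "v \<le> d (a 0) y"
  shows "v * d (\<gamma> u) (a u) \<le> u * d (\<gamma> v) (a v)"
  using geodesics_diverge[OF assms(2) ray_segment(2)[OF assms(1), of v] assms(3,4,5)]
    ray_segment(1)[OF assms(1), of v] assms by simp

text \<open>The ray is the limit of the geodesics from \<open>p\<close> to \<open>c n\<close>. At a
  fixed time they form a Cauchy sequence by completeness-free comparison at \<open>p\<close>, and
  the distance bound is inherited from \<open>geodesics_same_end\<close>.\<close>

lemma asymptotic_ray_exists:
  assumes complete: mcomplete and c: "geodesic_ray M d c" and p: "p \<in> M"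
  obtains c' where "geodesic_ray M d c'" "c' 0 = p" "\<And>t. 0 \<le> t \<Longrightarrow> d (c' t) (c t) \<le> 2 * d (c 0) p"
proof -
  define D where "D = d (c 0) p"
  have D: "D \<ge> 0" by (simp add: D_def)
  have cM: "c (real n) \<in> M" for n using geodesic_rayD(1)[OF c] by simp
  obtain g where g: "\<And>n. geodesic_segment M d (g n) p (c (real n))"
    using geodesic_exists[OF p cM] by metis
  define L where "L n = d p (c (real n))" for n
  have L: "\<bar>L n - real n\<bar> \<le> D" for n
    using mdist_reverse_triangle[of p "c (real n)" "c 0"] ray_segment(1)[OF c, of "real n"] p cM[of n] cM[of 0]
    by (simp add: L_def D_def commute)
  \<comment> \<open>The triangle with vertex \<open>p\<close> is almost degenerate: its sides differ
    from \<open>n\<close> and \<open>m\<close> by at most \<open>D\<close>, and the opposite side is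
    \<open>m - n\<close>. The coarse factor \<open>4 * (real m - D)\<close> is there to cancel
    against \<open>L m\<close>, which makes the bound independent of \<open>m\<close>.\<close>
  have bound: "(d (g n u) (g m u))\<^sup>2 \<le> 8 * u\<^sup>2 * D / (real n - D)"
    if u: "0 \<le> u" and n: "D + u < real n" "2 * D < real n" and m: "n < m" for n m u
  proof -
    have 1: "real n - D \<le> L n" "real m - D \<le> L m" using L[of n] L[of m] by auto
    have 2: "u \<le> L n" "u \<le> L m" using 1 n m by auto
    have pos: "0 < real n - D" "0 < real m - D" using n m D by auto
    have "d (c (real n)) (c (real m)) = real m - real n" using geodesic_rayD(2)[OF c] m by simp
    then have "(d (g n u) (g m u))\<^sup>2 \<le> u\<^sup>2 + u\<^sup>2 - u * u / (L n * L m) * ((L n)\<^sup>2 + (L m)\<^sup>2 - (real m - real n)\<^sup>2)"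
      using two_sides[OF g[of n] g[of m], of u u] u 2 by (simp add: L_def)
    also have "\<dots> = u\<^sup>2 * ((real m - real n)\<^sup>2 - (L m - L n)\<^sup>2) / (L n * L m)"
      using 1 pos by (simp add: field_simps power2_eq_square)
    also have "\<dots> \<le> u\<^sup>2 * (2 * D * (4 * (real m - D))) / (L n * L m)"
    proof -
      have "(real m - real n)\<^sup>2 - (L m - L n)\<^sup>2 = ((real m - L m) - (real n - L n)) * ((real m - real n) + (L m - L n))"
        by (simp add: power2_eq_square algebra_simps)
      also have "\<dots> \<le> 2 * D * (4 * (real m - D))"
      proof (rule mult_mono')
        show "real m - L m - (real n - L n) \<le> 2 * D" using L[of n] L[of m] by linarith
        have *: "\<bar>L m - L n\<bar> \<le> real m - real n"
          using mdist_reverse_triangle[of "c (real m)" p "c (real n)"] p cM geodesic_rayD(2)[OF c, of "real m" "real n"] m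
          by (simp add: L_def commute)
        then show "0 \<le> real m - L m - (real n - L n)" "0 \<le> real m - real n + (L m - L n)" by linarith+
        have "real n < real m" "L m - L n \<le> real m - real n" using m * by auto
        then show "real m - real n + (L m - L n) \<le> 4 * (real m - D)" using n(2) D by argo
      qed
      finally show ?thesis using 1 pos by (intro divide_right_mono mult_left_mono) auto
    qed
    also have "\<dots> \<le> u\<^sup>2 * (2 * D * (4 * (real m - D))) / ((real n - D) * (real m - D))"
      using 1 pos D by (intro divide_left_mono mult_mono mult_nonneg_nonneg) auto
    also have "\<dots> = ((8 * u\<^sup>2 * D) * (real m - D)) / ((real n - D) * (real m - D))"
      by (simp add: algebra_simps)
    also have "\<dots> = 8 * u\<^sup>2 * D / (real n - D)"
      using pos by (intro nonzero_mult_divide_mult_cancel_right) simp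
    finally show ?thesis .
  qed
  have gM: "g n u \<in> M" if "0 \<le> u" "u \<le> L n" for n u using geodesic_segmentD(5)[OF g] that by (simp add: L_def)
  \<comment> \<open>The shift of the index by \<open>k u\<close> makes every geodesic in the
    sequence long enough to be evaluated at time \<open>u\<close>.\<close>
  define k where "k u = nat \<lceil>D + u\<rceil>" for u
  have k: "u \<le> L (n + k u)" if "0 \<le> u" for n u
    using L[of "n + k u"] that D unfolding k_def by (simp add: abs_le_iff) linarith
  have lim: "\<exists>z. limitin mtopology (\<lambda>n. g (n + k u) u) z sequentially" if u: "0 \<le> u" for u
  proof -
    have "MCauchy (\<lambda>n. g (n + k u) u)"
      unfolding MCauchy_def
    proof (intro conjI allI impI)
      show "range (\<lambda>n. g (n + k u) u) \<subseteq> M" using gM k u by auto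
      fix e :: real assume e: "e > 0"
      define N where "N = Suc (nat \<lceil>2 * D + u + 8 * u\<^sup>2 * D / e\<^sup>2\<rceil>)"
      have N: "real N > 2 * D + u + 8 * u\<^sup>2 * D / e\<^sup>2" unfolding N_def by linarith
      have q: "8 * u\<^sup>2 * D / e\<^sup>2 \<ge> 0" using D by simp
      have lt: "d (g n u) (g m u) < e" if nm: "N \<le> n" "n < m" for n m
      proof -
        have n: "real n > 2 * D + u + 8 * u\<^sup>2 * D / e\<^sup>2" using nm N by linarith
        have "(d (g n u) (g m u))\<^sup>2 \<le> 8 * u\<^sup>2 * D / (real n - D)"
          using bound[OF u _ _ nm(2)] n u q D by simp
        also have "\<dots> < e\<^sup>2"
        proof -
          have "8 * u\<^sup>2 * D / e\<^sup>2 < real n - D" using n u D by linarith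
          moreover have "0 < real n - D" using n u D q by linarith
          ultimately show ?thesis using e by (simp add: field_simps)
        qed
        finally show ?thesis by (rule power2_less_imp_less) (use e in simp)
      qed
      have "d (g (n + k u) u) (g (m + k u) u) < e" if nm: "N \<le> n" "N \<le> m" for n m
        using lt[of "n + k u" "m + k u"] lt[of "m + k u" "n + k u"] nm gM[OF u k[OF u]] e commute
        by (cases n m rule: linorder_cases) auto
      then show "\<exists>N. \<forall>n n'. N \<le> n \<longrightarrow> N \<le> n' \<longrightarrow> d (g (n + k u) u) (g (n' + k u) u) < e" by blast
    qed
    then show ?thesis using complete by (auto simp: mcomplete_def)
  qed
  then obtain c' where c': "\<And>u. 0 \<le> u \<Longrightarrow> limitin mtopology (\<lambda>n. g (n + k u) u) (c' u) sequentially" by metis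
  have c'M: "c' u \<in> M" if "0 \<le> u" for u using c'[OF that] limitin_mspace by blast
  have approx: "\<exists>N. \<forall>n\<ge>N. u \<le> L n \<and> d (g n u) (c' u) < e" if u: "0 \<le> u" and e: "0 < e" for u e
  proof -
    obtain N where N: "\<And>n. n \<ge> N \<Longrightarrow> d (g (n + k u) u) (c' u) < e"
      using c'[OF u] e unfolding limit_metric_sequentially by blast
    have "u \<le> L n \<and> d (g n u) (c' u) < e" if "n \<ge> N + k u" for n
      using N[of "n - k u"] k[OF u, of "n - k u"] that by simp
    then show ?thesis by blast
  qed
  have ray: "geodesic_ray M d c'"
    unfolding geodesic_ray_def
  proof (intro conjI allI impI)
    fix s t :: real assume st: "0 \<le> s" "0 \<le> t"
    have "\<bar>d (c' s) (c' t) - \<bar>s - t\<bar>\<bar> \<le> 0"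
    proof (rule field_le_epsilon)
      fix e :: real assume e: "0 < e"
      obtain N N' where N: "\<And>n. n \<ge> N \<Longrightarrow> s \<le> L n \<and> d (g n s) (c' s) < e/2"
        "\<And>n. n \<ge> N' \<Longrightarrow> t \<le> L n \<and> d (g n t) (c' t) < e/2"
        using approx[OF st(1) half_gt_zero[OF e]] approx[OF st(2) half_gt_zero[OF e]] by blast
      define n where "n = max N N'"
      have n: "s \<le> L n" "d (g n s) (c' s) < e/2" "t \<le> L n" "d (g n t) (c' t) < e/2"
        using N[of n] by (auto simp: n_def)
      have "d (g n s) (g n t) = \<bar>s - t\<bar>" using geodesic_segmentD(6)[OF g] n st by (simp add: L_def)
      moreover have "\<bar>d (c' s) (c' t) - d (g n s) (g n t)\<bar> \<le> d (g n s) (c' s) + d (g n t) (c' t)"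
        using triangle[of "c' s" "g n s" "c' t"] triangle[of "g n s" "g n t" "c' t"]
          triangle[of "g n s" "c' s" "g n t"] triangle[of "c' s" "c' t" "g n t"] gM n st c'M by (simp add: commute)
      ultimately show "\<bar>d (c' s) (c' t) - \<bar>s - t\<bar>\<bar> \<le> 0 + e" using n by linarith
    qed
    then show "d (c' s) (c' t) = \<bar>s - t\<bar>" by simp
  qed (rule c'M)
  moreover have "c' 0 = p"
  proof -
    have "d p (c' 0) \<le> 0"
    proof (rule field_le_epsilon)
      fix e :: real assume "0 < e"
      then obtain N where "d (g N 0) (c' 0) < e" using approx[of 0 e] by auto
      then show "d p (c' 0) \<le> 0 + e" using geodesic_segmentD(3)[OF g] by simp
    qed
    then have "d p (c' 0) = 0" by (simp add: order.antisym)
    then show ?thesis using p c'M[of 0] by simp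
  qed
  moreover have "d (c' t) (c t) \<le> 2 * d (c 0) p" if t: "0 \<le> t" for t
  proof (rule field_le_epsilon)
    fix e :: real assume e: "0 < e"
    obtain N where N: "\<And>n. n \<ge> N \<Longrightarrow> t \<le> L n \<and> d (g n t) (c' t) < e" using approx[OF t e] by blast
    define n where "n = max N (nat \<lceil>t\<rceil>)"
    have n: "t \<le> L n" "d (g n t) (c' t) < e" "t \<le> real n"
    proof -
      show "t \<le> L n" "d (g n t) (c' t) < e" using N[of n] by (auto simp: n_def)
      have "t \<le> real (nat \<lceil>t\<rceil>)" by linarith
      also have "\<dots> \<le> real n" unfolding n_def by simp
      finally show "t \<le> real n" .
    qed
    have "d (g n t) (c t) \<le> 2 * d p (c 0)"
      using geodesics_same_end[OF g[of n] ray_segment(2)[OF c], of t] n t ray_segment(1)[OF c, of "real n"]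
      by (simp add: L_def)
    then show "d (c' t) (c t) \<le> 2 * d (c 0) p + e"
      using triangle[of "c' t" "g n t" "c t"] n gM[OF t n(1)] c'M[OF t] geodesic_rayD(1)[OF c t] by (simp add: commute)
  qed
  ultimately show ?thesis using that by blast
qed

text \<open>Tying the tolerance to the radius makes the neighbourhoods along one ray a chain, so two
  of them have a common refinement.\<close>

lemma cone_nbhd_mono:
  assumes c: "geodesic_ray M d c" and R: "0 < R" "R \<le> R'"
  shows "cone_nbhd M d c R' (1 / R') \<subseteq> cone_nbhd M d c R (1 / R)"
proof
  have scale: "x < 1 / R" if "R' * x \<le> R * y" "y < 1 / R'" "0 \<le> x" "0 \<le> y" for x y
  proof -
    have "x \<le> R / R' * y" using that R by (simp add: field_simps)
    also have "\<dots> \<le> 1 * y" using that R by (intro mult_right_mono) auto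
    also have "y < 1 / R'" using that by simp
    also have "1 / R' \<le> 1 / R" using R by (simp add: frac_le)
    finally show ?thesis by simp
  qed
  fix a assume a: "a \<in> cone_nbhd M d c R' (1 / R')"
  show "a \<in> cone_nbhd M d c R (1 / R)"
  proof (cases a)
    case (Inl y)
    with a obtain \<gamma> where y: "y \<in> M" "R' < d (c 0) y" "geodesic_segment M d \<gamma> (c 0) y" "d (\<gamma> R') (c R') < 1 / R'"
      by (auto simp: cone_nbhd_def)
    have "d (\<gamma> R) (c R) < 1 / R"
      using scale[OF ray_segment_diverge[OF c y(3), of R R'] y(4)] y R by simp
    then show ?thesis using Inl y R unfolding cone_nbhd_def by auto
  next
    case (Inr \<xi>)
    with a obtain \<sigma> where y: "\<xi> \<in> geom_boundary M d" "\<sigma> \<in> \<xi>" "\<sigma> 0 = c 0" "d (\<sigma> R') (c R') < 1 / R'"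
      by (auto simp: cone_nbhd_def)
    have "d (\<sigma> R) (c R) < 1 / R"
      using scale[OF rays_diverge[OF boundaryD(1)[OF y(1,2)] c y(3), of R R'] y(4)] R by simp
    then show ?thesis using Inr y unfolding cone_nbhd_def by auto
  qed
qed

text \<open>
  The sets \<open>cone_nbhd M d c R (1 / R)\<close> for a fixed ray \<open>c\<close> form a basis of neighbourhoods of its end
  point. Comparing different base points at infinity needs rays, which exist in complete spaces.
\<close>

lemma cone_nbhd_base_change:
  assumes c: "geodesic_ray M d c" and c': "geodesic_ray M d c'" and R': "0 < R'"
    and \<xi>: "Inr (ray_end M d c) \<in> cone_nbhd M d c' R' \<epsilon>"
  shows "\<exists>R>0. \<forall>a\<in>cone_nbhd M d c R (1 / R). mcomplete \<or> a \<in> range Inl \<longrightarrow> a \<in> cone_nbhd M d c' R' \<epsilon>"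
proof -
  obtain \<sigma> where \<sigma>: "\<sigma> \<in> ray_end M d c" "\<sigma> 0 = c' 0" "d (\<sigma> R') (c' R') < \<epsilon>"
    using \<xi> by (auto simp: cone_nbhd_def)
  then have \<sigma>r: "geodesic_ray M d \<sigma>" "asymptotic d c \<sigma>" by (auto simp: ray_end_def)
  obtain C0 where C0: "\<And>t. 0 \<le> t \<Longrightarrow> d (c t) (\<sigma> t) \<le> C0" using \<sigma>r unfolding asymptotic_def by blast
  have C0': "0 \<le> C0" using order.trans[OF nonneg C0[of 0]] by simp
  define D where "D = d (c 0) (c' 0)"
  \<comment> \<open>At time \<open>t\<close> the geodesic from the new base point is within
    \<open>K\<close> of \<sigma>: \<open>2 * D\<close> for the change of base point, 1 for
    membership in the neighbourhood, \<open>C0\<close> for \<sigma> being asymptotic to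
    \<open>c\<close>. Going back from \<open>t\<close> to \<open>R'\<close> shrinks \<open>K\<close>
    below \<delta>, and \<open>R\<close> exceeds \<open>t\<close> by more than \<open>D\<close>, so
    that points beyond \<open>R\<close> from \<open>c 0\<close> are beyond \<open>t\<close> from
    \<open>c' 0\<close>.\<close>
  define K where "K = 2 * D + 1 + C0"
  define \<delta> where "\<delta> = \<epsilon> - d (\<sigma> R') (c' R')"
  define t where "t = R' + 1 + R' * K / \<delta>"
  define R where "R = t + D + 1"
  have D: "0 \<le> D" by (simp add: D_def)
  have K: "0 < K" using D C0' by (simp add: K_def)
  have \<delta>: "0 < \<delta>" using \<sigma> by (simp add: \<delta>_def)
  have q: "0 \<le> R' * K / \<delta>" using R' K \<delta> by simp
  then have t: "R' < t" "0 < t" "R' \<le> t" "0 \<le> t" using R' by (auto simp: t_def)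
  have R: "1 \<le> R" "t \<le> R" "t < R - D" using t D by (auto simp: R_def)
  have tK: "R' * K < t * \<delta>" using \<delta> R' by (simp add: t_def algebra_simps add_pos_pos)
  have M: "c 0 \<in> M" "c' 0 \<in> M" "c t \<in> M" "\<sigma> t \<in> M" "\<sigma> R' \<in> M" "c' R' \<in> M"
    using geodesic_rayD(1)[OF c] geodesic_rayD(1)[OF c'] geodesic_rayD(1)[OF \<sigma>r(1)] t R' by auto
  have near: "d z (c t) \<le> 1" if "R * d z (c t) \<le> t * w" "w < 1 / R" for z w
  proof -
    have "R * d z (c t) \<le> t * (1 / R)" using that t by (meson less_imp_le mult_left_mono order_trans)
    also have "\<dots> \<le> R * 1" using R t by (intro mult_mono) auto
    finally show ?thesis using R by simp
  qed
  have concl: "d z' (c' R') < \<epsilon>"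
    if "z' \<in> M" "z \<in> M" "w \<in> M" "t * d z' (\<sigma> R') \<le> R' * d z (\<sigma> t)" "d z w \<le> 2 * D" "d w (c t) \<le> 1" for z z' w
  proof -
    have "d z (\<sigma> t) \<le> K"
      using triangle[OF that(2,3) M(4)] triangle[OF that(3) M(3,4)] C0[OF t(4)] that(5,6) by (simp add: K_def)
    then have "t * d z' (\<sigma> R') \<le> R' * K" using that(4) R' by (meson less_imp_le mult_left_mono order_trans)
    then have "t * d z' (\<sigma> R') < t * \<delta>" using tK by linarith
    then have "d z' (\<sigma> R') < \<delta>" using t by simp
    then show ?thesis using triangle[OF that(1) M(5,6)] by (simp add: \<delta>_def)
  qed
  have "a \<in> cone_nbhd M d c' R' \<epsilon>"
    if a: "a \<in> cone_nbhd M d c R (1 / R)" "mcomplete \<or> a \<in> range Inl" for a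
  proof (cases a)
    case (Inl y)
    with a obtain \<gamma> where y: "y \<in> M" "R < d (c 0) y" "geodesic_segment M d \<gamma> (c 0) y" "d (\<gamma> R) (c R) < 1 / R"
      by (auto simp: cone_nbhd_def)
    obtain \<gamma>' where g': "geodesic_segment M d \<gamma>' (c' 0) y" using geodesic_exists M y by blast
    have len: "t < d (c' 0) y" "t < d (c 0) y" using triangle[OF M(1,2) y(1)] y R by (auto simp: D_def)
    have "d (\<gamma>' R') (c' R') < \<epsilon>"
    proof (rule concl)
      show "\<gamma>' R' \<in> M" "\<gamma>' t \<in> M" "\<gamma> t \<in> M"
        using geodesic_segmentD(5)[OF g'] geodesic_segmentD(5)[OF y(3)] len t R' by auto
      show "t * d (\<gamma>' R') (\<sigma> R') \<le> R' * d (\<gamma>' t) (\<sigma> t)"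
        using ray_segment_diverge[OF \<sigma>r(1), of \<gamma>' y R' t] g' \<sigma>(2) t R' len by simp
      show "d (\<gamma>' t) (\<gamma> t) \<le> 2 * D"
        using geodesics_same_end[OF g' y(3) t(4)] len by (simp add: D_def commute)
      show "d (\<gamma> t) (c t) \<le> 1"
        using near[OF ray_segment_diverge[OF c y(3) t(4) R(2)] y(4)] y(2) by simp
    qed
    then show ?thesis using Inl y g' len t unfolding cone_nbhd_def by auto
  next
    case (Inr \<eta>)
    with a have cmp: mcomplete by auto
    from Inr a obtain \<rho> where y: "\<eta> \<in> geom_boundary M d" "\<rho> \<in> \<eta>" "\<rho> 0 = c 0" "d (\<rho> R) (c R) < 1 / R"
      by (auto simp: cone_nbhd_def)
    note \<rho> = boundaryD[OF y(1,2)]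
    obtain \<rho>' where \<rho>': "geodesic_ray M d \<rho>'" "\<rho>' 0 = c' 0" "\<And>t. 0 \<le> t \<Longrightarrow> d (\<rho>' t) (\<rho> t) \<le> 2 * d (\<rho> 0) (c' 0)"
      using asymptotic_ray_exists[OF cmp \<rho>(1) M(2)] by blast
    then have "\<rho>' \<in> \<eta>" unfolding \<rho>(2) ray_end_def asymptotic_def by (auto simp: commute)
    moreover have "d (\<rho>' R') (c' R') < \<epsilon>"
    proof (rule concl)
      show "\<rho>' R' \<in> M" "\<rho>' t \<in> M" "\<rho> t \<in> M"
        using geodesic_rayD(1)[OF \<rho>'(1)] geodesic_rayD(1)[OF \<rho>(1)] t R' by auto
      show "t * d (\<rho>' R') (\<sigma> R') \<le> R' * d (\<rho>' t) (\<sigma> t)"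
        using rays_diverge[OF \<rho>'(1) \<sigma>r(1), of R' t] \<rho>'(2) \<sigma>(2) t R' by simp
      show "d (\<rho>' t) (\<rho> t) \<le> 2 * D" using \<rho>'(3)[OF t(4)] y(3) by (simp add: D_def)
      show "d (\<rho> t) (c t) \<le> 1" using near[OF rays_diverge[OF \<rho>(1) c y(3) t(4) R(2)] y(4)] .
    qed
    ultimately show ?thesis using Inr y \<rho>'(2) unfolding cone_nbhd_def by auto
  qed
  then show ?thesis using R by (intro exI[of _ R]) auto
qed

text \<open>Induction over the generation of open sets; basic sets are handled by the change of base
  point. The alternative \<open>range Inl\<close> serves the product, where only orbit points are
  tested.\<close>

lemma cone_topology_nbhd:
  assumes T: "openin (cone_topology M d) T" and c: "geodesic_ray M d c" and \<xi>: "Inr (ray_end M d c) \<in> T"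
  shows "\<exists>R>0. \<forall>a\<in>cone_nbhd M d c R (1 / R). mcomplete \<or> a \<in> range Inl \<longrightarrow> a \<in> T"
proof -
  let ?P = "\<lambda>T. \<exists>R>0. \<forall>a\<in>cone_nbhd M d c R (1 / R). mcomplete \<or> a \<in> range Inl \<longrightarrow> a \<in> T"
  have "Inr (ray_end M d c) \<in> T \<longrightarrow> ?P T"
    using T unfolding cone_topology_def openin_topology_generated_by_iff
  proof (induction rule: generate_topology_on.induct)
    case (Int a b)
    show ?case
    proof
      assume "Inr (ray_end M d c) \<in> a \<inter> b"
      then obtain R1 R2 where R: "0 < R1" "\<forall>x\<in>cone_nbhd M d c R1 (1 / R1). mcomplete \<or> x \<in> range Inl \<longrightarrow> x \<in> a"
        "0 < R2" "\<forall>x\<in>cone_nbhd M d c R2 (1 / R2). mcomplete \<or> x \<in> range Inl \<longrightarrow> x \<in> b" using Int.IH by blast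
      then show "?P (a \<inter> b)"
        using cone_nbhd_mono[OF c R(1), of "max R1 R2"] cone_nbhd_mono[OF c R(3), of "max R1 R2"]
        by (intro exI[of _ "max R1 R2"]) (simp add: subset_iff)
    qed
  next
    case (UN K)
    show ?case
    proof
      assume "Inr (ray_end M d c) \<in> \<Union>K"
      then obtain k where "k \<in> K" "Inr (ray_end M d c) \<in> k" by blast
      then have "?P k" using UN.IH by blast
      then show "?P (\<Union>K)" using \<open>k \<in> K\<close> by blast
    qed
  next
    case (Basis s)
    then show ?case using cone_nbhd_base_change[OF c] by auto
  qed simp
  then show ?thesis using \<xi> by blast
qed

section \<open>The topology induced on the boundary\<close>

lemma openin_cone_nbhd:
  "geodesic_ray M d c \<Longrightarrow> 0 < R \<Longrightarrow> 0 < \<epsilon> \<Longrightarrow> openin (cone_topology M d) (cone_nbhd M d c R \<epsilon>)"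
  unfolding cone_topology_def by (rule topology_generated_by_Basis) blast

lemma in_cone_nbhd_self:
  "geodesic_ray M d c \<Longrightarrow> 0 < R \<Longrightarrow> 0 < \<epsilon> \<Longrightarrow> Inr (ray_end M d c) \<in> cone_nbhd M d c R \<epsilon>"
  unfolding cone_nbhd_def using geodesic_rayD(1)[of M d c R]
  by (intro UnI2 imageI CollectI conjI ray_end_in_boundary bexI[of _ c] in_ray_end_self refl) simp_all

lemma topspace_boundary_topology: "topspace (boundary_topology M d) = geom_boundary M d"
proof -
  have "Inr \<xi> \<in> topspace (cone_topology M d)" if \<xi>: "\<xi> \<in> geom_boundary M d" for \<xi>
  proof -
    obtain c where "c \<in> \<xi>" using boundary_nonempty \<xi> by blast
    note c = boundaryD[OF \<xi> this]
    then show ?thesis using openin_subset[OF openin_cone_nbhd[OF c(1), of 1 1]] in_cone_nbhd_self[OF c(1), of 1 1] by auto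
  qed
  then show ?thesis unfolding boundary_topology_def topspace_pullback_topology by auto
qed

lemma boundary_topology_nbhd:
  assumes W: "openin (boundary_topology M d) W" "ray_end M d c \<in> W" and c: "geodesic_ray M d c" and mcomplete
  shows "\<exists>R>0. \<forall>\<eta>\<in>geom_boundary M d. (\<exists>\<sigma>\<in>\<eta>. \<sigma> 0 = c 0 \<and> d (\<sigma> R) (c R) < 1 / R) \<longrightarrow> \<eta> \<in> W"
proof -
  obtain U where U: "openin (cone_topology M d) U" "W = Inr -` U \<inter> geom_boundary M d"
    using W(1) by (auto simp: boundary_topology_def openin_pullback_topology)
  then obtain R where "R > 0" "\<forall>a\<in>cone_nbhd M d c R (1 / R). a \<in> U"
    using cone_topology_nbhd[OF U(1) c] W(2) assms(4) by auto
  then show ?thesis unfolding U(2) cone_nbhd_def by (intro exI[of _ R]) auto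
qed

lemma openin_boundary_topology_nbhd:
  assumes "geodesic_ray M d c" "0 < R" "0 < \<epsilon>"
  shows "openin (boundary_topology M d) {\<eta> \<in> geom_boundary M d. \<exists>\<sigma>\<in>\<eta>. \<sigma> 0 = c 0 \<and> d (\<sigma> R) (c R) < \<epsilon>}"
  unfolding boundary_topology_def openin_pullback_topology
  using openin_cone_nbhd[OF assms] by (intro exI[of _ "cone_nbhd M d c R \<epsilon>"]) (auto simp: cone_nbhd_def image_iff)

text \<open>Neither extensionality nor surjectivity is included, so that iterates such as
  \<open>h ^^ 0\<close> and the function \<open>inv_into M h\<close> qualify directly.\<close>

definition isometric_map :: "('a \<Rightarrow> 'a) \<Rightarrow> bool" where
  "isometric_map h \<longleftrightarrow> (\<forall>y\<in>M. h y \<in> M) \<and> (\<forall>y\<in>M. \<forall>z\<in>M. d (h y) (h z) = d y z)"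

lemma isometric_ray: "isometric_map h \<Longrightarrow> geodesic_ray M d c \<Longrightarrow> geodesic_ray M d (h \<circ> c)"
  by (simp add: isometric_map_def geodesic_ray_def)

lemma isometric_asymptotic:
  "isometric_map h \<Longrightarrow> geodesic_ray M d a \<Longrightarrow> geodesic_ray M d b \<Longrightarrow> asymptotic d a b \<Longrightarrow> asymptotic d (h \<circ> a) (h \<circ> b)"
  unfolding asymptotic_def isometric_map_def comp_apply using geodesic_rayD(1)[of M d a] geodesic_rayD(1)[of M d b]
  by (metis (no_types, lifting))

lemma isometric_segment:
  "isometric_map h \<Longrightarrow> geodesic_segment M d \<gamma> x y \<Longrightarrow> geodesic_segment M d (h \<circ> \<gamma>) (h x) (h y)"
  by (simp add: isometric_map_def geodesic_segment_def)

lemma boundary_act_ray_end: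
  assumes h: "isometric_map h" and c: "geodesic_ray M d c"
  shows "boundary_act M d h (ray_end M d c) = ray_end M d (h \<circ> c)"
proof -
  have "ray_end M d (h \<circ> \<sigma>) = ray_end M d (h \<circ> c)" if "\<sigma> \<in> ray_end M d c" for \<sigma>
    using that ray_end_eqI[OF isometric_ray[OF h] isometric_ray[OF h c]] asymptotic_sym
      isometric_asymptotic[OF h _ c] by (simp add: ray_end_def)
  then show ?thesis unfolding boundary_act_def using in_ray_end_self[OF c] by blast
qed

text \<open>A basic neighbourhood based at \<open>c 0\<close> is mapped into the one based at
  \<open>h (c 0)\<close> with the same radius and tolerance. The comparison of base points is hidden
  in \<open>boundary_topology_nbhd\<close>.\<close>

lemma continuous_boundary_act:
  assumes h: "isometric_map h" and complete: mcomplete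
  shows "continuous_map (boundary_topology M d) (boundary_topology M d) (boundary_act M d h)"
proof -
  let ?B = "geom_boundary M d"
  have act: "boundary_act M d h \<xi> = ray_end M d (h \<circ> c)" if "\<xi> \<in> ?B" "c \<in> \<xi>" for \<xi> c
    using boundaryD[OF that] boundary_act_ray_end[OF h] by metis
  have in_B: "boundary_act M d h \<xi> \<in> ?B" if "\<xi> \<in> ?B" for \<xi>
    using act[OF that] boundary_nonempty[OF that] boundaryD(1)[OF that] isometric_ray[OF h] ray_end_in_boundary by metis
  have "openin (boundary_topology M d) {\<xi> \<in> ?B. boundary_act M d h \<xi> \<in> W}"
    if W: "openin (boundary_topology M d) W" for W
  proof (rule openin_subopen[THEN iffD2], intro ballI)
    fix \<xi> assume \<xi>: "\<xi> \<in> {\<xi> \<in> ?B. boundary_act M d h \<xi> \<in> W}"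
    then obtain c where c: "c \<in> \<xi>" using boundary_nonempty by blast
    have c': "geodesic_ray M d c" "\<xi> = ray_end M d c" using boundaryD[OF _ c] \<xi> by auto
    obtain R where R: "0 < R" "\<And>\<eta>. \<eta> \<in> ?B \<Longrightarrow> \<exists>\<sigma>\<in>\<eta>. \<sigma> 0 = (h \<circ> c) 0 \<and> d (\<sigma> R) ((h \<circ> c) R) < 1 / R \<Longrightarrow> \<eta> \<in> W"
      using boundary_topology_nbhd[OF W _ isometric_ray[OF h c'(1)] complete] \<xi> act[OF _ c] by auto
    let ?T = "{\<eta> \<in> ?B. \<exists>\<sigma>\<in>\<eta>. \<sigma> 0 = c 0 \<and> d (\<sigma> R) (c R) < 1 / R}"
    have "openin (boundary_topology M d) ?T" using openin_boundary_topology_nbhd[OF c'(1) R(1)] R(1) by simp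
    moreover have "\<xi> \<in> ?T" using \<xi> c geodesic_rayD(1)[OF c'(1)] R(1) by auto
    moreover have "?T \<subseteq> {\<xi> \<in> ?B. boundary_act M d h \<xi> \<in> W}"
    proof (intro subsetI CollectI)
      fix \<eta> assume "\<eta> \<in> ?T"
      then obtain \<sigma> where s: "\<eta> \<in> ?B" "\<sigma> \<in> \<eta>" "\<sigma> 0 = c 0" "d (\<sigma> R) (c R) < 1 / R" by blast
      note \<sigma> = boundaryD[OF s(1,2)]
      have "d ((h \<circ> \<sigma>) R) ((h \<circ> c) R) < 1 / R"
        using s(4) h geodesic_rayD(1)[OF \<sigma>(1)] geodesic_rayD(1)[OF c'(1)] R(1) by (simp add: isometric_map_def)
      moreover have "h \<circ> \<sigma> \<in> boundary_act M d h \<eta>"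
        using act[OF s(1,2)] in_ray_end_self isometric_ray[OF h \<sigma>(1)] by simp
      ultimately show "\<eta> \<in> ?B \<and> boundary_act M d h \<eta> \<in> W"
        using R(2)[OF in_B[OF s(1)]] s(1,3) by (metis comp_apply)
    qed
    ultimately show "\<exists>T. openin (boundary_topology M d) T \<and> \<xi> \<in> T \<and> T \<subseteq> {\<xi> \<in> ?B. boundary_act M d h \<xi> \<in> W}"
      by blast
  qed
  then show ?thesis using in_B by (auto simp: continuous_map_def topspace_boundary_topology)
qed

text \<open>A geodesic from a fixed point to a point far to the right of both lines has to pass near
  \<sigma> t and near \<tau> t. If such points existed arbitrarily far out, the lines would stay at
  bounded distance.\<close>

lemma contracting_lines_separate:
  assumes \<sigma>: "contracting_line M d \<sigma> S" and \<tau>: "contracting_line M d \<tau> T" and na: "\<not> asymptotic d \<sigma> \<tau>"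
  shows "\<exists>K. \<forall>p\<in>M. \<not> (right_of d \<sigma> p K \<and> right_of d \<tau> p K)"
proof (rule ccontr)
  assume "\<not> ?thesis"
  then have ex: "\<And>K. \<exists>p\<in>M. right_of d \<sigma> p K \<and> right_of d \<tau> p K" by blast
  have lines: "geodesic_line M d \<sigma>" "geodesic_line M d \<tau>" and ST: "S > 0" "T > 0"
    using \<sigma> \<tau> by (auto simp: contracting_line_def)
  define x where "x = \<sigma> 0"
  have x: "x \<in> M" using geodesic_lineD[OF lines(1)] by (simp add: x_def)
  obtain a b where ab: "left_of d \<sigma> x a" "left_of d \<tau> x b"
    using projection_exists[OF lines(1) x] projection_exists[OF lines(2) x] by blast
  define t0 where "t0 = max (max (a + S) (b + T)) 0"
  define D where "D = d x (\<tau> 0)"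
  have bound: "d (\<sigma> t) (\<tau> t) \<le> 2 * S + 2 * T + D" if t: "t0 \<le> t" for t
  proof -
    obtain p where p: "p \<in> M" "right_of d \<sigma> p (t + max S T)" "right_of d \<tau> p (t + max S T)" using ex by blast
    obtain \<gamma> where g: "geodesic_segment M d \<gamma> x p" using geodesic_exists x p by blast
    have "left_of d \<sigma> x (t - S)" "left_of d \<tau> x (t - T)"
      using left_of_mono[OF lines(1) x ab(1)] left_of_mono[OF lines(2) x ab(2)] t by (auto simp: t0_def)
    moreover have "right_of d \<sigma> p (t + S)" "right_of d \<tau> p (t + T)"
      using right_of_mono[OF lines(1) p(1,2)] right_of_mono[OF lines(2) p(1,3)] by auto
    ultimately obtain u v where u: "u \<in> {0..d x p}" "d (\<gamma> u) (\<sigma> t) \<le> S" and v: "v \<in> {0..d x p}" "d (\<gamma> v) (\<tau> t) \<le> T"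
      using \<sigma> \<tau> g unfolding contracting_line_def by meson
    have M: "\<gamma> u \<in> M" "\<gamma> v \<in> M" "\<sigma> t \<in> M" "\<tau> t \<in> M" "\<tau> 0 \<in> M"
      using geodesic_segmentD(5)[OF g] u v geodesic_lineD[OF lines(1)] geodesic_lineD[OF lines(2)] by auto
    have "d x (\<gamma> u) = u" "d x (\<gamma> v) = v"
      using geodesic_subsegment(1)[OF g] u v by auto
    moreover have "d x (\<sigma> t) = t" "d (\<tau> 0) (\<tau> t) = t"
      using geodesic_lineD(2)[OF lines(1), of 0 t] geodesic_lineD(2)[OF lines(2), of 0 t] t by (auto simp: x_def t0_def)
    \<comment> \<open>Both passing times are read off from the distance to \<open>x\<close>, and
      both are close to \<open>t\<close>. So the two points on the geodesic are close to each
      other.\<close>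
    ultimately have "\<bar>u - t\<bar> \<le> S" "\<bar>v - t\<bar> \<le> T + D"
      using mdist_reverse_triangle[of "\<gamma> u" x "\<sigma> t"] mdist_reverse_triangle[of "\<gamma> v" x "\<tau> t"]
        mdist_reverse_triangle[of x "\<tau> t" "\<tau> 0"] x M u v by (auto simp: commute D_def)
    then have "\<bar>u - v\<bar> \<le> S + T + D" by linarith
    moreover have "d (\<gamma> u) (\<gamma> v) = \<bar>u - v\<bar>" using geodesic_segmentD(6)[OF g] u v by auto
    moreover have "d (\<sigma> t) (\<tau> t) \<le> d (\<sigma> t) (\<gamma> u) + d (\<gamma> u) (\<gamma> v) + d (\<gamma> v) (\<tau> t)"
      using triangle[OF M(3,1,4)] triangle[OF M(1,2,4)] by linarith
    ultimately show ?thesis using u v by (simp add: commute)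
  qed
  have t0: "0 \<le> t0" by (simp add: t0_def)
  have "d (\<sigma> t) (\<tau> t) \<le> 2 * S + 2 * T + D + 2 * t0" if t: "0 \<le> t" for t
  proof (cases "t0 \<le> t")
    case True
    then show ?thesis using bound[OF True] t0 by linarith
  next
    case False
    have M: "\<sigma> t \<in> M" "\<tau> t \<in> M" "\<sigma> t0 \<in> M" "\<tau> t0 \<in> M"
      using geodesic_lineD[OF lines(1)] geodesic_lineD[OF lines(2)] by auto
    have "d (\<sigma> t) (\<tau> t) \<le> d (\<sigma> t) (\<sigma> t0) + d (\<sigma> t0) (\<tau> t0) + d (\<tau> t0) (\<tau> t)"
      using triangle[OF M(1,3,2)] triangle[OF M(3,4,2)] by linarith
    then show ?thesis using bound[of t0] geodesic_lineD(2)[OF lines(1), of t t0] geodesic_lineD(2)[OF lines(2), of t0 t] t False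
      by simp
  qed
  then show False using na unfolding asymptotic_def by blast
qed

text \<open>The geodesics from \<omega> 0 to far points of \<mu> converge to \<omega>, so \<omega>
  passes near \<open>s\<close> if they do. In the bound, \<open>C\<close> is the distance of the
  geodesic from \<open>s\<close>, another \<open>C\<close> corrects the time, and 1 is the deviation
  of the geodesic from \<omega>.\<close>

lemma ray_near_point:
  assumes \<omega>: "geodesic_ray M d \<omega>" and \<mu>: "geodesic_ray M d \<mu>" and as: "asymptotic d \<omega> \<mu>" and s: "s \<in> M" and C: "0 \<le> C"
    and near: "\<And>N. \<exists>t\<ge>N. \<exists>\<gamma>. geodesic_segment M d \<gamma> (\<omega> 0) (\<mu> t) \<and> (\<exists>u\<in>{0..d (\<omega> 0) (\<mu> t)}. d (\<gamma> u) s \<le> C)"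
  shows "d (\<omega> (d (\<omega> 0) s)) s \<le> 2 * C + 1"
proof -
  obtain C1 where C1: "\<And>t. 0 \<le> t \<Longrightarrow> d (\<omega> t) (\<mu> t) \<le> C1" using as unfolding asymptotic_def by blast
  define D where "D = d (\<omega> 0) (\<mu> 0)"
  define U where "U = d (\<omega> 0) s + C"
  have D: "0 \<le> D" "D \<le> C1" using C1[of 0] by (auto simp: D_def)
  have U: "0 \<le> U" using C by (simp add: U_def)
  \<comment> \<open>\<open>t\<close> is so large that a deviation of at most \<open>C1 + D\<close>
    at the far end shrinks to at most 1 at a time not exceeding \<open>U\<close>.\<close>
  obtain t \<gamma> u where t: "D + 1 + U * (C1 + D) \<le> t" and g: "geodesic_segment M d \<gamma> (\<omega> 0) (\<mu> t)"
    and u: "u \<in> {0..d (\<omega> 0) (\<mu> t)}" "d (\<gamma> u) s \<le> C" using near by blast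
  have "0 \<le> U * (C1 + D)" using U D by simp
  then have t0: "0 \<le> t" using t D by linarith
  define v where "v = d (\<omega> 0) (\<mu> t)"
  have M: "\<omega> 0 \<in> M" "\<mu> 0 \<in> M" "\<mu> t \<in> M" "\<gamma> u \<in> M" "\<omega> t \<in> M" "\<omega> v \<in> M" "\<omega> u \<in> M" "\<omega> (d (\<omega> 0) s) \<in> M"
    using geodesic_rayD(1)[OF \<omega>] geodesic_rayD(1)[OF \<mu>] t0 geodesic_segmentD(5)[OF g] u by (auto simp: v_def)
  have tv: "\<bar>t - v\<bar> \<le> D"
    using mdist_reverse_triangle[OF M(2,3,1)] ray_segment(1)[OF \<mu> t0] by (simp add: v_def D_def commute)
  have du: "d (\<omega> 0) (\<gamma> u) = u" using geodesic_subsegment(1)[OF g] u by auto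
  have us: "\<bar>u - d (\<omega> 0) s\<bar> \<le> C"
    using mdist_reverse_triangle[OF M(4,1) s] du u(2) by (simp add: commute)
  have "d (\<mu> t) (\<omega> v) \<le> d (\<mu> t) (\<omega> t) + d (\<omega> t) (\<omega> v)" using triangle[OF M(3,5,6)] .
  also have "\<dots> \<le> C1 + D" using C1[OF t0] tv geodesic_rayD(2)[OF \<omega> t0, of v] by (simp add: commute v_def)
  finally have end_close: "d (\<gamma> v) (\<omega> v) \<le> C1 + D" using geodesic_segmentD(4)[OF g] by (simp add: v_def)
  have "v * d (\<gamma> u) (\<omega> u) \<le> u * d (\<gamma> v) (\<omega> v)"
    using ray_segment_diverge[OF \<omega> g, of u v] u by (simp add: v_def)
  also have "\<dots> \<le> U * (C1 + D)" using end_close us u by (intro mult_mono) (auto simp: U_def)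
  also have "\<dots> \<le> v * 1" using t tv by linarith
  finally have "v * d (\<gamma> u) (\<omega> u) \<le> v * 1" .
  moreover have "0 < v" using t tv \<open>0 \<le> U * (C1 + D)\<close> by linarith
  ultimately have "d (\<gamma> u) (\<omega> u) \<le> 1" by simp
  moreover have "d (\<omega> (d (\<omega> 0) s)) (\<omega> u) \<le> C"
    using geodesic_rayD(2)[OF \<omega>, of "d (\<omega> 0) s" u] us u by (simp add: abs_minus_commute)
  moreover have "d (\<omega> (d (\<omega> 0) s)) s \<le> d (\<omega> (d (\<omega> 0) s)) (\<omega> u) + d (\<omega> u) (\<gamma> u) + d (\<gamma> u) s"
    using triangle[OF M(8,7) s] triangle[OF M(7,4) s] by linarith
  ultimately show ?thesis using u(2) by (simp add: commute)
qed

end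

section \<open>Products\<close>

lemma prod_distance_L2: "prod_distance I d x y = L2_set (\<lambda>i. d i (x i) (y i)) I"
  by (simp add: prod_distance_def L2_set_def)

locale cat0_product =
  fixes I :: "'i set" and X :: "'i \<Rightarrow> 'a set" and d :: "'i \<Rightarrow> 'a \<Rightarrow> 'a \<Rightarrow> real"
  assumes finite_I: "finite I" and cat0_factor: "\<And>i. i \<in> I \<Longrightarrow> cat0 (X i) (d i)"
begin

abbreviation PX :: "('i \<Rightarrow> 'a) set" where "PX \<equiv> prod_space I X"
abbreviation PD :: "('i \<Rightarrow> 'a) \<Rightarrow> ('i \<Rightarrow> 'a) \<Rightarrow> real" where "PD \<equiv> prod_distance I d"

section \<open>The product as a space with the squared-distance inequality\<close>

lemma metric_factor: "i \<in> I \<Longrightarrow> Metric_space (X i) (d i)"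
  using cat0_factor cat0_def by blast

lemma PX_component: "x \<in> PX \<Longrightarrow> i \<in> I \<Longrightarrow> x i \<in> X i"
  by (auto simp: prod_space_def)

lemma PX_I: "(\<And>i. i \<in> I \<Longrightarrow> f i \<in> X i) \<Longrightarrow> (\<lambda>i\<in>I. f i) \<in> PX"
  by (auto simp: prod_space_def)

lemma prod_Metric_space: "Metric_space PX PD"
proof
  fix x y z
  show "0 \<le> PD x y" by (simp add: prod_distance_L2)
  show "PD x y = PD y x"
    unfolding prod_distance_L2 by (intro L2_set_cong refl) (simp add: Metric_space.commute[OF metric_factor])
  assume xy: "x \<in> PX" "y \<in> PX"
  have "PD x y = 0 \<longleftrightarrow> (\<forall>i\<in>I. x i = y i)"
    unfolding prod_distance_L2 using finite_I PX_component[OF xy(1)] PX_component[OF xy(2)]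
    by (simp add: L2_set_eq_0_iff Metric_space.zero[OF metric_factor])
  also have "\<dots> \<longleftrightarrow> x = y"
    using xy by (metis PiE_ext prod_space_def)
  finally show "PD x y = 0 \<longleftrightarrow> x = y" .
  assume z: "z \<in> PX"
  have "PD x z \<le> L2_set (\<lambda>i. d i (x i) (y i) + d i (y i) (z i)) I"
    unfolding prod_distance_L2
    using PX_component[OF xy(1)] PX_component[OF xy(2)] PX_component[OF z]
    by (intro L2_set_mono) (auto simp: Metric_space.triangle[OF metric_factor] Metric_space.nonneg[OF metric_factor])
  also have "\<dots> \<le> PD x y + PD y z" unfolding prod_distance_L2 by (rule L2_set_triangle_ineq)
  finally show "PD x z \<le> PD x y + PD y z" .
qed

lemma component_le: "i \<in> I \<Longrightarrow> d i (x i) (y i) \<le> PD x y"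
  unfolding prod_distance_L2 using finite_I by (rule member_le_L2_set)

lemma PD_square: "(PD x y)\<^sup>2 = (\<Sum>i\<in>I. (d i (x i) (y i))\<^sup>2)"
  by (simp add: prod_distance_def sum_nonneg)

text \<open>The point at fraction \<open>u\<close> of every factor geodesic. Using fractions instead
  of arc length avoids dividing by the length of a constant component.\<close>

definition prod_point :: "('i \<Rightarrow> real \<Rightarrow> 'a) \<Rightarrow> ('i \<Rightarrow> 'a) \<Rightarrow> ('i \<Rightarrow> 'a) \<Rightarrow> real \<Rightarrow> 'i \<Rightarrow> 'a" where
  "prod_point \<kappa> x y u = (\<lambda>i\<in>I. \<kappa> i (u * d i (x i) (y i)))"

context
  fixes \<kappa> x y
  assumes \<kappa>: "\<And>i. i \<in> I \<Longrightarrow> geodesic_segment (X i) (d i) (\<kappa> i) (x i) (y i)" and x: "x \<in> PX" and y: "y \<in> PX"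
begin

lemma \<kappa>_range: "0 \<le> u \<Longrightarrow> u \<le> 1 \<Longrightarrow> i \<in> I \<Longrightarrow> 0 \<le> u * d i (x i) (y i) \<and> u * d i (x i) (y i) \<le> d i (x i) (y i)"
  using Metric_space.nonneg[OF metric_factor] by (simp add: mult_left_le_one_le)

lemma prod_point_in: "0 \<le> u \<Longrightarrow> u \<le> 1 \<Longrightarrow> prod_point \<kappa> x y u \<in> PX"
  unfolding prod_point_def using \<kappa>_range geodesic_segmentD(5)[OF \<kappa>] by (intro PX_I) auto

lemma prod_point_dist:
  assumes "0 \<le> u" "u \<le> 1" "0 \<le> v" "v \<le> 1"
  shows "PD (prod_point \<kappa> x y u) (prod_point \<kappa> x y v) = \<bar>u - v\<bar> * PD x y"
proof -
  have "d i (prod_point \<kappa> x y u i) (prod_point \<kappa> x y v i) = \<bar>u - v\<bar> * d i (x i) (y i)" if i: "i \<in> I" for i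
  proof -
    have "d i (prod_point \<kappa> x y u i) (prod_point \<kappa> x y v i) = \<bar>u * d i (x i) (y i) - v * d i (x i) (y i)\<bar>"
      using geodesic_segmentD(6)[OF \<kappa>[OF i]] \<kappa>_range[OF _ _ i] assms i by (simp add: prod_point_def)
    also have "\<dots> = \<bar>u - v\<bar> * d i (x i) (y i)"
      using Metric_space.nonneg[OF metric_factor[OF i]] by (simp add: abs_mult flip: left_diff_distrib)
    finally show ?thesis .
  qed
  then have "PD (prod_point \<kappa> x y u) (prod_point \<kappa> x y v) = L2_set (\<lambda>i. \<bar>u - v\<bar> * d i (x i) (y i)) I"
    unfolding prod_distance_L2 by (intro L2_set_cong) auto
  then show ?thesis by (simp add: prod_distance_L2 L2_set_right_distrib)
qed

lemma prod_point_0: "prod_point \<kappa> x y 0 = x"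
proof -
  have "prod_point \<kappa> x y 0 = restrict x I"
    unfolding prod_point_def using geodesic_segmentD(3)[OF \<kappa>] by (intro restrict_ext) simp
  then show ?thesis using x by (simp add: prod_space_def PiE_restrict)
qed

lemma prod_point_1: "prod_point \<kappa> x y 1 = y"
proof -
  have "prod_point \<kappa> x y 1 = restrict y I"
    unfolding prod_point_def using geodesic_segmentD(4)[OF \<kappa>] by (intro restrict_ext) simp
  then show ?thesis using y by (simp add: prod_space_def PiE_restrict)
qed

lemma prod_point_segment: "geodesic_segment PX PD (\<lambda>t. prod_point \<kappa> x y (t / PD x y)) x y"
proof -
  interpret Metric_space PX PD by (rule prod_Metric_space)
  show ?thesis
  proof (cases "PD x y = 0")
    case True
    then show ?thesis using x y prod_point_0 by (auto simp: geodesic_segment_def)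
  next
    case False
    then have L: "PD x y > 0" by (simp add: less_le)
    have "PD (prod_point \<kappa> x y (s / PD x y)) (prod_point \<kappa> x y (t / PD x y)) = \<bar>s - t\<bar>"
      if "s \<in> {0..PD x y}" "t \<in> {0..PD x y}" for s t
      using prod_point_dist[of "s / PD x y" "t / PD x y"] that L
      by (simp add: abs_mult flip: diff_divide_distrib)
    then show ?thesis
      using L x y prod_point_0 prod_point_1 prod_point_in
      by (auto simp: geodesic_segment_def)
  qed
qed

lemma prod_point_stewart:
  assumes z: "z \<in> PX" and u: "0 \<le> u" "u \<le> 1"
  shows "(PD z (prod_point \<kappa> x y u))\<^sup>2 \<le> (1 - u) * (PD z x)\<^sup>2 + u * (PD z y)\<^sup>2 - u * (1 - u) * (PD x y)\<^sup>2"
proof -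
  have "(PD z (prod_point \<kappa> x y u))\<^sup>2 \<le>
    (\<Sum>i\<in>I. (1 - u) * (d i (z i) (x i))\<^sup>2 + u * (d i (z i) (y i))\<^sup>2 - u * (1 - u) * (d i (x i) (y i))\<^sup>2)"
    unfolding PD_square
    using cat0.stewart[OF cat0_factor \<kappa> PX_component[OF z] u] by (intro sum_mono) (simp add: prod_point_def)
  also have "\<dots> = (1 - u) * (PD z x)\<^sup>2 + u * (PD z y)\<^sup>2 - u * (1 - u) * (PD x y)\<^sup>2"
    unfolding PD_square by (simp add: sum.distrib sum_subtractf sum_distrib_left)
  finally show ?thesis .
qed

text \<open>Uniqueness has to precede \<open>prod_cat0\<close>, whose inequality concerns every
  geodesic. Applied to the point of \<gamma> itself, \<open>prod_point_stewart\<close> has right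
  side 0.\<close>

lemma geodesic_eq_prod_point:
  assumes \<gamma>: "geodesic_segment PX PD \<gamma> x y" and u: "0 \<le> u" "u \<le> 1"
  shows "\<gamma> (u * PD x y) = prod_point \<kappa> x y u"
proof -
  interpret Metric_space PX PD by (rule prod_Metric_space)
  note g = geodesic_segmentD[OF \<gamma>]
  define L where "L = PD x y"
  have uL: "0 \<le> u * L" "u * L \<le> L" using u by (auto simp: L_def mult_left_le_one_le)
  have z: "\<gamma> (u * L) \<in> PX" using g(5) uL by (simp add: L_def)
  have "PD (\<gamma> (u * L)) x = u * L" "PD (\<gamma> (u * L)) y = (1 - u) * L"
    using g(3,4) g(6)[of "u * L" 0] g(6)[of "u * L" "PD x y"] uL by (auto simp: L_def algebra_simps)
  then have "(PD (\<gamma> (u * L)) (prod_point \<kappa> x y u))\<^sup>2 \<le> (1 - u) * (u * L)\<^sup>2 + u * ((1 - u) * L)\<^sup>2 - u * (1 - u) * L\<^sup>2"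
    using prod_point_stewart[OF z u] by (simp add: L_def)
  also have "\<dots> = 0" by (simp add: power2_eq_square algebra_simps)
  finally have "PD (\<gamma> (u * L)) (prod_point \<kappa> x y u) = 0" by simp
  then show ?thesis using z prod_point_in[OF u] by (simp add: L_def)
qed

end

lemma factor_geodesics:
  assumes "x \<in> PX" "y \<in> PX"
  obtains \<kappa> where "\<And>i. i \<in> I \<Longrightarrow> geodesic_segment (X i) (d i) (\<kappa> i) (x i) (y i)"
proof -
  have "\<forall>i\<in>I. \<exists>\<kappa>. geodesic_segment (X i) (d i) \<kappa> (x i) (y i)"
    using cat0.geodesic_exists[OF cat0_factor] PX_component assms by blast
  then show ?thesis using that by metis
qed

lemma prod_cat0: "cat0 PX PD"
proof -
  interpret Metric_space PX PD by (rule prod_Metric_space)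
  show ?thesis
  proof
    fix x y assume "x \<in> PX" "y \<in> PX"
    then show "\<exists>\<gamma>. geodesic_segment PX PD \<gamma> x y"
      using prod_point_segment factor_geodesics by metis
  next
    fix x y z \<gamma> u assume \<gamma>: "geodesic_segment PX PD \<gamma> x y" and z: "z \<in> PX" and u: "0 \<le> u" "u \<le> (1::real)"
    note xy = geodesic_segmentD(1,2)[OF \<gamma>]
    obtain \<kappa> where \<kappa>: "\<And>i. i \<in> I \<Longrightarrow> geodesic_segment (X i) (d i) (\<kappa> i) (x i) (y i)"
      using factor_geodesics[OF xy] by blast
    show "(PD z (\<gamma> (u * PD x y)))\<^sup>2 \<le> (1 - u) * (PD z x)\<^sup>2 + u * (PD z y)\<^sup>2 - u * (1 - u) * (PD x y)\<^sup>2"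
      using prod_point_stewart[OF \<kappa> xy z u] geodesic_eq_prod_point[OF \<kappa> xy \<gamma> u] by simp
  qed
qed

section \<open>Rays in the product, slopes and cone neighbourhoods\<close>

lemma ray_decompositionD:
  assumes "ray_decomposition I X d \<sigma> \<theta> \<rho>"
  shows "\<And>i. i \<in> I \<Longrightarrow> geodesic_ray (X i) (d i) (\<rho> i)" "\<And>i. i \<in> I \<Longrightarrow> 0 \<le> \<theta> i" "(\<Sum>i\<in>I. (\<theta> i)\<^sup>2) = 1"
    "\<And>t i. 0 \<le> t \<Longrightarrow> i \<in> I \<Longrightarrow> \<sigma> t i = \<rho> i (\<theta> i * t)" "\<And>t. 0 \<le> t \<Longrightarrow> \<sigma> t = (\<lambda>i\<in>I. \<rho> i (\<theta> i * t))"
  using assms by (auto simp: ray_decomposition_def)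

lemma ray_decomposition_ray:
  assumes dec: "ray_decomposition I X d \<sigma> \<theta> \<rho>"
  shows "geodesic_ray PX PD \<sigma>"
  unfolding geodesic_ray_def
proof (intro conjI allI impI)
  note D = ray_decompositionD[OF dec]
  fix s :: real assume s: "0 \<le> s"
  show "\<sigma> s \<in> PX" unfolding D(5)[OF s] using geodesic_rayD(1)[OF D(1)] D(2) s by (intro PX_I) simp
  fix t :: real assume t: "0 \<le> t"
  have "d i (\<sigma> s i) (\<sigma> t i) = \<bar>s - t\<bar> * \<theta> i" if i: "i \<in> I" for i
  proof -
    have "d i (\<sigma> s i) (\<sigma> t i) = \<bar>\<theta> i * s - \<theta> i * t\<bar>"
      using geodesic_rayD(2)[OF D(1)[OF i]] D(2)[OF i] D(4)[OF _ i] s t by simp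
    also have "\<dots> = \<bar>s - t\<bar> * \<theta> i" using D(2)[OF i] by (simp add: abs_mult flip: right_diff_distrib)
    finally show ?thesis .
  qed
  then have "PD (\<sigma> s) (\<sigma> t) = L2_set (\<lambda>i. \<bar>s - t\<bar> * \<theta> i) I"
    unfolding prod_distance_L2 by (intro L2_set_cong) auto
  also have "\<dots> = \<bar>s - t\<bar> * L2_set \<theta> I" by (simp add: L2_set_right_distrib)
  also have "L2_set \<theta> I = 1" using D(3) by (simp add: L2_set_def)
  finally show "PD (\<sigma> s) (\<sigma> t) = \<bar>s - t\<bar>" by simp
qed

text \<open>In each factor the distances from the starting points differ by at most a constant, so
  two different speeds would drift apart linearly. If the common speed is positive, rescaling time
  turns the bound into asymptoticity of the components.\<close>

lemma ray_decomposition_unique: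
  assumes dec: "ray_decomposition I X d \<sigma> \<theta> \<rho>" "ray_decomposition I X d \<sigma>' \<theta>' \<rho>'"
    and as: "asymptotic PD \<sigma> \<sigma>'" and i: "i \<in> I"
  shows "\<theta> i = \<theta>' i" "0 < \<theta> i \<Longrightarrow> asymptotic (d i) (\<rho> i) (\<rho>' i)"
proof -
  note D = ray_decompositionD[OF dec(1)] and D' = ray_decompositionD[OF dec(2)]
  interpret cat0 "X i" "d i" using cat0_factor[OF i] .
  obtain C where C: "\<And>t. 0 \<le> t \<Longrightarrow> PD (\<sigma> t) (\<sigma>' t) \<le> C" using as unfolding asymptotic_def by blast
  have Ci: "d i (\<rho> i (\<theta> i * t)) (\<rho>' i (\<theta>' i * t)) \<le> C" if "0 \<le> t" for t
    using order.trans[OF component_le[OF i] C[OF that]] D(4)[OF that i] D'(4)[OF that i] by simp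
  define K where "K = C + d i (\<rho> i 0) (\<rho>' i 0)"
  have bound: "\<bar>\<theta> i - \<theta>' i\<bar> * t \<le> K" if t: "0 \<le> t" for t
  proof -
    have p: "0 \<le> \<theta> i * t" "0 \<le> \<theta>' i * t" using D(2)[OF i] D'(2)[OF i] t by auto
    have M: "\<rho> i 0 \<in> X i" "\<rho>' i 0 \<in> X i" "\<rho> i (\<theta> i * t) \<in> X i" "\<rho>' i (\<theta>' i * t) \<in> X i"
      using geodesic_rayD(1)[OF D(1)[OF i]] geodesic_rayD(1)[OF D'(1)[OF i]] p by auto
    have "\<bar>\<theta> i * t - \<theta>' i * t\<bar> \<le> K"
      using Ci[OF t] triangle[OF M(1,2,4)] triangle[OF M(1,4,3)] triangle[OF M(2,1,3)] triangle[OF M(2,3,4)]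
        ray_segment(1)[OF D(1)[OF i] p(1)] ray_segment(1)[OF D'(1)[OF i] p(2)]
      by (simp add: K_def abs_le_iff commute)
    then show ?thesis using t by (simp add: abs_mult flip: left_diff_distrib)
  qed
  show eq: "\<theta> i = \<theta>' i"
  proof (rule ccontr)
    assume ne: "\<theta> i \<noteq> \<theta>' i"
    have "0 \<le> K" using bound[of 0] by simp
    then show False using bound[of "(K + 1) / \<bar>\<theta> i - \<theta>' i\<bar>"] ne by simp
  qed
  assume pos: "0 < \<theta> i"
  have "d i (\<rho> i t) (\<rho>' i t) \<le> C" if "0 \<le> t" for t
    using Ci[of "t / \<theta> i"] that pos eq by simp
  then show "asymptotic (d i) (\<rho> i) (\<rho>' i)" unfolding asymptotic_def by blast
qed

lemma regular_boundaryE: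
  assumes "\<xi> \<in> regular_boundary I X d"
  obtains \<sigma> \<theta> \<rho> where "\<sigma> \<in> \<xi>" "ray_decomposition I X d \<sigma> \<theta> \<rho>" "\<And>i. i \<in> I \<Longrightarrow> 0 < \<theta> i"
  using assms that by (auto simp: regular_boundary_def has_slope_def)

text \<open>The description ranges over all representatives and all decompositions. By uniqueness
  they all share the given positive slope, and hence the classes of the components.\<close>

lemma furstenberg_proj_eq:
  assumes \<xi>: "\<xi> \<in> geom_boundary PX PD" and \<sigma>: "\<sigma> \<in> \<xi>"
    and dec: "ray_decomposition I X d \<sigma> \<theta> \<rho>" and pos: "\<And>i. i \<in> I \<Longrightarrow> 0 < \<theta> i"
  shows "furstenberg_proj I X d \<xi> = (\<lambda>i\<in>I. ray_end (X i) (d i) (\<rho> i))"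
  unfolding furstenberg_proj_def
proof (rule the_equality)
  interpret P: cat0 PX PD by (rule prod_cat0)
  show "\<exists>\<sigma>\<in>\<xi>. \<exists>\<theta> \<rho>'. ray_decomposition I X d \<sigma> \<theta> \<rho>' \<and>
      (\<lambda>i\<in>I. ray_end (X i) (d i) (\<rho> i)) = (\<lambda>i\<in>I. ray_end (X i) (d i) (\<rho>' i))"
    using \<sigma> dec by blast
  fix \<eta> assume "\<exists>\<sigma>\<in>\<xi>. \<exists>\<theta> \<rho>. ray_decomposition I X d \<sigma> \<theta> \<rho> \<and> \<eta> = (\<lambda>i\<in>I. ray_end (X i) (d i) (\<rho> i))"
  then obtain \<sigma>' \<theta>' \<rho>' where o: "\<sigma>' \<in> \<xi>" "ray_decomposition I X d \<sigma>' \<theta>' \<rho>'" "\<eta> = (\<lambda>i\<in>I. ray_end (X i) (d i) (\<rho>' i))"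
    by blast
  have "asymptotic PD \<sigma> \<sigma>'" using P.boundaryD[OF \<xi> \<sigma>] o(1) by (simp add: ray_end_def)
  note u = ray_decomposition_unique[OF dec o(2) this]
  have "ray_end (X i) (d i) (\<rho> i) = ray_end (X i) (d i) (\<rho>' i)" if i: "i \<in> I" for i
    using cat0.ray_end_eqI[OF cat0_factor[OF i]] ray_decompositionD(1)[OF dec i] ray_decompositionD(1)[OF o(2) i]
      u(2)[OF i pos[OF i]] by blast
  then show "\<eta> = (\<lambda>i\<in>I. ray_end (X i) (d i) (\<rho> i))" unfolding o(3) by (intro restrict_ext) simp
qed

text \<open>A component of a product geodesic runs along the factor geodesic at a speed determined
  by the target \<open>z\<close>, not by \<theta>. Its time is therefore only asserted to
  exist.\<close>

lemma cone_nbhd_component: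
  assumes dec: "ray_decomposition I X d \<sigma> \<theta> \<rho>" and R: "0 < R" and z: "Inl z \<in> cone_nbhd PX PD \<sigma> R \<epsilon>" and i: "i \<in> I"
    and \<kappa>: "geodesic_segment (X i) (d i) \<kappa> (\<rho> i 0) (z i)"
  shows "\<exists>s\<in>{0..d i (\<rho> i 0) (z i)}. d i (\<kappa> s) (\<rho> i (\<theta> i * R)) < \<epsilon>"
proof -
  obtain \<gamma> where z: "z \<in> PX" "R < PD (\<sigma> 0) z" "geodesic_segment PX PD \<gamma> (\<sigma> 0) z" "PD (\<gamma> R) (\<sigma> R) < \<epsilon>"
    using z by (auto simp: cone_nbhd_def)
  have \<sigma>: "\<sigma> 0 \<in> PX" using geodesic_rayD(1)[OF ray_decomposition_ray[OF dec], of 0] by simp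
  have \<sigma>i: "\<sigma> 0 i = \<rho> i 0" "\<sigma> R i = \<rho> i (\<theta> i * R)"
    using ray_decompositionD(4)[OF dec _ i, of 0] ray_decompositionD(4)[OF dec _ i, of R] R by simp_all
  obtain \<kappa>' where \<kappa>': "\<And>i. i \<in> I \<Longrightarrow> geodesic_segment (X i) (d i) (\<kappa>' i) (\<sigma> 0 i) (z i)"
    using factor_geodesics[OF \<sigma> z(1)] by blast
  define u where "u = R / PD (\<sigma> 0) z"
  have u: "0 \<le> u" "u \<le> 1" "u * PD (\<sigma> 0) z = R" using z R by (auto simp: u_def)
  define s where "s = u * d i (\<rho> i 0) (z i)"
  have s: "s \<in> {0..d i (\<rho> i 0) (z i)}"
    using u Metric_space.nonneg[OF metric_factor[OF i]] by (auto simp: s_def mult_left_le_one_le)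
  have "\<gamma> R i = \<kappa>' i s"
    using geodesic_eq_prod_point[OF \<kappa>' \<sigma> z(1,3) u(1,2)] u(3) i by (simp add: prod_point_def s_def \<sigma>i)
  also have "\<dots> = \<kappa> s"
    using cat0.geodesic_unique[OF cat0_factor[OF i] \<kappa>'[OF i, unfolded \<sigma>i] \<kappa>] s by auto
  finally have "d i (\<kappa> s) (\<rho> i (\<theta> i * R)) < \<epsilon>"
    using z(4) component_le[OF i, of "\<gamma> R" "\<sigma> R"] \<sigma>i(2) by simp
  then show ?thesis using s by blast
qed

text \<open>The product distance is at most the sum of the component distances, so the tolerance is
  split evenly among the factors.\<close>

lemma in_cone_nbhdI:
  assumes dec: "ray_decomposition I X d \<sigma> \<theta> \<rho>" and R: "0 < R" and z: "z \<in> PX" and far: "R < PD (\<sigma> 0) z"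
    and \<kappa>: "\<And>i. i \<in> I \<Longrightarrow> geodesic_segment (X i) (d i) (\<kappa> i) (\<rho> i 0) (z i)"
    and near: "\<And>i. i \<in> I \<Longrightarrow> d i (\<kappa> i (R / PD (\<sigma> 0) z * d i (\<rho> i 0) (z i))) (\<rho> i (\<theta> i * R)) < \<epsilon> / card I"
    and I: "I \<noteq> {}"
  shows "Inl z \<in> cone_nbhd PX PD \<sigma> R \<epsilon>"
proof -
  have \<sigma>: "\<sigma> 0 \<in> PX" using geodesic_rayD(1)[OF ray_decomposition_ray[OF dec], of 0] by simp
  have \<sigma>i: "\<sigma> 0 i = \<rho> i 0" "\<sigma> R i = \<rho> i (\<theta> i * R)" if "i \<in> I" for i
    using ray_decompositionD(4)[OF dec _ that, of 0] ray_decompositionD(4)[OF dec _ that, of R] R by simp_all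
  have \<kappa>': "\<And>i. i \<in> I \<Longrightarrow> geodesic_segment (X i) (d i) (\<kappa> i) (\<sigma> 0 i) (z i)" using \<kappa> \<sigma>i by simp
  let ?\<gamma> = "\<lambda>t. prod_point \<kappa> (\<sigma> 0) z (t / PD (\<sigma> 0) z)"
  have "PD (?\<gamma> R) (\<sigma> R) \<le> (\<Sum>i\<in>I. d i (?\<gamma> R i) (\<sigma> R i))"
    unfolding prod_distance_L2 by (rule L2_set_le_sum) (simp add: Metric_space.nonneg[OF metric_factor])
  also have "\<dots> < (\<Sum>i\<in>I. \<epsilon> / card I)"
    using near \<sigma>i finite_I I by (intro sum_strict_mono) (auto simp: prod_point_def)
  also have "\<dots> = \<epsilon>" using I finite_I by simp
  finally show ?thesis
    using z far prod_point_segment[OF \<kappa>' \<sigma> z] unfolding cone_nbhd_def by blast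
qed

end

section \<open>Axes\<close>

lemma left_of_shift:
  assumes "\<And>y z. y \<in> M \<Longrightarrow> z \<in> M \<Longrightarrow> d (g y) (g z) = d y z" "\<And>t. \<sigma> t \<in> M" "\<And>t. g (\<sigma> t) = \<sigma> (t + b)" "p \<in> M"
    "left_of d \<sigma> p \<tau>"
  shows "left_of d \<sigma> (g p) (\<tau> + b)"
  unfolding left_of_def
proof (intro allI impI)
  fix t :: real assume t: "0 \<le> t"
  have "d (g p) (\<sigma> (s + b)) = d p (\<sigma> s)" for s using assms by metis
  then show "d (g p) (\<sigma> (\<tau> + b)) \<le> d (g p) (\<sigma> (\<tau> + b + t))"
    using assms(5) t unfolding left_of_def by (metis add.assoc add.commute)
qed

lemma right_of_shift:
  assumes "\<And>y z. y \<in> M \<Longrightarrow> z \<in> M \<Longrightarrow> d (g y) (g z) = d y z" "\<And>t. \<sigma> t \<in> M" "\<And>t. g (\<sigma> t) = \<sigma> (t + b)" "p \<in> M"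
    "right_of d \<sigma> p \<tau>"
  shows "right_of d \<sigma> (g p) (\<tau> + b)"
  unfolding right_of_def
  using left_of_shift[of M d g "\<lambda>t. \<sigma> (- t)" "- b" p "- \<tau>"] assms by (simp add: right_of_def)

lemma contracting_line_reverse:
  assumes "cat0 M d" "contracting_line M d \<sigma> T"
  shows "contracting_line M d (\<lambda>t. \<sigma> (- t)) T"
  unfolding contracting_line_def
proof (intro conjI allI impI)
  interpret cat0 M d by fact
  show "geodesic_line M d (\<lambda>t. \<sigma> (- t))" "0 < T"
    using assms(2) geodesic_line_reverse by (auto simp: contracting_line_def)
  fix \<tau> p q \<gamma>
  assume *: "geodesic_segment M d \<gamma> p q \<and> left_of d (\<lambda>t. \<sigma> (- t)) p (\<tau> - T) \<and> right_of d (\<lambda>t. \<sigma> (- t)) q (\<tau> + T)"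
  then have "left_of d \<sigma> q (- \<tau> - T)" "right_of d \<sigma> p (- \<tau> + T)"
    by (simp_all add: right_of_def)
  moreover have "geodesic_segment M d (\<lambda>t. \<gamma> (d p q - t)) q p" using geodesic_reverse * by blast
  ultimately obtain u where "u \<in> {0..d q p}" "d (\<gamma> (d p q - u)) (\<sigma> (- \<tau>)) \<le> T"
    using assms(2) unfolding contracting_line_def by blast
  then show "\<exists>u\<in>{0..d p q}. d (\<gamma> u) (\<sigma> (- \<tau>)) \<le> T"
    by (intro bexI[of _ "d p q - u"]) (auto simp: commute)
qed

context cat0
begin

lemma line_rays:
  assumes "geodesic_line M d \<sigma>"
  shows "geodesic_ray M d \<sigma>" "geodesic_ray M d (\<lambda>t. \<sigma> (- t))"
  using assms by (auto simp: geodesic_line_def geodesic_ray_def)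

lemma isometry_group_isometric: "h \<in> carrier (isometry_group M d) \<Longrightarrow> isometric_map h"
  by (auto simp: isometry_group_def isometric_map_def Bij_def bij_betw_def)

lemma funpow_isometric: "isometric_map h \<Longrightarrow> isometric_map (h ^^ k)"
  by (induction k) (auto simp: isometric_map_def)

lemma funpow_shift: "(\<And>t. h (\<sigma> t) = \<sigma> (t + l)) \<Longrightarrow> (h ^^ k) (\<sigma> t) = \<sigma> (t + real k * l)"
  by (induction k) (auto simp: algebra_simps)

lemma axis_inverse:
  assumes h: "h \<in> carrier (isometry_group M d)" and line: "geodesic_line M d \<sigma>" and sh: "\<And>t. h (\<sigma> t) = \<sigma> (t + l)"
  shows "isometric_map (inv_into M h)" "inv_into M h (\<sigma> t) = \<sigma> (t + - l)"
proof -
  have b: "bij_betw h M M" using h by (auto simp: isometry_group_def Bij_def)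
  have hi: "isometric_map h" using isometry_group_isometric[OF h] .
  have in_M: "inv_into M h y \<in> M" "h (inv_into M h y) = y" if "y \<in> M" for y
    using b that by (auto simp: bij_betw_def inv_into_into f_inv_into_f)
  show "isometric_map (inv_into M h)"
    unfolding isometric_map_def using in_M hi unfolding isometric_map_def by metis
  have "inv_into M h (h (\<sigma> (t - l))) = \<sigma> (t - l)"
    using b geodesic_lineD(1)[OF line] by (intro bij_betw_inv_into_left) auto
  then show "inv_into M h (\<sigma> t) = \<sigma> (t + - l)" using sh[of "t - l"] by simp
qed

lemma axis_periodic:
  assumes h: "h \<in> carrier (isometry_group M d)" and line: "geodesic_line M d \<sigma>" and l: "0 < l"
    and sh: "\<And>t. h (\<sigma> t) = \<sigma> (t + l)"
  shows "periodic_line M d \<sigma>"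
  unfolding periodic_line_def
proof (intro conjI exI[of _ l] allI)
  note hi = isometry_group_isometric[OF h] and inv = axis_inverse[OF h line sh]
  fix a :: real
  \<comment> \<open>The number of whole translation lengths in \<open>a\<close>. Powers of the
    inverse or of \<open>h\<close>, according to the sign of \<open>a\<close>, bring the remainder
    below \<open>l\<close>.\<close>
  define k where "k = nat \<lfloor>\<bar>a\<bar> / l\<rfloor>"
  have "real k = of_int \<lfloor>\<bar>a\<bar> / l\<rfloor>" using l by (simp add: k_def)
  then have "real k \<le> \<bar>a\<bar> / l" "\<bar>a\<bar> / l \<le> real k + 1" by linarith+
  then have k: "real k * l \<le> \<bar>a\<bar>" "\<bar>a\<bar> \<le> real k * l + l" using l by (auto simp: field_simps)
  show "\<exists>g b. \<bar>a + b\<bar> \<le> l \<and> (\<forall>y\<in>M. g y \<in> M) \<and>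
        (\<forall>y\<in>M. \<forall>z\<in>M. d (g y) (g z) = d y z) \<and> (\<forall>t. g (\<sigma> t) = \<sigma> (t + b))"
  proof (cases "0 \<le> a")
    case True
    have "\<bar>a + real k * - l\<bar> \<le> l" using k True by simp
    then show ?thesis
      using funpow_isometric[OF inv(1), of k] funpow_shift[of "inv_into M h" \<sigma> "- l" k, OF inv(2)]
      unfolding isometric_map_def by blast
  next
    case False
    have "\<bar>a + real k * l\<bar> \<le> l" using k False by simp
    then show ?thesis
      using funpow_isometric[OF hi, of k] funpow_shift[of h \<sigma> l k, OF sh]
      unfolding isometric_map_def by blast
  qed
qed (fact line)

text \<open>Applying powers of \<open>h\<close> keeps the distance between corresponding points
  constant, which is incompatible with linear drift, so the translation lengths agree. The distance
  is then periodic and bounded on one period. This justifies the definite descriptions of the end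
  points.\<close>

lemma axes_close:
  assumes h: "h \<in> carrier (isometry_group M d)" and "is_axis M d h \<sigma>" "is_axis M d h \<tau>"
  shows "\<exists>C. \<forall>t. d (\<sigma> t) (\<tau> t) \<le> C"
proof -
  obtain l m where l: "0 < l" "\<And>t. h (\<sigma> t) = \<sigma> (t + l)" and m: "0 < m" "\<And>t. h (\<tau> t) = \<tau> (t + m)"
    and lines: "geodesic_line M d \<sigma>" "geodesic_line M d \<tau>" using assms(2,3) unfolding is_axis_def by blast
  note hi = isometry_group_isometric[OF h]
  have M: "\<sigma> t \<in> M" "\<tau> t \<in> M" for t using geodesic_lineD(1)[OF lines(1)] geodesic_lineD(1)[OF lines(2)] by auto
  define D where "D = d (\<sigma> 0) (\<tau> 0)"
  have pow: "d (\<sigma> (t + real k * l)) (\<tau> (t + real k * m)) = d (\<sigma> t) (\<tau> t)" for t k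
    using funpow_isometric[OF hi, of k] funpow_shift[of h \<sigma> l k t, OF l(2)] funpow_shift[of h \<tau> m k t, OF m(2)] M
    unfolding isometric_map_def by metis
  have "real k * \<bar>l - m\<bar> \<le> 2 * D" for k
  proof -
    have "\<bar>real k * l - real k * m\<bar> \<le> 2 * D"
      using pow[of 0 k] triangle[OF M(1)[of 0] M(1)[of "real k * l"] M(2)[of "real k * m"]]
        triangle[OF M(1)[of 0] M(2)[of 0] M(2)[of "real k * m"]]
        triangle[OF M(2)[of 0] M(2)[of "real k * m"] M(1)[of "real k * l"]]
        triangle[OF M(2)[of 0] M(1)[of 0] M(1)[of "real k * l"]]
        triangle[OF M(1)[of 0] M(2)[of "real k * m"] M(1)[of "real k * l"]]
        triangle[OF M(2)[of 0] M(1)[of "real k * l"] M(2)[of "real k * m"]]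
        geodesic_lineD(2)[OF lines(1), of 0 "real k * l"] geodesic_lineD(2)[OF lines(2), of 0 "real k * m"] l(1) m(1)
      by (simp add: D_def commute abs_le_iff)
    then show ?thesis by (simp add: abs_mult flip: right_diff_distrib)
  qed
  then have lm: "l = m" by (metis abs_le_zero_iff ex_less_of_nat_mult eq_iff_diff_eq_0 not_le linorder_neqE_linordered_idom zero_less_abs_iff)
  have near: "d (\<sigma> t) (\<tau> t) \<le> D + 2 * l" if "0 \<le> t" "t \<le> l" for t
  proof -
    have "d (\<sigma> t) (\<tau> t) \<le> d (\<sigma> t) (\<sigma> 0) + (D + d (\<tau> 0) (\<tau> t))"
      using triangle[OF M(1)[of t] M(1)[of 0] M(2)[of t]] triangle[OF M(1)[of 0] M(2)[of 0] M(2)[of t]] by (simp add: D_def)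
    then show ?thesis using geodesic_lineD(2)[OF lines(1), of t 0] geodesic_lineD(2)[OF lines(2), of 0 t] that by simp
  qed
  have "d (\<sigma> t) (\<tau> t) \<le> D + 2 * l" for t
  proof -
    define j where "j = \<lfloor>t / l\<rfloor>"
    have "of_int j \<le> t / l" "t / l \<le> of_int j + 1" unfolding j_def by linarith+
    then have j: "of_int j * l \<le> t" "t \<le> of_int j * l + l" using l by (auto simp: field_simps)
    show ?thesis
    proof (cases "0 \<le> j")
      case True
      then have "real (nat j) = of_int j" by simp
      then show ?thesis using pow[of "t - real (nat j) * l" "nat j"] near[of "t - real (nat j) * l"] j lm by simp
    next
      case False
      then have "real (nat (- j)) = - of_int j" by simp
      then show ?thesis using pow[of t "nat (- j)"] near[of "t + real (nat (- j)) * l"] j lm by simp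
    qed
  qed
  then show ?thesis by blast
qed

lemma attracting_point_axis:
  assumes h: "h \<in> carrier (isometry_group M d)" and ax: "is_axis M d h \<sigma>"
  shows "attracting_point M d h = ray_end M d \<sigma>" "repelling_point M d h = ray_end M d (\<lambda>t. \<sigma> (- t))"
proof -
  have line: "geodesic_line M d \<rho>" if "is_axis M d h \<rho>" for \<rho> using that by (simp add: is_axis_def)
  have "ray_end M d \<tau> = ray_end M d \<sigma>" "ray_end M d (\<lambda>t. \<tau> (- t)) = ray_end M d (\<lambda>t. \<sigma> (- t))"
    if \<tau>: "is_axis M d h \<tau>" for \<tau>
  proof -
    obtain C where "\<And>t. d (\<tau> t) (\<sigma> t) \<le> C" using axes_close[OF h \<tau> ax] by blast
    then have "asymptotic d \<tau> \<sigma>" "asymptotic d (\<lambda>t. \<tau> (- t)) (\<lambda>t. \<sigma> (- t))" unfolding asymptotic_def by blast+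
    then show "ray_end M d \<tau> = ray_end M d \<sigma>" "ray_end M d (\<lambda>t. \<tau> (- t)) = ray_end M d (\<lambda>t. \<sigma> (- t))"
      using ray_end_eqI line_rays[OF line[OF \<tau>]] line_rays[OF line[OF ax]] by blast+
  qed
  note * = this
  show "attracting_point M d h = ray_end M d \<sigma>"
    unfolding attracting_point_def
  proof (rule the_equality)
    show "\<exists>\<rho>. is_axis M d h \<rho> \<and> ray_end M d \<sigma> = ray_end M d \<rho>" using ax by blast
  qed (use *(1) in auto)
  show "repelling_point M d h = ray_end M d (\<lambda>t. \<sigma> (- t))"
    unfolding repelling_point_def
  proof (rule the_equality)
    show "\<exists>\<rho>. is_axis M d h \<rho> \<and> ray_end M d (\<lambda>t. \<sigma> (- t)) = ray_end M d (\<lambda>t. \<rho> (- t))" using ax by blast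
  qed (use *(2) in auto)
qed

end

text \<open>All that the dynamics needs to know about one factor, packed into a single existential
  so that the data can be chosen for all factors at once.\<close>

lemma independent_axes:
  assumes "hadamard_space M d" "locally_compact_space (Metric_space.mtopology M d)" "independent_rank_one M d g h"
  shows "\<exists>\<tau> \<sigma> m l T S. contracting_line M d \<tau> T \<and> contracting_line M d \<sigma> S \<and> 0 < m \<and> 0 < l \<and>
    (\<forall>t. g (\<tau> t) = \<tau> (t + m)) \<and> (\<forall>t. h (\<sigma> t) = \<sigma> (t + l)) \<and>
    \<not> asymptotic d \<sigma> \<tau> \<and> \<not> asymptotic d \<sigma> (\<lambda>t. \<tau> (- t)) \<and>
    \<not> asymptotic d (\<lambda>t. \<sigma> (- t)) \<tau> \<and> \<not> asymptotic d (\<lambda>t. \<sigma> (- t)) (\<lambda>t. \<tau> (- t))"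
proof -
  interpret cat0 M d using assms(1) by (simp add: hadamard_space_def CAT0_space_imp_cat0)
  have complete: mcomplete using assms(1) by (simp add: hadamard_space_def)
  have axis: "\<exists>\<rho> k S. is_axis M d f \<rho> \<and> contracting_line M d \<rho> S \<and> 0 < k \<and> (\<forall>t. f (\<rho> t) = \<rho> (t + k))"
    if f: "rank_one M d f" for f
  proof -
    obtain \<rho> where \<rho>: "is_axis M d f \<rho>" "\<not> bounds_flat_half_plane M d \<rho>" using f unfolding rank_one_def by blast
    then obtain k where k: "geodesic_line M d \<rho>" "0 < k" "\<And>t. f (\<rho> t) = \<rho> (t + k)" unfolding is_axis_def by blast
    have "periodic_line M d \<rho>" using axis_periodic[OF _ k] f unfolding rank_one_def by blast
    then show ?thesis using rank_one_contracting[OF _ hopf_rinow[OF complete assms(2)] \<rho>(2)] \<rho>(1) k by blast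
  qed
  have r: "rank_one M d g" "rank_one M d h" and c: "g \<in> carrier (isometry_group M d)" "h \<in> carrier (isometry_group M d)"
    using assms(3) by (auto simp: independent_rank_one_def rank_one_def)
  obtain \<tau> m T where \<tau>: "is_axis M d g \<tau>" "contracting_line M d \<tau> T" "0 < m" "\<forall>t. g (\<tau> t) = \<tau> (t + m)" using axis[OF r(1)] by blast
  obtain \<sigma> l S where \<sigma>: "is_axis M d h \<sigma>" "contracting_line M d \<sigma> S" "0 < l" "\<forall>t. h (\<sigma> t) = \<sigma> (t + l)" using axis[OF r(2)] by blast

  have lines: "geodesic_line M d \<sigma>" "geodesic_line M d \<tau>" using \<sigma> \<tau> by (auto simp: is_axis_def)
  have "{ray_end M d \<tau>, ray_end M d (\<lambda>t. \<tau> (- t))} \<inter> {ray_end M d \<sigma>, ray_end M d (\<lambda>t. \<sigma> (- t))} = {}"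
    using assms(3) attracting_point_axis[OF c(1) \<tau>(1)] attracting_point_axis[OF c(2) \<sigma>(1)]
    by (simp add: independent_rank_one_def)
  then have "\<not> asymptotic d \<sigma> \<tau> \<and> \<not> asymptotic d \<sigma> (\<lambda>t. \<tau> (- t)) \<and>
    \<not> asymptotic d (\<lambda>t. \<sigma> (- t)) \<tau> \<and> \<not> asymptotic d (\<lambda>t. \<sigma> (- t)) (\<lambda>t. \<tau> (- t))"
    by (auto simp: ray_end_eq_iff[symmetric] line_rays[OF lines(1)] line_rays[OF lines(2)])
  then show ?thesis using \<sigma> \<tau> by blast
qed

section \<open>Groups acting on a product\<close>

lemma group_isometry_group:
  assumes "Metric_space M d"
  shows "group (isometry_group M d)"
proof -
  interpret B: group "BijGroup M" by (rule group_BijGroup)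
  let ?H = "{f \<in> Bij M. \<forall>x\<in>M. \<forall>y\<in>M. d (f x) (f y) = d x y}"
  have "subgroup ?H (BijGroup M)"
  proof (rule B.subgroupI)
    show "?H \<subseteq> carrier (BijGroup M)" by (auto simp: BijGroup_def)
    show "?H \<noteq> {}" using id_Bij[of M] by fastforce
    fix f assume f: "f \<in> ?H"
    then have b: "bij_betw f M M" by (simp add: Bij_def)
    have "d (inv_into M f x) (inv_into M f y) = d x y" if "x \<in> M" "y \<in> M" for x y
    proof -
      have M: "inv_into M f x \<in> M" "inv_into M f y \<in> M"
        using bij_betwE[OF bij_betw_inv_into[OF b]] that by auto
      then have "d (f (inv_into M f x)) (f (inv_into M f y)) = d (inv_into M f x) (inv_into M f y)" using f by simp
      then show ?thesis using bij_betw_inv_into_right[OF b] that by simp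
    qed
    then show "inv\<^bsub>BijGroup M\<^esub> f \<in> ?H" using f by (simp add: inv_BijGroup restrict_inv_into_Bij)
  next
    fix f g assume f: "f \<in> ?H" and g: "g \<in> ?H"
    then have "g x \<in> M" if "x \<in> M" for x using that Bij_imp_funcset by fastforce
    then show "f \<otimes>\<^bsub>BijGroup M\<^esub> g \<in> ?H" using f g compose_Bij[of f M g] by (simp add: BijGroup_def compose_eq)
  qed
  then show ?thesis
    unfolding isometry_group_def by (rule subgroup.subgroup_is_group) (rule group_BijGroup)
qed

locale product_action = cat0_product I X d for I :: "'i set" and X :: "'i \<Rightarrow> 'a set" and d +
  fixes \<Gamma> :: "('i \<Rightarrow> 'a \<Rightarrow> 'a) set"
  assumes complete_factor: "\<And>i. i \<in> I \<Longrightarrow> Metric_space.mcomplete (X i) (d i)"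
    and subgroup: "subgroup \<Gamma> (prod_isometries I X d)"
begin

section \<open>Group laws as statements about pointwise maps\<close>

lemma group_prod: "group (prod_isometries I X d)"
  unfolding prod_isometries_def using group_isometry_group[OF metric_factor] by simp

lemma component_isometry: "\<gamma> \<in> \<Gamma> \<Longrightarrow> i \<in> I \<Longrightarrow> \<gamma> i \<in> carrier (isometry_group (X i) (d i))"
  using subgroup.subset[OF subgroup] by (auto simp: prod_isometries_def)

lemma isometric: "\<gamma> \<in> \<Gamma> \<Longrightarrow> i \<in> I \<Longrightarrow> cat0.isometric_map (X i) (d i) (\<gamma> i)"
  using cat0.isometry_group_isometric[OF cat0_factor component_isometry] .

lemma in_factor: "\<gamma> \<in> \<Gamma> \<Longrightarrow> i \<in> I \<Longrightarrow> y \<in> X i \<Longrightarrow> \<gamma> i y \<in> X i"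
  using isometric cat0.isometric_map_def[OF cat0_factor] by blast

lemma dist_act: "\<gamma> \<in> \<Gamma> \<Longrightarrow> i \<in> I \<Longrightarrow> y \<in> X i \<Longrightarrow> z \<in> X i \<Longrightarrow> d i (\<gamma> i y) (\<gamma> i z) = d i y z"
  using isometric cat0.isometric_map_def[OF cat0_factor] by blast

lemma mult_apply:
  assumes "\<gamma> \<in> \<Gamma>" "\<delta> \<in> \<Gamma>" "i \<in> I" "y \<in> X i"
  shows "(\<gamma> \<otimes>\<^bsub>prod_isometries I X d\<^esub> \<delta>) i y = \<gamma> i (\<delta> i y)"
  using assms component_isometry[OF assms(1,3)] component_isometry[OF assms(2,3)]
  by (simp add: prod_isometries_def isometry_group_def BijGroup_def compose_def)

lemma one_apply: "i \<in> I \<Longrightarrow> y \<in> X i \<Longrightarrow> \<one>\<^bsub>prod_isometries I X d\<^esub> i y = y"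
  by (simp add: prod_isometries_def isometry_group_def BijGroup_def)

text \<open>Only the values of group elements on the factors matter for the dynamics. Closure under
  products, inverses and powers is therefore restated as existence of an element with prescribed
  values.\<close>

lemma ex_comp:
  assumes "\<gamma> \<in> \<Gamma>" "\<delta> \<in> \<Gamma>"
  shows "\<exists>\<mu>\<in>\<Gamma>. \<forall>i\<in>I. \<forall>y\<in>X i. \<mu> i y = \<gamma> i (\<delta> i y)"
  using mult_apply[OF assms] subgroup.m_closed[OF subgroup assms] by blast

lemma ex_inverse:
  assumes "\<gamma> \<in> \<Gamma>"
  shows "\<exists>\<mu>\<in>\<Gamma>. \<forall>i\<in>I. \<forall>y\<in>X i. \<mu> i (\<gamma> i y) = y \<and> \<gamma> i (\<mu> i y) = y"
proof -
  let ?G = "prod_isometries I X d"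
  interpret group ?G by (rule group_prod)
  have i: "inv\<^bsub>?G\<^esub> \<gamma> \<in> \<Gamma>" using subgroup.m_inv_closed[OF subgroup assms] .
  have c: "\<gamma> \<in> carrier ?G" using subgroup.subset[OF subgroup] assms by blast
  have "(inv\<^bsub>?G\<^esub> \<gamma>) j (\<gamma> j y) = y \<and> \<gamma> j ((inv\<^bsub>?G\<^esub> \<gamma>) j y) = y" if "j \<in> I" "y \<in> X j" for j y
    using mult_apply[OF i assms that] mult_apply[OF assms i that] l_inv[OF c] r_inv[OF c] one_apply[OF that] by simp
  then show ?thesis using i by blast
qed

lemma ex_power:
  assumes "\<gamma> \<in> \<Gamma>"
  shows "\<exists>\<mu>\<in>\<Gamma>. \<forall>i\<in>I. \<forall>y\<in>X i. \<mu> i y = (\<gamma> i ^^ k) y"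
proof (induction k)
  case 0
  show ?case using one_apply subgroup.one_closed[OF subgroup] by auto
next
  case (Suc k)
  then obtain \<mu> where \<mu>: "\<mu> \<in> \<Gamma>" "\<forall>i\<in>I. \<forall>y\<in>X i. \<mu> i y = (\<gamma> i ^^ k) y" by blast
  then show ?case using ex_comp[OF assms \<mu>(1)] by simp
qed

lemma funpow_in_factor: "\<gamma> \<in> \<Gamma> \<Longrightarrow> i \<in> I \<Longrightarrow> y \<in> X i \<Longrightarrow> (\<gamma> i ^^ k) y \<in> X i"
  by (induction k) (auto simp: in_factor)

section \<open>The action on the Furstenberg boundary and ping-pong\<close>

lemma topspace_furstenberg: "topspace (furstenberg_topology I X d) = (\<Pi>\<^sub>E i\<in>I. geom_boundary (X i) (d i))"
  unfolding furstenberg_topology_def topspace_product_topology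
  using cat0.topspace_boundary_topology[OF cat0_factor] by (intro PiE_cong) auto

lemma continuous_furstenberg_act:
  assumes "\<gamma> \<in> \<Gamma>"
  shows "continuous_map (furstenberg_topology I X d) (furstenberg_topology I X d) (furstenberg_act I X d \<gamma>)"
  unfolding furstenberg_topology_def continuous_map_componentwise
proof (intro conjI ballI)
  show "furstenberg_act I X d \<gamma> ` topspace (product_topology (\<lambda>i. boundary_topology (X i) (d i)) I) \<subseteq> extensional I"
    by (auto simp: furstenberg_act_def)
  fix i assume i: "i \<in> I"
  have "continuous_map (product_topology (\<lambda>i. boundary_topology (X i) (d i)) I) (boundary_topology (X i) (d i))
    (boundary_act (X i) (d i) (\<gamma> i) \<circ> (\<lambda>\<xi>. \<xi> i))"
    using cat0.continuous_boundary_act[OF cat0_factor[OF i] isometric[OF assms i] complete_factor[OF i]]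
      continuous_map_product_projection[OF i] by (rule continuous_map_compose[rotated])
  then show "continuous_map (product_topology (\<lambda>i. boundary_topology (X i) (d i)) I) (boundary_topology (X i) (d i))
      (\<lambda>\<xi>. furstenberg_act I X d \<gamma> \<xi> i)"
    by (rule continuous_map_eq) (simp add: furstenberg_act_def i)
qed

lemma furstenberg_act_rays:
  assumes "\<gamma> \<in> \<Gamma>" "\<And>i. i \<in> I \<Longrightarrow> geodesic_ray (X i) (d i) (c i)"
  shows "furstenberg_act I X d \<gamma> (\<lambda>i\<in>I. ray_end (X i) (d i) (c i)) = (\<lambda>i\<in>I. ray_end (X i) (d i) (\<gamma> i \<circ> c i))"
  unfolding furstenberg_act_def
  using cat0.boundary_act_ray_end[OF cat0_factor isometric[OF assms(1)] assms(2)] by (intro restrict_ext) simp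

text \<open>
  Of the translates of \<open>y i\<close> by \<open>0, N, 2 N, \<dots>\<close> along \<open>\<tau> i\<close> at most one is near the left end of
  \<open>\<sigma> i\<close>. Hence one of \<open>card I + 1\<close> exponents is good for all factors at once, and then a power
  of \<open>h\<close> moves the point to the right.
\<close>

lemma escape_right:
  assumes gh: "g \<in> \<Gamma>" "h \<in> \<Gamma>" and lm: "\<And>i. i \<in> I \<Longrightarrow> 0 < l i" "\<And>i. i \<in> I \<Longrightarrow> 0 < m i"
    and con: "\<And>i. i \<in> I \<Longrightarrow> contracting_line (X i) (d i) (\<sigma> i) (S i)" "\<And>i. i \<in> I \<Longrightarrow> contracting_line (X i) (d i) (\<tau> i) (T i)"
    and sh: "\<And>i t. i \<in> I \<Longrightarrow> h i (\<sigma> i t) = \<sigma> i (t + l i)" "\<And>i t. i \<in> I \<Longrightarrow> g i (\<tau> i t) = \<tau> i (t + m i)"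
    and na: "\<And>i. i \<in> I \<Longrightarrow> \<not> asymptotic (d i) (\<lambda>t. \<sigma> i (- t)) (\<tau> i)"
      "\<And>i. i \<in> I \<Longrightarrow> \<not> asymptotic (d i) (\<lambda>t. \<sigma> i (- t)) (\<lambda>t. \<tau> i (- t))"
  shows "\<exists>F. finite F \<and> F \<subseteq> \<Gamma> \<and> (\<forall>y\<in>PX. \<exists>\<alpha>\<in>F. \<forall>i\<in>I. right_of (d i) (\<sigma> i) (\<alpha> i (y i)) R)"
proof -
  have lines: "geodesic_line (X i) (d i) (\<sigma> i)" "geodesic_line (X i) (d i) (\<tau> i)" if "i \<in> I" for i
    using con[OF that] by (auto simp: contracting_line_def)
  \<comment> \<open>Reversal of \<sigma> turns far left into far right. The backward end of \<sigma>
    is separated from each of the two ends of \<tau>, and the larger constant serves for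
    both.\<close>
  have "\<exists>K. \<forall>p\<in>X i. left_of (d i) (\<sigma> i) p (- K) \<longrightarrow> \<not> right_of (d i) (\<tau> i) p K \<and> \<not> left_of (d i) (\<tau> i) p (- K)"
    if i: "i \<in> I" for i
  proof -
    interpret cat0 "X i" "d i" using cat0_factor[OF i] .
    note rev = contracting_line_reverse[OF cat0_factor[OF i]]
    obtain K1 where K1: "\<And>p. p \<in> X i \<Longrightarrow> \<not> (left_of (d i) (\<sigma> i) p (- K1) \<and> right_of (d i) (\<tau> i) p K1)"
      using contracting_lines_separate[OF rev[OF con(1)[OF i]] con(2)[OF i] na(1)[OF i]] by (auto simp: right_of_def)
    obtain K2 where K2: "\<And>p. p \<in> X i \<Longrightarrow> \<not> (left_of (d i) (\<sigma> i) p (- K2) \<and> left_of (d i) (\<tau> i) p (- K2))"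
      using contracting_lines_separate[OF rev[OF con(1)[OF i]] rev[OF con(2)[OF i]] na(2)[OF i]] by (auto simp: right_of_def)
    have "\<not> right_of (d i) (\<tau> i) p (max K1 K2) \<and> \<not> left_of (d i) (\<tau> i) p (- max K1 K2)"
      if p: "p \<in> X i" "left_of (d i) (\<sigma> i) p (- max K1 K2)" for p
      using K1[OF p(1)] K2[OF p(1)] left_of_mono[OF lines(1)[OF i] p] left_of_mono[OF lines(2)[OF i] p(1), of "- max K1 K2" "- K2"]
        right_of_mono[OF lines(2)[OF i] p(1), of "max K1 K2" K1] by auto
    then show ?thesis by blast
  qed
  then obtain K where K: "\<And>i p. i \<in> I \<Longrightarrow> p \<in> X i \<Longrightarrow> left_of (d i) (\<sigma> i) p (- K i) \<Longrightarrow>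
      \<not> right_of (d i) (\<tau> i) p (K i) \<and> \<not> left_of (d i) (\<tau> i) p (- K i)" by metis
  have large: "\<exists>N::nat. \<forall>i\<in>I. b i \<le> real N * a i" if "\<And>i. i \<in> I \<Longrightarrow> 0 < a i" for a b :: "'i \<Rightarrow> real"
  proof -
    have "\<forall>\<^sub>F N in sequentially. b i \<le> real N * a i" if i: "i \<in> I" for i
    proof (intro eventually_sequentiallyI[of "nat \<lceil>b i / a i\<rceil>"])
      fix N assume "nat \<lceil>b i / a i\<rceil> \<le> N"
      then have "b i / a i \<le> real N" by linarith
      then show "b i \<le> real N * a i" using \<open>\<And>i. i \<in> I \<Longrightarrow> 0 < a i\<close>[OF i] by (simp add: field_simps)
    qed
    then have "\<forall>\<^sub>F N in sequentially. \<forall>i\<in>I. b i \<le> real N * a i"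
      using finite_I by (simp add: eventually_ball_finite)
    then show ?thesis by (auto simp: eventually_sequentially)
  qed
  \<comment> \<open>\<open>N\<close> steps of \<open>g\<close> carry a projection across the whole
    window from \<open>- K i\<close> to \<open>K i\<close> on \<tau>. Below, \<open>k\<close> steps
    of \<open>h\<close> carry anything right of \<open>- K i\<close> to the right of
    \<open>R\<close> on \<sigma>.\<close>
  obtain N :: nat where N: "\<And>i. i \<in> I \<Longrightarrow> 2 * K i \<le> real N * m i" using large[of m "\<lambda>i. 2 * K i"] lm by blast
  obtain k :: nat where k: "\<And>i. i \<in> I \<Longrightarrow> R + K i \<le> real k * l i" using large[of l "\<lambda>i. R + K i"] lm by blast
  have "\<exists>\<mu>\<in>\<Gamma>. \<forall>i\<in>I. \<forall>y\<in>X i. \<mu> i y = (h i ^^ k) ((g i ^^ (j * N)) y)" for j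
  proof -
    obtain \<mu>1 \<mu>2 where \<mu>: "\<mu>1 \<in> \<Gamma>" "\<forall>i\<in>I. \<forall>y\<in>X i. \<mu>1 i y = (h i ^^ k) y" "\<mu>2 \<in> \<Gamma>" "\<forall>i\<in>I. \<forall>y\<in>X i. \<mu>2 i y = (g i ^^ (j * N)) y"
      using ex_power[OF gh(2)] ex_power[OF gh(1)] by metis
    then show ?thesis using ex_comp[OF \<mu>(1,3)] funpow_in_factor[OF gh(1)] by simp
  qed
  then obtain \<mu> where \<mu>: "\<And>j. \<mu> j \<in> \<Gamma>" "\<And>j i y. i \<in> I \<Longrightarrow> y \<in> X i \<Longrightarrow> \<mu> j i y = (h i ^^ k) ((g i ^^ (j * N)) y)" by metis
  have "\<exists>j\<in>{0..card I}. \<forall>i\<in>I. right_of (d i) (\<sigma> i) (\<mu> j i (y i)) R" if y: "y \<in> PX" for y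
  proof -
    have yi: "y i \<in> X i" if "i \<in> I" for i using PX_component[OF y that] .
    define bad where "bad j i \<longleftrightarrow> left_of (d i) (\<sigma> i) ((g i ^^ (j * N)) (y i)) (- K i)" for j i
    \<comment> \<open>A bad point projects to \<tau> beyond \<open>- K i\<close>. Every later
      translate then projects beyond \<open>K i\<close>, which is impossible for a bad
      point.\<close>
    have one_bad: False if b: "i \<in> I" "bad j i" "bad j' i" "j < j'" for i j j'
    proof -
      interpret cat0 "X i" "d i" using cat0_factor[OF b(1)] .
      define p where "p = (g i ^^ (j * N)) (y i)"
      have p: "p \<in> X i" unfolding p_def using funpow_in_factor[OF gh(1) b(1) yi[OF b(1)]] .
      define n where "n = (j' - j) * N"
      have "(g i ^^ n) p = (g i ^^ (j' * N)) (y i)"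
      proof -
        have "j' * N = n + j * N" using b(4) by (simp add: n_def diff_mult_distrib)
        then show ?thesis by (simp add: p_def funpow_add)
      qed
      then have bad': "left_of (d i) (\<sigma> i) ((g i ^^ n) p) (- K i)" using b(3) by (simp add: bad_def)
      have p': "(g i ^^ n) p \<in> X i" using funpow_in_factor[OF gh(1) b(1) p] .
      obtain a where a: "left_of (d i) (\<tau> i) p a" "right_of (d i) (\<tau> i) p a"
        using projection_exists[OF lines(2)[OF b(1)] p] by blast
      have "- K i < a" using K[OF b(1) p] b(2) left_of_mono[OF lines(2)[OF b(1)] p a(1), of "- K i"]
        by (force simp: bad_def p_def)
      moreover have "right_of (d i) (\<tau> i) ((g i ^^ n) p) (a + real n * m i)"
        using funpow_isometric[OF isometric[OF gh(1) b(1)], of n] funpow_shift[of "g i" "\<tau> i" "m i" n, OF sh(2)[OF b(1)]]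
          geodesic_lineD(1)[OF lines(2)[OF b(1)]] p a(2)
        by (intro right_of_shift[of "X i"]) (auto simp: isometric_map_def)
      moreover have "real N * m i \<le> real n * m i"
      proof -
        have "N \<le> n"
          using mult_le_mono1[OF Suc_leI[OF zero_less_diff[THEN iffD2, OF b(4)]], of N] by (simp add: n_def)
        then show ?thesis using lm(2)[OF b(1)] by (intro mult_right_mono) auto
      qed
      ultimately have "right_of (d i) (\<tau> i) ((g i ^^ n) p) (K i)"
        using right_of_mono[OF lines(2)[OF b(1)] p', of "a + real n * m i" "K i"] N[OF b(1)] by simp
      then show False using K[OF b(1) p' bad'] by blast
    qed
    have "\<exists>j\<in>{0..card I}. \<forall>i\<in>I. \<not> bad j i"
    proof (rule ccontr)
      assume "\<not> ?thesis"
      then obtain f where f: "\<And>j. j \<in> {0..card I} \<Longrightarrow> f j \<in> I \<and> bad j (f j)" by metis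
      have "inj_on f {0..card I}"
      proof (rule inj_onI)
        fix a b assume "a \<in> {0..card I}" "b \<in> {0..card I}" "f a = f b"
        then show "a = b" using f[of a] f[of b] one_bad[of "f a" a b] one_bad[of "f a" b a] by (metis linorder_neqE_nat)
      qed
      then have "card {0..card I} \<le> card I" using f finite_I by (intro card_inj_on_le) auto
      then show False by simp
    qed
    then obtain j where j: "j \<in> {0..card I}" "\<And>i. i \<in> I \<Longrightarrow> \<not> bad j i" by blast
    have "right_of (d i) (\<sigma> i) (\<mu> j i (y i)) R" if i: "i \<in> I" for i
    proof -
      interpret cat0 "X i" "d i" using cat0_factor[OF i] .
      define p where "p = (g i ^^ (j * N)) (y i)"
      have p: "p \<in> X i" unfolding p_def using funpow_in_factor[OF gh(1) i yi[OF i]] .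
      have "right_of (d i) (\<sigma> i) p (- K i)"
        using left_or_right[OF lines(1)[OF i] p, of "- K i"] j(2)[OF i] by (simp add: bad_def p_def)
      then have "right_of (d i) (\<sigma> i) ((h i ^^ k) p) (- K i + real k * l i)"
        using funpow_isometric[OF isometric[OF gh(2) i], of k] funpow_shift[of "h i" "\<sigma> i" "l i" k, OF sh(1)[OF i]]
          geodesic_lineD(1)[OF lines(1)[OF i]] p
        by (intro right_of_shift[of "X i"]) (auto simp: isometric_map_def)
      then have "right_of (d i) (\<sigma> i) ((h i ^^ k) p) R"
        using right_of_mono[OF lines(1)[OF i] funpow_in_factor[OF gh(2) i p], of k "- K i + real k * l i" R] k[OF i] by simp
      then show ?thesis using \<mu>(2)[OF i yi[OF i]] by (simp add: p_def)
    qed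
    then show ?thesis using j(1) by blast
  qed
  then show ?thesis using \<mu>(1) by (intro exI[of _ "\<mu> ` {0..card I}"]) auto
qed

text \<open>This is \<open>escape_right\<close> for the reversed lines \<sigma> and the inverse of
  \<open>h\<close>.\<close>

lemma escape_left:
  assumes gh: "g \<in> \<Gamma>" "h \<in> \<Gamma>" and lm: "\<And>i. i \<in> I \<Longrightarrow> 0 < l i" "\<And>i. i \<in> I \<Longrightarrow> 0 < m i"
    and con: "\<And>i. i \<in> I \<Longrightarrow> contracting_line (X i) (d i) (\<sigma> i) (S i)" "\<And>i. i \<in> I \<Longrightarrow> contracting_line (X i) (d i) (\<tau> i) (T i)"
    and sh: "\<And>i t. i \<in> I \<Longrightarrow> h i (\<sigma> i t) = \<sigma> i (t + l i)" "\<And>i t. i \<in> I \<Longrightarrow> g i (\<tau> i t) = \<tau> i (t + m i)"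
    and na: "\<And>i. i \<in> I \<Longrightarrow> \<not> asymptotic (d i) (\<sigma> i) (\<tau> i)"
      "\<And>i. i \<in> I \<Longrightarrow> \<not> asymptotic (d i) (\<sigma> i) (\<lambda>t. \<tau> i (- t))"
  shows "\<exists>F. finite F \<and> F \<subseteq> \<Gamma> \<and> (\<forall>y\<in>PX. \<exists>\<alpha>\<in>F. \<forall>i\<in>I. left_of (d i) (\<sigma> i) (\<alpha> i (y i)) (- R))"
proof -
  obtain h' where h': "h' \<in> \<Gamma>" "\<And>i y. i \<in> I \<Longrightarrow> y \<in> X i \<Longrightarrow> h' i (h i y) = y" using ex_inverse[OF gh(2)] by blast
  have "\<sigma> i t \<in> X i" if "i \<in> I" for i t
    using con(1)[OF that] geodesic_lineD(1) by (auto simp: contracting_line_def)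
  then have sh': "h' i (\<sigma> i (- t)) = \<sigma> i (- (t + l i))" if "i \<in> I" for i t
    using h'(2)[OF that, of "\<sigma> i (- t - l i)"] sh(1)[OF that, of "- t - l i"] that by simp
  show ?thesis
    using escape_right[of g h' l m "\<lambda>i t. \<sigma> i (- t)" S \<tau> T R] gh(1) h'(1) lm con sh' sh(2) na
      contracting_line_reverse[OF cat0_factor con(1)]
    by (simp add: right_of_def)
qed

text \<open>
  If \<open>\<gamma> x\<close> is close to the given limit point, then \<open>\<alpha>\<close> and \<open>\<beta>\<close> from fixed finite subsets of \<open>\<Gamma>\<close>
  move \<open>\<gamma>\<^sup>-\<^sup>1 x\<close> and the given point of \<open>A\<close> to different sides of all the lines \<open>\<sigma> i\<close>. So the ray
  from \<open>x\<close> to the image of that point under \<open>\<gamma> \<alpha>\<^sup>-\<^sup>1 \<beta>\<close> passes near \<open>\<gamma> x\<close>.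
\<close>

lemma limit_set_subset_closed:
  assumes con: "\<And>i. i \<in> I \<Longrightarrow> contracting_line (X i) (d i) (\<sigma> i) (S i)"
    and esc: "\<And>R. \<exists>F. finite F \<and> F \<subseteq> \<Gamma> \<and> (\<forall>y\<in>PX. \<exists>\<alpha>\<in>F. \<forall>i\<in>I. right_of (d i) (\<sigma> i) (\<alpha> i (y i)) R)"
      "\<And>R. \<exists>F. finite F \<and> F \<subseteq> \<Gamma> \<and> (\<forall>y\<in>PX. \<exists>\<alpha>\<in>F. \<forall>i\<in>I. left_of (d i) (\<sigma> i) (\<alpha> i (y i)) (- R))"
    and A: "nonempty_invariant_closed I X d \<Gamma> A" and x: "x \<in> PX"
  shows "furstenberg_limit_set I X d \<Gamma> x \<subseteq> A"
proof
  interpret P: cat0 PX PD by (rule prod_cat0)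
  fix \<xi> assume "\<xi> \<in> furstenberg_limit_set I X d \<Gamma> x"
  then obtain \<zeta> where \<zeta>: "\<zeta> \<in> geometric_limit_set I X d \<Gamma> x" "\<zeta> \<in> regular_boundary I X d" "\<xi> = furstenberg_proj I X d \<zeta>"
    by (auto simp: furstenberg_limit_set_def)
  then obtain c \<theta> \<rho> where c: "c \<in> \<zeta>" and dec: "ray_decomposition I X d c \<theta> \<rho>" and pos: "\<And>i. i \<in> I \<Longrightarrow> 0 < \<theta> i"
    using regular_boundaryE by metis
  have \<zeta>B: "\<zeta> \<in> geom_boundary PX PD" using \<zeta>(1) by (simp add: geometric_limit_set_def)
  have \<xi>: "\<xi> = (\<lambda>i\<in>I. ray_end (X i) (d i) (\<rho> i))" using furstenberg_proj_eq[OF \<zeta>B c dec pos] \<zeta>(3) by simp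
  note D = ray_decompositionD[OF dec]
  note cray = ray_decomposition_ray[OF dec]
  have \<zeta>c: "\<zeta> = ray_end PX PD c" using P.boundaryD[OF \<zeta>B c] by simp
  have y: "\<rho> i 0 \<in> X i" if "i \<in> I" for i using geodesic_rayD(1)[OF D(1)[OF that]] by simp
  have xi: "x i \<in> X i" if "i \<in> I" for i using PX_component[OF x that] .
  have \<sigma>M: "\<sigma> i t \<in> X i" if "i \<in> I" for i t
    using con[OF that] geodesic_lineD(1) by (auto simp: contracting_line_def)
  have A_top: "A \<subseteq> topspace (furstenberg_topology I X d)"
    using A by (simp add: nonempty_invariant_closed_def closedin_subset)
  obtain \<eta> where \<eta>: "\<eta> \<in> A" using A by (auto simp: nonempty_invariant_closed_def)
  have \<eta>B: "\<eta> i \<in> geom_boundary (X i) (d i)" if "i \<in> I" for i using A_top \<eta> that topspace_furstenberg by auto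
  have \<eta>ext: "\<eta> \<in> extensional I" using A_top \<eta> topspace_furstenberg by (auto simp: PiE_def)
  have "\<forall>i\<in>I. \<exists>\<nu>. \<nu> \<in> \<eta> i" using cat0.boundary_nonempty[OF cat0_factor \<eta>B] by blast
  then obtain \<nu> where "\<And>i. i \<in> I \<Longrightarrow> \<nu> i \<in> \<eta> i" by metis
  then have \<nu>: "geodesic_ray (X i) (d i) (\<nu> i)" "\<eta> i = ray_end (X i) (d i) (\<nu> i)" if "i \<in> I" for i
    using cat0.boundaryD[OF cat0_factor \<eta>B] that by blast+
  have \<nu>M: "\<nu> i t \<in> X i" if "i \<in> I" "0 \<le> t" for i t using geodesic_rayD(1)[OF \<nu>(1)[OF that(1)] that(2)] .
  have \<eta>eq: "\<eta> = (\<lambda>i\<in>I. ray_end (X i) (d i) (\<nu> i))"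
    using \<eta>ext \<nu>(2) by (intro extensionalityI[OF \<eta>ext]) auto
  obtain iv where iv: "\<And>\<gamma>. \<gamma> \<in> \<Gamma> \<Longrightarrow> iv \<gamma> \<in> \<Gamma>"
      "\<And>\<gamma> i z. \<gamma> \<in> \<Gamma> \<Longrightarrow> i \<in> I \<Longrightarrow> z \<in> X i \<Longrightarrow> iv \<gamma> i (\<gamma> i z) = z \<and> \<gamma> i (iv \<gamma> i z) = z"
    using ex_inverse by metis
  \<comment> \<open>A sum instead of a maximum: one number that dominates the constants of all
    factors.\<close>
  define T where "T = (\<Sum>i\<in>I. \<bar>S i\<bar>)"
  have S: "S i \<le> T" if "i \<in> I" for i
    using member_le_sum[OF that, of "\<lambda>i. \<bar>S i\<bar>"] finite_I unfolding T_def by force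
  have T: "0 \<le> T" unfolding T_def by (rule sum_nonneg) simp
  obtain Fl where Fl: "finite Fl" "Fl \<subseteq> \<Gamma>" "\<And>y. y \<in> PX \<Longrightarrow> \<exists>\<alpha>\<in>Fl. \<forall>i\<in>I. left_of (d i) (\<sigma> i) (\<alpha> i (y i)) (- T)"
    using esc(2)[of T] by blast
  obtain Fr where Fr: "finite Fr" "Fr \<subseteq> \<Gamma>" "\<And>y. y \<in> PX \<Longrightarrow> \<exists>\<beta>\<in>Fr. \<forall>i\<in>I. right_of (d i) (\<sigma> i) (\<beta> i (y i)) T"
    using esc(1)[of T] by blast
  \<comment> \<open>At each integer time some element of \<open>Fr\<close> works for the points on
    the rays \<nu>. One element works infinitely often, which is enough because
    \<open>ray_near_point\<close> asks only for arbitrarily late times.\<close>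
  have "\<exists>\<beta>\<in>Fr. infinite {t \<in> (UNIV::nat set). \<forall>i\<in>I. right_of (d i) (\<sigma> i) (\<beta> i (\<nu> i (real t))) T}"
  proof (rule pigeonhole_infinite_rel)
    show "\<forall>t\<in>UNIV. \<exists>\<beta>\<in>Fr. \<forall>i\<in>I. right_of (d i) (\<sigma> i) (\<beta> i (\<nu> i (real t))) T"
    proof
      fix t :: nat
      have "(\<lambda>i\<in>I. \<nu> i (real t)) \<in> PX" using \<nu>M by (intro PX_I) simp
      then show "\<exists>\<beta>\<in>Fr. \<forall>i\<in>I. right_of (d i) (\<sigma> i) (\<beta> i (\<nu> i (real t))) T"
        using Fr(3)[of "\<lambda>i\<in>I. \<nu> i (real t)"] by simp
    qed
  qed (use Fr in auto)
  then obtain \<beta> where \<beta>: "\<beta> \<in> \<Gamma>" and \<beta>inf: "infinite {t::nat. \<forall>i\<in>I. right_of (d i) (\<sigma> i) (\<beta> i (\<nu> i (real t))) T}"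
    using Fr(2) by auto
  have \<beta>r: "\<exists>t::nat. N \<le> real t \<and> (\<forall>i\<in>I. right_of (d i) (\<sigma> i) (\<beta> i (\<nu> i (real t))) T)" for N
  proof -
    obtain t where "nat \<lceil>N\<rceil> < t" "\<forall>i\<in>I. right_of (d i) (\<sigma> i) (\<beta> i (\<nu> i (real t))) T"
      using \<beta>inf unfolding infinite_nat_iff_unbounded by blast
    moreover from this have "N \<le> real t" by linarith
    ultimately show ?thesis by blast
  qed
  \<comment> \<open>\<open>C\<close> bounds how far the inverse of \<alpha> moves
    \<open>\<sigma> i 0\<close> from \<open>x i\<close>. It does not involve \<gamma>, which is
    chosen only after the neighbourhood; this is where finiteness of \<open>Fl\<close>
    enters.\<close>
  define C where "C = (\<Sum>i\<in>I. \<Sum>\<alpha>\<in>Fl. d i (iv \<alpha> i (\<sigma> i 0)) (x i))"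
  have dn: "0 \<le> d i a b" if "i \<in> I" for i a b using Metric_space.nonneg[OF metric_factor[OF that]] .
  have C: "d i (iv \<alpha> i (\<sigma> i 0)) (x i) \<le> C" if "i \<in> I" "\<alpha> \<in> Fl" for i \<alpha>
  proof -
    have "d i (iv \<alpha> i (\<sigma> i 0)) (x i) \<le> (\<Sum>\<alpha>\<in>Fl. d i (iv \<alpha> i (\<sigma> i 0)) (x i))"
      using that Fl(1) dn by (intro member_le_sum) auto
    also have "\<dots> \<le> C" unfolding C_def using that finite_I dn
      by (intro member_le_sum[of i I "\<lambda>i. \<Sum>\<alpha>\<in>Fl. d i (iv \<alpha> i (\<sigma> i 0)) (x i)"]) (auto intro: sum_nonneg)
    finally show ?thesis .
  qed
  have C0: "0 \<le> C" unfolding C_def using dn by (intro sum_nonneg) auto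
  define C4 where "C4 = 2 * (T + C) + 1"
  have C4: "0 \<le> C4" using T C0 by (simp add: C4_def)
  show "\<xi> \<in> A"
  proof (rule ccontr)
    assume "\<xi> \<notin> A"
    have "\<xi> \<in> topspace (furstenberg_topology I X d)"
      unfolding \<xi> topspace_furstenberg using cat0.ray_end_in_boundary[OF cat0_factor D(1)] by auto
    then have "\<xi> \<in> topspace (furstenberg_topology I X d) - A" using \<open>\<xi> \<notin> A\<close> by blast
    moreover have "openin (furstenberg_topology I X d) (topspace (furstenberg_topology I X d) - A)"
      using A by (simp add: nonempty_invariant_closed_def closedin_def)
    ultimately obtain W where W: "\<And>i. i \<in> I \<Longrightarrow> openin (boundary_topology (X i) (d i)) (W i)"
        "\<xi> \<in> PiE I W" "PiE I W \<inter> A = {}"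
    proof -
      assume "\<xi> \<in> topspace (furstenberg_topology I X d) - A"
        and "openin (furstenberg_topology I X d) (topspace (furstenberg_topology I X d) - A)"
      then obtain U where "\<forall>i\<in>I. openin (boundary_topology (X i) (d i)) (U i)" "\<xi> \<in> PiE I U"
          "PiE I U \<subseteq> topspace (furstenberg_topology I X d) - A"
        unfolding furstenberg_topology_def openin_product_topology_alt by meson
      then show ?thesis using that[of U] by blast
    qed
    have "\<exists>R>0. \<forall>\<eta>\<in>geom_boundary (X i) (d i). (\<exists>\<sigma>\<in>\<eta>. \<sigma> 0 = \<rho> i 0 \<and> d i (\<sigma> R) (\<rho> i R) < 1 / R) \<longrightarrow> \<eta> \<in> W i"
      if i: "i \<in> I" for i
      using cat0.boundary_topology_nbhd[OF cat0_factor[OF i] W(1)[OF i] _ D(1)[OF i] complete_factor[OF i]] W(2) i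
      by (auto simp: \<xi> PiE_def Pi_def)
    then obtain r where r: "\<And>i. i \<in> I \<Longrightarrow> 0 < r i"
      "\<And>i \<eta> \<sigma>. i \<in> I \<Longrightarrow> \<eta> \<in> geom_boundary (X i) (d i) \<Longrightarrow> \<sigma> \<in> \<eta> \<Longrightarrow> \<sigma> 0 = \<rho> i 0 \<Longrightarrow> d i (\<sigma> (r i)) (\<rho> i (r i)) < 1 / r i \<Longrightarrow> \<eta> \<in> W i"
      by metis
    \<comment> \<open>\<open>R\<close> makes a deviation of \<open>C4 + 2\<close> at time
      \<open>\<theta> i * R\<close> shrink below \<open>1 / r i\<close> at time \<open>r i\<close>,
      in all factors. Positivity of every \<theta> i, that is, regularity of the limit point, is
      used here.\<close>
    define R where "R = 1 + (\<Sum>i\<in>I. (r i * r i * (C4 + 2) + r i) / \<theta> i)"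
    have R: "0 < R" "r i \<le> \<theta> i * R" "r i * r i * (C4 + 2) < \<theta> i * R" if i: "i \<in> I" for i
    proof -
      have nn: "0 \<le> (r j * r j * (C4 + 2) + r j) / \<theta> j" if "j \<in> I" for j
        using r(1)[OF that] pos[OF that] C4 by (intro divide_nonneg_pos add_nonneg_nonneg mult_nonneg_nonneg) auto
      have "(r i * r i * (C4 + 2) + r i) / \<theta> i \<le> (\<Sum>i\<in>I. (r i * r i * (C4 + 2) + r i) / \<theta> i)"
        using i finite_I nn by (intro member_le_sum) auto
      then have le: "(r i * r i * (C4 + 2) + r i) / \<theta> i < R" unfolding R_def by linarith
      then show "0 < R" using nn[OF i] by linarith
      have "r i * r i * (C4 + 2) + r i < \<theta> i * R" using le pos[OF i] by (simp add: field_simps)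
      moreover have "0 \<le> r i * r i * (C4 + 2)" using r(1)[OF i] C4 by simp
      ultimately show "r i \<le> \<theta> i * R" "r i * r i * (C4 + 2) < \<theta> i * R" using r(1)[OF i] by linarith+
    qed
    have "R > 0 \<or> I = {}" using R(1) by blast
    moreover have "I \<noteq> {}" using D(3) by auto
    ultimately have R0: "0 < R" by blast
    have "Inr \<zeta> \<in> cone_nbhd PX PD c R 1" unfolding \<zeta>c using P.in_cone_nbhd_self[OF cray R0, of 1] by simp
    moreover have "openin (cone_topology PX PD) (cone_nbhd PX PD c R 1)" using P.openin_cone_nbhd[OF cray R0, of 1] by simp
    ultimately obtain \<gamma> where \<gamma>: "\<gamma> \<in> \<Gamma>" "Inl (prod_act I \<gamma> x) \<in> cone_nbhd PX PD c R 1"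
      using \<zeta>(1) unfolding geometric_limit_set_def in_closure_of by blast
    have \<gamma>x: "prod_act I \<gamma> x i = \<gamma> i (x i)" if "i \<in> I" for i using that by (simp add: prod_act_def)
    obtain \<alpha> where \<alpha>: "\<alpha> \<in> Fl" "\<And>i. i \<in> I \<Longrightarrow> left_of (d i) (\<sigma> i) (\<alpha> i (iv \<gamma> i (\<rho> i 0))) (- T)"
      using Fl(3)[of "\<lambda>i\<in>I. iv \<gamma> i (\<rho> i 0)"] PX_I[of "\<lambda>i. iv \<gamma> i (\<rho> i 0)"] in_factor[OF iv(1)[OF \<gamma>(1)]] y by auto
    have \<alpha>\<Gamma>: "\<alpha> \<in> \<Gamma>" using \<alpha>(1) Fl(2) by blast
    \<comment> \<open>\<open>q\<close> is \<gamma> composed with the inverse of \<alpha>. It takes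
      the left point \<open>a\<close> below back to the base point \<rho> i 0, and \<sigma> i 0 to
      within \<open>C\<close> of the orbit point \<gamma> i (x i).\<close>
    obtain q where q: "q \<in> \<Gamma>" "\<forall>i\<in>I. \<forall>z\<in>X i. q i z = \<gamma> i (iv \<alpha> i z)" using ex_comp[OF \<gamma>(1) iv(1)[OF \<alpha>\<Gamma>]] by blast
    obtain \<delta> where \<delta>: "\<delta> \<in> \<Gamma>" "\<forall>i\<in>I. \<forall>z\<in>X i. \<delta> i z = q i (\<beta> i z)" using ex_comp[OF q(1) \<beta>] by blast
    have \<delta>\<eta>: "furstenberg_act I X d \<delta> \<eta> = (\<lambda>i\<in>I. ray_end (X i) (d i) (\<delta> i \<circ> \<nu> i))"
      using furstenberg_act_rays[OF \<delta>(1) \<nu>(1)] \<eta>eq by simp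
    have "ray_end (X i) (d i) (\<delta> i \<circ> \<nu> i) \<in> W i" if i: "i \<in> I" for i
    proof -
      interpret cat0 "X i" "d i" using cat0_factor[OF i] .
      define \<mu> where "\<mu> = \<delta> i \<circ> \<nu> i"
      have \<mu>: "geodesic_ray (X i) (d i) \<mu>" unfolding \<mu>_def using isometric_ray[OF isometric[OF \<delta>(1) i] \<nu>(1)[OF i]] .
      obtain \<omega> where \<omega>: "geodesic_ray (X i) (d i) \<omega>" "\<omega> 0 = \<rho> i 0" "\<And>t. 0 \<le> t \<Longrightarrow> d i (\<omega> t) (\<mu> t) \<le> 2 * d i (\<mu> 0) (\<rho> i 0)"
        using asymptotic_ray_exists[OF complete_factor[OF i] \<mu> y[OF i]] by blast
      have as: "asymptotic (d i) \<omega> \<mu>" using \<omega>(3) unfolding asymptotic_def by blast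
      define s where "s = \<gamma> i (x i)"
      have s: "s \<in> X i" unfolding s_def using in_factor[OF \<gamma>(1) i xi[OF i]] .
      have near: "\<exists>t\<ge>N. \<exists>\<kappa>. geodesic_segment (X i) (d i) \<kappa> (\<omega> 0) (\<mu> t) \<and> (\<exists>u\<in>{0..d i (\<omega> 0) (\<mu> t)}. d i (\<kappa> u) s \<le> T + C)" for N
      proof -
        obtain t :: nat where t: "N \<le> real t" "right_of (d i) (\<sigma> i) (\<beta> i (\<nu> i (real t))) T" using \<beta>r[of N] i by blast
        define a b where "a = \<alpha> i (iv \<gamma> i (\<rho> i 0))" and "b = \<beta> i (\<nu> i (real t))"
        have ab: "a \<in> X i" "b \<in> X i" unfolding a_def b_def
          using in_factor \<alpha>\<Gamma> \<beta> iv(1)[OF \<gamma>(1)] y[OF i] \<nu>M[OF i] i by auto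
        obtain \<kappa> where \<kappa>: "geodesic_segment (X i) (d i) \<kappa> a b" using geodesic_exists[OF ab] by blast
        have line: "geodesic_line (X i) (d i) (\<sigma> i)" using con[OF i] by (simp add: contracting_line_def)
        have "left_of (d i) (\<sigma> i) a (0 - S i)" "right_of (d i) (\<sigma> i) b (0 + S i)"
          using left_of_mono[OF line ab(1) \<alpha>(2)[OF i, folded a_def], of "- S i"] right_of_mono[OF line ab(2) t(2)[folded b_def], of "S i"] S[OF i]
          by auto
        then obtain u where u: "u \<in> {0..d i a b}" "d i (\<kappa> u) (\<sigma> i 0) \<le> S i"
          using con[OF i] \<kappa> unfolding contracting_line_def by blast
        have ku: "\<kappa> u \<in> X i" using geodesic_segmentD(5)[OF \<kappa>] u(1) by auto
        have qa: "q i a = \<omega> 0"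
          using q(2) iv(2)[OF \<alpha>\<Gamma> i in_factor[OF iv(1)[OF \<gamma>(1)] i y[OF i]]] iv(2)[OF \<gamma>(1) i y[OF i]] ab(1) i \<omega>(2)
          by (simp add: a_def)
        have qb: "q i b = \<mu> (real t)" using \<delta>(2) \<nu>M[OF i] i by (simp add: b_def \<mu>_def)
        have seg: "geodesic_segment (X i) (d i) (q i \<circ> \<kappa>) (\<omega> 0) (\<mu> (real t))"
          using isometric_segment[OF isometric[OF q(1) i] \<kappa>] qa qb by simp
        have dq: "d i (\<omega> 0) (\<mu> (real t)) = d i a b" using dist_act[OF q(1) i ab] qa qb by simp
        have "d i (q i (\<kappa> u)) s \<le> d i (q i (\<kappa> u)) (q i (\<sigma> i 0)) + d i (q i (\<sigma> i 0)) s"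
          using in_factor[OF q(1) i] ku \<sigma>M[OF i] s by (intro triangle) auto
        also have "d i (q i (\<kappa> u)) (q i (\<sigma> i 0)) \<le> T" using dist_act[OF q(1) i ku \<sigma>M[OF i]] u(2) S[OF i] by simp
        also have "d i (q i (\<sigma> i 0)) s = d i (iv \<alpha> i (\<sigma> i 0)) (x i)"
          using q(2) \<sigma>M[OF i] i dist_act[OF \<gamma>(1) i in_factor[OF iv(1)[OF \<alpha>\<Gamma>] i \<sigma>M[OF i]] xi[OF i]] by (simp add: s_def)
        also have "\<dots> \<le> C" using C[OF i \<alpha>(1)] .
        finally have "d i ((q i \<circ> \<kappa>) u) s \<le> T + C" by simp
        then show ?thesis using seg u(1) dq t(1)
          by (intro exI[of _ "real t"] conjI exI[of _ "q i \<circ> \<kappa>"] bexI[of _ u]) auto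
      qed
      have \<omega>s: "d i (\<omega> (d i (\<omega> 0) s)) s \<le> C4"
        unfolding C4_def using ray_near_point[OF \<omega>(1) \<mu> as s _ near] T C0 by simp
      obtain \<kappa> where \<kappa>: "geodesic_segment (X i) (d i) \<kappa> (\<rho> i 0) s" using geodesic_exists[OF y[OF i] s] by blast
      obtain v where v: "v \<in> {0..d i (\<rho> i 0) s}" "d i (\<kappa> v) (\<rho> i (\<theta> i * R)) < 1"
        using cone_nbhd_component[OF dec R0 \<gamma>(2) i, of \<kappa>] \<kappa> \<gamma>x[OF i] by (auto simp: s_def)
      have \<theta>R: "0 \<le> \<theta> i * R" using pos[OF i] R0 by simp
      have M: "\<kappa> v \<in> X i" "\<rho> i (\<theta> i * R) \<in> X i" "\<omega> v \<in> X i" "\<omega> (\<theta> i * R) \<in> X i"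
        using geodesic_segmentD(5)[OF \<kappa>] v(1) geodesic_rayD(1)[OF D(1)[OF i] \<theta>R] geodesic_rayD(1)[OF \<omega>(1)] \<theta>R by auto
      \<comment> \<open>\<kappa> ends at \<open>s\<close>, and \<omega> is within \<open>C4\<close>
        of \<open>s\<close> at the same time. Going back towards the common starting point does not
        increase the distance.\<close>
      have "d i (\<kappa> v) (\<omega> v) \<le> C4"
      proof (cases "d i (\<rho> i 0) s = 0")
        case True
        then have "v = 0" using v(1) by auto
        then show ?thesis using geodesic_segmentD(3)[OF \<kappa>] \<omega>(2) y[OF i] C4 by simp
      next
        case False
        then have L: "0 < d i (\<rho> i 0) s" using nonneg[of "\<rho> i 0" s] by linarith
        have "d i (\<rho> i 0) s * d i (\<kappa> v) (\<omega> v) \<le> v * d i (\<kappa> (d i (\<rho> i 0) s)) (\<omega> (d i (\<rho> i 0) s))"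
          using ray_segment_diverge[OF \<omega>(1), of \<kappa> s v "d i (\<rho> i 0) s"] \<kappa> v(1) \<omega>(2) by simp
        also have "\<dots> \<le> d i (\<rho> i 0) s * C4"
          using v(1) \<omega>s \<omega>(2) geodesic_segmentD(4)[OF \<kappa>] by (intro mult_mono) (auto simp: commute)
        finally show ?thesis using L by simp
      qed
      \<comment> \<open>The unknown time \<open>v\<close> is pinned down by distances from the
        starting point. This costs 1, and the tolerance of the cone neighbourhood costs another 1,
        hence \<open>C4 + 2\<close>.\<close>
      moreover have "\<bar>v - \<theta> i * R\<bar> \<le> 1"
        using mdist_reverse_triangle[OF M(1) y[OF i] M(2)] v geodesic_subsegment(1)[OF \<kappa>, of v]
          ray_segment(1)[OF D(1)[OF i] \<theta>R] by (simp add: commute)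
      then have "d i (\<omega> (\<theta> i * R)) (\<omega> v) \<le> 1" using geodesic_rayD(2)[OF \<omega>(1) \<theta>R, of v] v(1) by (simp add: abs_minus_commute)
      ultimately have close: "d i (\<omega> (\<theta> i * R)) (\<rho> i (\<theta> i * R)) \<le> C4 + 2"
        using triangle[OF M(4,3,2)] triangle[OF M(3,1,2)] v(2) by (simp add: commute)
      have "\<theta> i * R * d i (\<omega> (r i)) (\<rho> i (r i)) \<le> r i * d i (\<omega> (\<theta> i * R)) (\<rho> i (\<theta> i * R))"
        using rays_diverge[OF \<omega>(1) D(1)[OF i] \<omega>(2) less_imp_le[OF r(1)[OF i]] R(2)[OF i]] .
      also have "\<dots> \<le> r i * (C4 + 2)" using close r(1)[OF i] by (intro mult_left_mono) auto
      also have "\<dots> < \<theta> i * R * (1 / r i)" using R(3)[OF i] r(1)[OF i] by (simp add: field_simps)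
      finally have "d i (\<omega> (r i)) (\<rho> i (r i)) < 1 / r i"
        by (rule mult_less_cancel_left_pos[THEN iffD1, rotated]) (use pos[OF i] R0 in simp)
      moreover have "\<omega> \<in> ray_end (X i) (d i) \<mu>" using \<omega>(1) asymptotic_sym[OF as] by (simp add: ray_end_def)
      ultimately show ?thesis using r(2)[of i "ray_end (X i) (d i) \<mu>" \<omega>] i ray_end_in_boundary[OF \<mu>] \<omega>(2) by (simp add: \<mu>_def)
    qed
    then have "furstenberg_act I X d \<delta> \<eta> \<in> PiE I W" unfolding \<delta>\<eta> by auto
    moreover have "furstenberg_act I X d \<delta> \<eta> \<in> A" using A \<eta> \<delta>(1) by (auto simp: nonempty_invariant_closed_def)
    ultimately show False using W(3) by blast
  qed
qed

text \<open>
  The points \<open>\<gamma> h\<^sup>k x\<close> with \<open>k\<close> large converge to a point whose slope is that of \<open>h\<close>, while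
  \<open>\<gamma>\<close> only affects the projection to the Furstenberg boundary.
\<close>

lemma orbit_closure_subset_limit_set:
  assumes h: "h \<in> \<Gamma>" and I: "I \<noteq> {}" and line: "\<And>i. i \<in> I \<Longrightarrow> geodesic_line (X i) (d i) (\<sigma> i)"
    and l: "\<And>i. i \<in> I \<Longrightarrow> 0 < l i" and sh: "\<And>i t. i \<in> I \<Longrightarrow> h i (\<sigma> i t) = \<sigma> i (t + l i)" and x: "x \<in> PX"
    and \<eta>: "\<eta> \<in> Abstract_Topology.closure_of (furstenberg_topology I X d)
      {furstenberg_act I X d \<gamma> (\<lambda>i\<in>I. ray_end (X i) (d i) (\<sigma> i)) |\<gamma>. \<gamma> \<in> \<Gamma>}"
  shows "\<eta> \<in> furstenberg_limit_set I X d \<Gamma> x"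
proof -
  interpret P: cat0 PX PD by (rule prod_cat0)
  have xi: "x i \<in> X i" if "i \<in> I" for i using PX_component[OF x that] .
  have \<sigma>M: "\<sigma> i t \<in> X i" if "i \<in> I" for i t using geodesic_lineD(1)[OF line[OF that]] .
  have \<sigma>ray: "geodesic_ray (X i) (d i) (\<sigma> i)" if "i \<in> I" for i using cat0.line_rays(1)[OF cat0_factor line] that by blast
  have \<eta>T: "\<eta> \<in> (\<Pi>\<^sub>E i\<in>I. geom_boundary (X i) (d i))" using \<eta> by (simp add: in_closure_of topspace_furstenberg)
  have "\<exists>c. geodesic_ray (X i) (d i) c \<and> c 0 = x i \<and> \<eta> i = ray_end (X i) (d i) c" if i: "i \<in> I" for i
  proof -
    interpret cat0 "X i" "d i" using cat0_factor[OF i] .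
    have B: "\<eta> i \<in> geom_boundary (X i) (d i)" using \<eta>T i by auto
    obtain c0 where "c0 \<in> \<eta> i" using boundary_nonempty[OF B] by blast
    note c0 = boundaryD[OF B this]
    obtain c where c: "geodesic_ray (X i) (d i) c" "c 0 = x i" "\<And>t. 0 \<le> t \<Longrightarrow> d i (c t) (c0 t) \<le> 2 * d i (c0 0) (x i)"
      using asymptotic_ray_exists[OF complete_factor[OF i] c0(1) xi[OF i]] by blast
    then have "asymptotic (d i) c c0" unfolding asymptotic_def by blast
    then show ?thesis using c c0 ray_end_eqI by blast
  qed
  then obtain \<rho> where \<rho>: "\<And>i. i \<in> I \<Longrightarrow> geodesic_ray (X i) (d i) (\<rho> i)" "\<And>i. i \<in> I \<Longrightarrow> \<rho> i 0 = x i"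
      "\<And>i. i \<in> I \<Longrightarrow> \<eta> i = ray_end (X i) (d i) (\<rho> i)" by metis
  \<comment> \<open>The translation length of \<open>h\<close> on the product. The quotients
    \<open>l i / n\<close> form the slope of its axes.\<close>
  define n where "n = L2_set l I"
  have n: "0 < n"
  proof -
    obtain i where i: "i \<in> I" using I by blast
    have "l i \<le> n" unfolding n_def using member_le_L2_set[OF finite_I i] .
    then show ?thesis using l[OF i] by linarith
  qed
  define \<theta> where "\<theta> i = l i / n" for i
  have \<theta>: "0 < \<theta> i" if "i \<in> I" for i using l[OF that] n by (simp add: \<theta>_def)
  define c where "c t = (\<lambda>i\<in>I. \<rho> i (\<theta> i * t))" for t
  have dec: "ray_decomposition I X d c \<theta> \<rho>"
  proof -
    have "(\<Sum>i\<in>I. (\<theta> i)\<^sup>2) = (\<Sum>i\<in>I. (l i)\<^sup>2) / n\<^sup>2" by (simp add: \<theta>_def power_divide sum_divide_distrib)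
    also have "(\<Sum>i\<in>I. (l i)\<^sup>2) = n\<^sup>2" by (simp add: n_def L2_set_def sum_nonneg)
    finally show ?thesis using n \<rho>(1) \<theta> less_imp_le unfolding ray_decomposition_def c_def by auto
  qed
  note cray = ray_decomposition_ray[OF dec]
  define \<zeta> where "\<zeta> = ray_end PX PD c"
  have \<zeta>B: "\<zeta> \<in> geom_boundary PX PD" unfolding \<zeta>_def using P.ray_end_in_boundary[OF cray] .
  have c\<zeta>: "c \<in> \<zeta>" unfolding \<zeta>_def using P.in_ray_end_self[OF cray] .
  have c0: "c 0 = x" using x \<rho>(2) by (auto simp: c_def prod_space_def PiE_def extensional_def fun_eq_iff)
  have reg: "\<zeta> \<in> regular_boundary I X d"
    unfolding regular_boundary_def has_slope_def using \<zeta>B c\<zeta> dec \<theta> by blast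
  have proj: "furstenberg_proj I X d \<zeta> = \<eta>"
    using furstenberg_proj_eq[OF \<zeta>B c\<zeta> dec \<theta>] \<rho>(3) \<eta>T by (auto simp: PiE_def intro!: extensionalityI[of _ I])
  have approx: "\<exists>\<gamma>\<in>\<Gamma>. Inl (prod_act I \<gamma> x) \<in> cone_nbhd PX PD c R (1 / R)" if R: "0 < R" for R
  proof -
    define e where "e = 1 / R / card I"
    have e: "0 < e" using R I finite_I by (simp add: e_def card_gt_0_iff)
    \<comment> \<open>Half of the tolerance is spent on replacing \<rho> by the ray \<omega> towards
      the translate of the attracting point, the other half on replacing \<omega> by the geodesic to
      the orbit point.\<close>
    define W where "W i = {\<xi> \<in> geom_boundary (X i) (d i). \<exists>\<omega>\<in>\<xi>. \<omega> 0 = \<rho> i 0 \<and> d i (\<omega> (\<theta> i * R)) (\<rho> i (\<theta> i * R)) < e / 2}" for i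
    have \<theta>R: "0 < \<theta> i * R" if "i \<in> I" for i using \<theta>[OF that] R by simp
    have "openin (boundary_topology (X i) (d i)) (W i)" if "i \<in> I" for i
      unfolding W_def using cat0.openin_boundary_topology_nbhd[OF cat0_factor[OF that] \<rho>(1)[OF that] \<theta>R[OF that], of "e / 2"] e by simp
    then have "openin (furstenberg_topology I X d) (PiE I W)"
      unfolding furstenberg_topology_def using finite_I by (simp add: openin_PiE_gen)
    moreover have "\<eta> i \<in> W i" if i: "i \<in> I" for i
    proof -
      interpret cat0 "X i" "d i" using cat0_factor[OF i] .
      show ?thesis unfolding W_def \<rho>(3)[OF i]
        using ray_end_in_boundary[OF \<rho>(1)[OF i]] in_ray_end_self[OF \<rho>(1)[OF i]] geodesic_rayD(1)[OF \<rho>(1)[OF i], of "\<theta> i * R"] \<theta>R[OF i] e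
        by (intro CollectI conjI bexI[of _ "\<rho> i"]) auto
    qed
    then have "\<eta> \<in> PiE I W" using \<eta>T by (auto simp: PiE_def)
    ultimately obtain \<gamma> where \<gamma>: "\<gamma> \<in> \<Gamma>" "furstenberg_act I X d \<gamma> (\<lambda>i\<in>I. ray_end (X i) (d i) (\<sigma> i)) \<in> PiE I W"
      using \<eta> unfolding in_closure_of by blast
    have \<gamma>W: "ray_end (X i) (d i) (\<gamma> i \<circ> \<sigma> i) \<in> W i" if "i \<in> I" for i
      using \<gamma>(2) that furstenberg_act_rays[OF \<gamma>(1) \<sigma>ray] by auto
    have "\<exists>\<omega>. geodesic_ray (X i) (d i) \<omega> \<and> asymptotic (d i) (\<gamma> i \<circ> \<sigma> i) \<omega> \<and> \<omega> 0 = x i \<and> d i (\<omega> (\<theta> i * R)) (\<rho> i (\<theta> i * R)) < e / 2" if "i \<in> I" for i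
      using \<gamma>W[OF that] \<rho>(2)[OF that] by (auto simp: W_def ray_end_def)
    then obtain \<omega> where \<omega>: "\<And>i. i \<in> I \<Longrightarrow> geodesic_ray (X i) (d i) (\<omega> i)" "\<And>i. i \<in> I \<Longrightarrow> asymptotic (d i) (\<gamma> i \<circ> \<sigma> i) (\<omega> i)"
        "\<And>i. i \<in> I \<Longrightarrow> \<omega> i 0 = x i" "\<And>i. i \<in> I \<Longrightarrow> d i (\<omega> i (\<theta> i * R)) (\<rho> i (\<theta> i * R)) < e / 2" by metis
    have "\<exists>\<mu>\<in>\<Gamma>. \<forall>i\<in>I. \<forall>y\<in>X i. \<mu> i y = \<gamma> i ((h i ^^ k) y)" for k
      using ex_power[OF h, of k] ex_comp[OF \<gamma>(1)] funpow_in_factor[OF h] by metis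
    then obtain \<mu> where \<mu>: "\<And>k. \<mu> k \<in> \<Gamma>" "\<And>k i y. i \<in> I \<Longrightarrow> y \<in> X i \<Longrightarrow> \<mu> k i y = \<gamma> i ((h i ^^ k) y)" by metis
    define z where "z k = prod_act I (\<mu> k) x" for k
    have zi: "z k i = \<gamma> i ((h i ^^ k) (x i))" if "i \<in> I" for k i using \<mu>(2)[OF that xi[OF that]] that by (simp add: z_def prod_act_def)
    have zX: "z k i \<in> X i" if "i \<in> I" for k i unfolding zi[OF that] using in_factor[OF \<gamma>(1)] funpow_in_factor[OF h] xi that by blast
    have zPX: "z k \<in> PX" for k using in_factor[OF \<mu>(1)] xi unfolding z_def prod_act_def by (intro PX_I) blast
    \<comment> \<open>\<open>h ^^ k\<close> shifts \<sigma> i by \<open>real k * l i\<close>, so the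
      orbit points follow the translated axis at bounded distance, and hence follow \<omega> i with
      the speed \<open>l i\<close>.\<close>
    have "\<exists>G. \<forall>k. d i (z k i) (\<omega> i (real k * l i)) \<le> G" if i: "i \<in> I" for i
    proof -
      interpret cat0 "X i" "d i" using cat0_factor[OF i] .
      obtain C where C: "\<And>t. 0 \<le> t \<Longrightarrow> d i (\<gamma> i (\<sigma> i t)) (\<omega> i t) \<le> C" using \<omega>(2)[OF i] by (auto simp: asymptotic_def)
      have "d i (z k i) (\<omega> i (real k * l i)) \<le> d i (x i) (\<sigma> i 0) + C" for k
      proof -
        have kl: "0 \<le> real k * l i" using l[OF i] by simp
        have "d i (z k i) (\<gamma> i (\<sigma> i (real k * l i))) = d i ((h i ^^ k) (x i)) ((h i ^^ k) (\<sigma> i 0))"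
          unfolding zi[OF i] funpow_shift[of "h i" "\<sigma> i" "l i" k, OF sh[OF i]]
          using dist_act[OF \<gamma>(1) i funpow_in_factor[OF h i xi[OF i]] \<sigma>M[OF i]] by simp
        also have "\<dots> = d i (x i) (\<sigma> i 0)"
          using funpow_isometric[OF isometric[OF h i], of k] xi[OF i] \<sigma>M[OF i] by (simp add: isometric_map_def)
        finally show ?thesis
          using triangle[OF zX[OF i] in_factor[OF \<gamma>(1) i \<sigma>M[OF i]] geodesic_rayD(1)[OF \<omega>(1)[OF i] kl], of k "real k * l i"] C[OF kl]
          by simp
      qed
      then show ?thesis by blast
    qed
    then obtain G where G: "\<And>i k. i \<in> I \<Longrightarrow> d i (z k i) (\<omega> i (real k * l i)) \<le> G i" by metis
    define L where "L i k = d i (x i) (z k i)" for i k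
    define N where "N k = PD x (z k)" for k
    have Lk: "\<bar>L i k - real k * l i\<bar> \<le> G i" if i: "i \<in> I" for i k
    proof -
      interpret cat0 "X i" "d i" using cat0_factor[OF i] .
      have kl: "0 \<le> real k * l i" using l[OF i] by simp
      show ?thesis
        using mdist_reverse_triangle[OF zX[OF i] xi[OF i] geodesic_rayD(1)[OF \<omega>(1)[OF i] kl], of k] G[OF i, of k]
          ray_segment(1)[OF \<omega>(1)[OF i] kl] \<omega>(3)[OF i] by (simp add: L_def commute)
    qed
    have Llim: "(\<lambda>k. L i k / real k) \<longlonglongrightarrow> l i" if i: "i \<in> I" for i
    proof (rule LIM_zero_cancel, rule Lim_null_comparison)
      show "\<forall>\<^sub>F k in sequentially. norm (L i k / real k - l i) \<le> G i / real k"
      proof (intro eventually_sequentiallyI[of 1])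
        fix k :: nat assume k: "1 \<le> k"
        then have "L i k / real k - l i = (L i k - real k * l i) / real k" by (simp add: field_simps)
        then show "norm (L i k / real k - l i) \<le> G i / real k" using Lk[OF i, of k] k by (simp add: divide_right_mono)
      qed
      show "(\<lambda>k. G i / real k) \<longlonglongrightarrow> 0" by (rule lim_const_over_n)
    qed
    have Neq: "N k / real k = L2_set (\<lambda>i. L i k / real k) I" for k
      using L2_set_right_distrib[of "1 / real k" "\<lambda>i. L i k" I] by (simp add: N_def prod_distance_L2 L_def)
    have Nlim: "(\<lambda>k. N k / real k) \<longlonglongrightarrow> n"
      unfolding Neq n_def L2_set_def by (intro tendsto_intros Llim)
    have Ninf: "filterlim N at_top sequentially"
    proof -
      have "filterlim (\<lambda>k. (N k / real k) * real k) at_top sequentially"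
        using filterlim_tendsto_pos_mult_at_top[OF Nlim n filterlim_real_sequentially] .
      moreover have "N k / real k * real k \<le> N k" for k by (simp add: N_def)
      ultimately show ?thesis by (rule filterlim_at_top_mono[OF _ always_eventually[OF allI]])
    qed
    \<comment> \<open>The first term is the deviation \<open>2 * \<bar>G i\<bar>\<close> at the end
      of the factor geodesic, scaled back to the time of interest. The second is the discrepancy
      between the speed of that component and \<theta> i.\<close>
    have small: "\<forall>\<^sub>F k in sequentially. 2 * \<bar>G i\<bar> * R / N k + \<bar>R * L i k / N k - \<theta> i * R\<bar> < e / 2" if i: "i \<in> I" for i
    proof (rule order_tendstoD(2))
      have "(\<lambda>k. (L i k / real k) / (N k / real k)) \<longlonglongrightarrow> l i / n" using n by (intro tendsto_intros Llim[OF i] Nlim) simp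
      moreover have "\<forall>\<^sub>F k in sequentially. (L i k / real k) / (N k / real k) = L i k / N k"
        by (intro eventually_sequentiallyI[of 1]) simp
      ultimately have "(\<lambda>k. L i k / N k) \<longlonglongrightarrow> \<theta> i" unfolding \<theta>_def by (rule Lim_transform_eventually)
      then have "(\<lambda>k. R * (L i k / N k)) \<longlonglongrightarrow> R * \<theta> i" by (intro tendsto_intros)
      then have "(\<lambda>k. \<bar>R * L i k / N k - \<theta> i * R\<bar>) \<longlonglongrightarrow> \<bar>R * \<theta> i - \<theta> i * R\<bar>" by (intro tendsto_intros) simp
      moreover have "(\<lambda>k. 2 * \<bar>G i\<bar> * R / N k) \<longlonglongrightarrow> 0" using Ninf by (intro real_tendsto_divide_at_top[OF tendsto_const])
      ultimately show "(\<lambda>k. 2 * \<bar>G i\<bar> * R / N k + \<bar>R * L i k / N k - \<theta> i * R\<bar>) \<longlonglongrightarrow> 0 + \<bar>R * \<theta> i - \<theta> i * R\<bar>" by (intro tendsto_add)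
    qed (use e in \<open>simp add: mult.commute\<close>)
    have "\<forall>\<^sub>F k in sequentially. (\<forall>i\<in>I. 2 * \<bar>G i\<bar> * R / N k + \<bar>R * L i k / N k - \<theta> i * R\<bar> < e / 2) \<and> R < N k"
      using small finite_I Ninf by (intro eventually_conj) (simp_all add: eventually_ball_finite filterlim_at_top_dense)
    then obtain k where k: "\<And>i. i \<in> I \<Longrightarrow> 2 * \<bar>G i\<bar> * R / N k + \<bar>R * L i k / N k - \<theta> i * R\<bar> < e / 2" "R < N k"
      by (auto simp: eventually_sequentially)
    obtain \<kappa> where \<kappa>: "\<And>i. i \<in> I \<Longrightarrow> geodesic_segment (X i) (d i) (\<kappa> i) (x i) (z k i)"
      using factor_geodesics[OF x zPX] by blast
    have "Inl (z k) \<in> cone_nbhd PX PD c R (1 / R)"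
    proof (rule in_cone_nbhdI[OF dec R zPX _ _ _ I])
      show "R < PD (c 0) (z k)" using k(2) c0 by (simp add: N_def)
      show "geodesic_segment (X i) (d i) (\<kappa> i) (\<rho> i 0) (z k i)" if "i \<in> I" for i using \<kappa>[OF that] \<rho>(2)[OF that] by simp
      fix i assume i: "i \<in> I"
      interpret cat0 "X i" "d i" using cat0_factor[OF i] .
      \<comment> \<open>The time on the factor geodesic at which the product geodesic has reached
        time \<open>R\<close>.\<close>
      define s where "s = R * L i k / N k"
      have N0: "0 < N k" using k(2) R by simp
      have s: "0 \<le> s" "s \<le> L i k"
      proof -
        show "0 \<le> s" using R N0 by (simp add: s_def L_def)
        have "R / N k * L i k \<le> 1 * L i k" using k(2) N0 by (intro mult_right_mono) (auto simp: L_def)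
        then show "s \<le> L i k" by (simp add: s_def)
      qed
      have kl: "0 \<le> real k * l i" using l[OF i] by simp
      have L0: "0 \<le> L i k" by (simp add: L_def)
      have M: "\<kappa> i s \<in> X i" "\<omega> i s \<in> X i" "\<omega> i (\<theta> i * R) \<in> X i" "\<rho> i (\<theta> i * R) \<in> X i" "\<omega> i (real k * l i) \<in> X i" "\<omega> i (L i k) \<in> X i"
        using geodesic_segmentD(5)[OF \<kappa>[OF i]] s geodesic_rayD(1)[OF \<omega>(1)[OF i]] geodesic_rayD(1)[OF \<rho>(1)[OF i]] \<theta>R[OF i] kl L0
        by (auto simp: L_def)
      have "d i (\<kappa> i (L i k)) (\<omega> i (L i k)) \<le> 2 * \<bar>G i\<bar>"
        using triangle[OF zX[OF i] M(5,6), of k] G[OF i, of k] geodesic_rayD(2)[OF \<omega>(1)[OF i] kl L0] Lk[OF i, of k]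
          geodesic_segmentD(4)[OF \<kappa>[OF i]] by (simp add: L_def abs_minus_commute)
      then have *: "L i k * d i (\<kappa> i s) (\<omega> i s) \<le> s * (2 * \<bar>G i\<bar>)"
        using ray_segment_diverge[OF \<omega>(1)[OF i], of "\<kappa> i" "z k i" s "L i k"] \<kappa>[OF i] \<omega>(3)[OF i] s
        by (simp add: L_def) (meson mult_left_mono order_trans)
      have "d i (\<kappa> i s) (\<omega> i s) \<le> 2 * \<bar>G i\<bar> * R / N k"
      proof (cases "L i k = 0")
        case True
        then have "s = 0" using s by simp
        then show ?thesis using geodesic_segmentD(3)[OF \<kappa>[OF i]] \<omega>(3)[OF i] xi[OF i] R N0 by simp
      next
        case False
        then have "0 < L i k" using L0 by simp
        then show ?thesis using * N0 by (simp add: s_def field_simps)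
      qed
      moreover have "d i (\<omega> i s) (\<omega> i (\<theta> i * R)) = \<bar>s - \<theta> i * R\<bar>"
        using geodesic_rayD(2)[OF \<omega>(1)[OF i] s(1), of "\<theta> i * R"] \<theta>R[OF i] by simp
      ultimately have "d i (\<kappa> i s) (\<rho> i (\<theta> i * R)) < e"
        using triangle[OF M(1,2,4)] triangle[OF M(2,3,4)] \<omega>(4)[OF i] k(1)[OF i] by (simp add: s_def)
      moreover have "R / PD (c 0) (z k) * d i (\<rho> i 0) (z k i) = s" using c0 \<rho>(2)[OF i] by (simp add: s_def L_def N_def)
      ultimately show "d i (\<kappa> i (R / PD (c 0) (z k) * d i (\<rho> i 0) (z k i))) (\<rho> i (\<theta> i * R)) < 1 / R / real (card I)"
        by (simp add: e_def)
    qed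
    then show ?thesis using \<mu>(1) by (auto simp: z_def)
  qed
  have "Inr \<zeta> \<in> Abstract_Topology.closure_of (cone_topology PX PD) (Inl ` {prod_act I \<gamma> x |\<gamma>. \<gamma> \<in> \<Gamma>})"
    unfolding in_closure_of
  proof (intro conjI allI impI)
    show "Inr \<zeta> \<in> topspace (cone_topology PX PD)"
      using openin_subset[OF P.openin_cone_nbhd[OF cray, of 1 1]] P.in_cone_nbhd_self[OF cray, of 1 1] by (auto simp: \<zeta>_def)
    fix T assume "Inr \<zeta> \<in> T \<and> openin (cone_topology PX PD) T"
    then have T: "openin (cone_topology PX PD) T" "Inr (ray_end PX PD c) \<in> T" by (simp_all add: \<zeta>_def)
    obtain R where R: "0 < R" "\<forall>a\<in>cone_nbhd PX PD c R (1 / R). a \<in> range Inl \<longrightarrow> a \<in> T"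
      using P.cone_topology_nbhd[OF T(1) cray T(2)] by blast
    obtain \<gamma> where "\<gamma> \<in> \<Gamma>" "Inl (prod_act I \<gamma> x) \<in> cone_nbhd PX PD c R (1 / R)" using approx[OF R(1)] by blast
    then show "\<exists>y. y \<in> Inl ` {prod_act I \<gamma> x |\<gamma>. \<gamma> \<in> \<Gamma>} \<and> y \<in> T" using R(2) by blast
  qed
  then show ?thesis
    unfolding furstenberg_limit_set_def geometric_limit_set_def using \<zeta>B reg proj by blast
qed

end

theorem theorem5p1:
  fixes r :: nat
    and X :: "nat \<Rightarrow> 'a set"
    and d :: "nat \<Rightarrow> 'a \<Rightarrow> 'a \<Rightarrow> real"
    and \<Gamma> :: "(nat \<Rightarrow> 'a \<Rightarrow> 'a) set"
    and x :: "nat \<Rightarrow> 'a"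
  assumes "1 \<le> r"
    and "\<And>i. i \<in> {1..r} \<Longrightarrow> hadamard_space (X i) (d i)"
    and "\<And>i. i \<in> {1..r} \<Longrightarrow> locally_compact_space (Metric_space.mtopology (X i) (d i))"
    and "subgroup \<Gamma> (prod_isometries {1..r} X d)"
    and "properly_discontinuous {1..r} X d \<Gamma>"
    and "\<exists>g\<in>\<Gamma>. \<exists>h\<in>\<Gamma>. independent_regular_axial {1..r} X d g h"
    and "x \<in> prod_space {1..r} X"
  shows "nonempty_invariant_closed {1..r} X d \<Gamma> (furstenberg_limit_set {1..r} X d \<Gamma> x) \<and>
    (\<forall>A. nonempty_invariant_closed {1..r} X d \<Gamma> A \<longrightarrow>
       furstenberg_limit_set {1..r} X d \<Gamma> x \<subseteq> A)"
proof -
  define I where "I = {1..r}"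
  have I: "finite I" "I \<noteq> {}" using assms(1) by (auto simp: I_def)
  note hyps = assms[folded I_def]
  interpret product_action I X d \<Gamma>
  proof (intro product_action.intro cat0_product.intro product_action_axioms.intro)
    show "cat0 (X i) (d i)" "Metric_space.mcomplete (X i) (d i)" if "i \<in> I" for i
      using hyps(2)[OF that] by (auto simp: hadamard_space_def CAT0_space_imp_cat0)
  qed (fact I(1) hyps(4))+
  obtain g h where gh: "g \<in> \<Gamma>" "h \<in> \<Gamma>" "independent_regular_axial I X d g h" using hyps(6) by blast
  have "\<forall>i\<in>I. \<exists>\<tau> \<sigma> m l T S. contracting_line (X i) (d i) \<tau> T \<and> contracting_line (X i) (d i) \<sigma> S \<and> 0 < m \<and> 0 < l \<and>
    (\<forall>t. g i (\<tau> t) = \<tau> (t + m)) \<and> (\<forall>t. h i (\<sigma> t) = \<sigma> (t + l)) \<and>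
    \<not> asymptotic (d i) \<sigma> \<tau> \<and> \<not> asymptotic (d i) \<sigma> (\<lambda>t. \<tau> (- t)) \<and>
    \<not> asymptotic (d i) (\<lambda>t. \<sigma> (- t)) \<tau> \<and> \<not> asymptotic (d i) (\<lambda>t. \<sigma> (- t)) (\<lambda>t. \<tau> (- t))"
    using independent_axes[OF hyps(2,3)] gh(3) unfolding independent_regular_axial_def by blast
  then obtain \<tau> \<sigma> m l T S where ax: "\<forall>i\<in>I. contracting_line (X i) (d i) (\<tau> i) (T i) \<and> contracting_line (X i) (d i) (\<sigma> i) (S i) \<and>
    0 < m i \<and> 0 < l i \<and> (\<forall>t. g i (\<tau> i t) = \<tau> i (t + m i)) \<and> (\<forall>t. h i (\<sigma> i t) = \<sigma> i (t + l i)) \<and>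
    \<not> asymptotic (d i) (\<sigma> i) (\<tau> i) \<and> \<not> asymptotic (d i) (\<sigma> i) (\<lambda>t. \<tau> i (- t)) \<and>
    \<not> asymptotic (d i) (\<lambda>t. \<sigma> i (- t)) (\<tau> i) \<and> \<not> asymptotic (d i) (\<lambda>t. \<sigma> i (- t)) (\<lambda>t. \<tau> i (- t))"
    unfolding bchoice_iff by blast
  have esc: "\<exists>F. finite F \<and> F \<subseteq> \<Gamma> \<and> (\<forall>y\<in>PX. \<exists>\<alpha>\<in>F. \<forall>i\<in>I. right_of (d i) (\<sigma> i) (\<alpha> i (y i)) R)"
    "\<exists>F. finite F \<and> F \<subseteq> \<Gamma> \<and> (\<forall>y\<in>PX. \<exists>\<alpha>\<in>F. \<forall>i\<in>I. left_of (d i) (\<sigma> i) (\<alpha> i (y i)) (- R))" for R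
    by (rule escape_right[of g h l m \<sigma> S \<tau> T], use gh ax in simp_all)
      (rule escape_left[of g h l m \<sigma> S \<tau> T], use gh ax in simp_all)
  have minimal: "furstenberg_limit_set I X d \<Gamma> x \<subseteq> A" if "nonempty_invariant_closed I X d \<Gamma> A" for A
    using limit_set_subset_closed[OF _ esc that hyps(7)] ax by blast
  have line: "geodesic_line (X i) (d i) (\<sigma> i)" if "i \<in> I" for i using ax that by (auto simp: contracting_line_def)
  have ray: "geodesic_ray (X i) (d i) (\<sigma> i)" if "i \<in> I" for i using cat0.line_rays(1)[OF cat0_factor line] that by blast
  define hp where "hp = (\<lambda>i\<in>I. ray_end (X i) (d i) (\<sigma> i))"
  define Orb where "Orb = {furstenberg_act I X d \<gamma> hp |\<gamma>. \<gamma> \<in> \<Gamma>}"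
  define C where "C = Abstract_Topology.closure_of (furstenberg_topology I X d) Orb"
  have hp_top: "hp \<in> topspace (furstenberg_topology I X d)"
    unfolding hp_def topspace_furstenberg using cat0.ray_end_in_boundary[OF cat0_factor ray] by auto
  have Orb_top: "Orb \<subseteq> topspace (furstenberg_topology I X d)"
    unfolding Orb_def using hp_top continuous_map_image_subset_topspace[OF continuous_furstenberg_act] by blast
  have inv: "furstenberg_act I X d \<delta> ` Orb \<subseteq> Orb" if \<delta>: "\<delta> \<in> \<Gamma>" for \<delta>
  proof clarify
    fix \<xi> assume "\<xi> \<in> Orb"
    then obtain \<gamma> where \<gamma>: "\<gamma> \<in> \<Gamma>" "\<xi> = furstenberg_act I X d \<gamma> hp" by (auto simp: Orb_def)
    obtain \<mu> where \<mu>: "\<mu> \<in> \<Gamma>" "\<forall>i\<in>I. \<forall>y\<in>X i. \<mu> i y = \<delta> i (\<gamma> i y)" using ex_comp[OF \<delta> \<gamma>(1)] by blast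
    have act: "furstenberg_act I X d \<gamma> hp = (\<lambda>i\<in>I. ray_end (X i) (d i) (\<gamma> i \<circ> \<sigma> i))" if "\<gamma> \<in> \<Gamma>" for \<gamma>
      unfolding hp_def using that ray by (rule furstenberg_act_rays)
    have "furstenberg_act I X d \<delta> \<xi> = (\<lambda>i\<in>I. ray_end (X i) (d i) (\<delta> i \<circ> (\<gamma> i \<circ> \<sigma> i)))"
      unfolding \<gamma>(2) act[OF \<gamma>(1)]
      by (rule furstenberg_act_rays[OF \<delta>]) (rule cat0.isometric_ray[OF cat0_factor isometric[OF \<gamma>(1)] ray])
    also have "\<dots> = (\<lambda>i\<in>I. ray_end (X i) (d i) (\<mu> i \<circ> \<sigma> i))"
    proof (rule restrict_ext)
      fix i assume i: "i \<in> I"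
      have "\<delta> i \<circ> (\<gamma> i \<circ> \<sigma> i) = \<mu> i \<circ> \<sigma> i" using \<mu>(2) i geodesic_lineD(1)[OF line[OF i]] by (simp add: fun_eq_iff)
      then show "ray_end (X i) (d i) (\<delta> i \<circ> (\<gamma> i \<circ> \<sigma> i)) = ray_end (X i) (d i) (\<mu> i \<circ> \<sigma> i)" by simp
    qed
    also have "\<dots> = furstenberg_act I X d \<mu> hp" using act[OF \<mu>(1)] by simp
    finally show "furstenberg_act I X d \<delta> \<xi> \<in> Orb" using \<mu>(1) by (auto simp: Orb_def)
  qed
  have C: "nonempty_invariant_closed I X d \<Gamma> C"
    unfolding nonempty_invariant_closed_def
  proof (intro conjI ballI)
    show "closedin (furstenberg_topology I X d) C" unfolding C_def by (rule closedin_closure_of)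
    have "furstenberg_act I X d g hp \<in> Orb" using gh(1) by (auto simp: Orb_def)
    then show "C \<noteq> {}" unfolding C_def using closure_of_subset[OF Orb_top] by blast
    fix \<delta> assume \<delta>: "\<delta> \<in> \<Gamma>"
    have "furstenberg_act I X d \<delta> ` C \<subseteq> Abstract_Topology.closure_of (furstenberg_topology I X d) (furstenberg_act I X d \<delta> ` Orb)"
      unfolding C_def by (rule continuous_map_image_closure_subset[OF continuous_furstenberg_act[OF \<delta>]])
    also have "\<dots> \<subseteq> C" unfolding C_def by (rule closure_of_mono[OF inv[OF \<delta>]])
    finally show "furstenberg_act I X d \<delta> ` C \<subseteq> C" .
  qed
  have "C \<subseteq> furstenberg_limit_set I X d \<Gamma> x"
  proof
    fix \<eta> assume "\<eta> \<in> C"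
    then show "\<eta> \<in> furstenberg_limit_set I X d \<Gamma> x"
      using orbit_closure_subset_limit_set[of h \<sigma> l x \<eta>] gh(2) I(2) line ax hyps(7)
      unfolding C_def Orb_def hp_def by blast
  qed
  \<comment> \<open>Minimality, applied to the closed invariant set \<open>C\<close> itself, gives
    the remaining inclusion. Closedness, invariance and nonemptiness of the limit set are then those
    of \<open>C\<close>.\<close>
  then have "furstenberg_limit_set I X d \<Gamma> x = C" using minimal[OF C] by blast
  then show ?thesis using C minimal unfolding I_def by simp
qed

end
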